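(* Let $V>0$ and consider, for $\alpha,\beta,\nu>0$ and with $\sigma=\frac{\beta(\nu+1)}{\nu}$, the dynamical system $$\dot\alpha=-\mathbb E\left[\tfrac{\partial K}{\partial\alpha}\right],\quad \dot\beta=-\mathbb E\left[\tfrac{\partial K}{\partial\beta}\right],\quad \dot\nu=-\mathbb E\left[\tfrac{\partial K}{\partial\nu}\right]\qquad(\ast)$$ whose right-hand sides, as well as the functions $A(\alpha)$ and $\sigma_\varkappa(\alpha)$, are given in the context. Then the following hold. 1. There is a smooth increasing function $\sigma_*(\alpha)$, $\alpha>0$, such that (a) $\dot\alpha=0$ on the curve $(\alpha,\sigma_*(\alpha))$, i.e. whenever $\sigma=\sigma_*(\alpha)$; (b) $\lim_{\alpha\to0}\sigma_*(\alpha)=0$ and $\lim_{\alpha\to\infty}\sigma_*(\alpha)=\infty$; (c) $\sigma_*(\alpha)<\sigma_0(\alpha)$ for all $\alpha>0$; (d) for any $\varkappa>0$ there exists $\alpha_\varkappa>0$ such that $\sigma_*(\alpha)>\sigma_\varkappa(\alpha)$ for all $\alpha>\alpha_\varkappa$; (e) the region $$\mathbf S_*:=\left\{(\alpha,\beta,\nu)\in\mathbb R^3:\ \alpha,\beta,\nu>0\ \text{and}\ \sigma_*(\alpha)<\frac{\beta(\nu+1)}{\nu}<\sigma_0(\alpha)\right\}$$ is forward invariant for system $(\ast)$. 2. For any $\alpha(0),\beta(0),\nu(0)>0$, there exists a time moment $t_0$ depending on the initial condition such that for all $t>t_0$ we have $(\alpha(t),\beta(t),\nu(t))\in\mathbf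 S_*$, $\dot\alpha(t),\dot\beta(t)>0$ and $\dot\nu(t)<0$. 3. For any $\alpha(0),\beta(0),\nu(0)>0$, there is $C>0$ depending on the initial conditions such that the points $(\nu(t),\beta(t))$ for all $t\ge0$ lie on the integral curve $$\beta^2+\nu^2+\frac{2\nu^3}{3}=C$$ of the equation $\dfrac{d\beta}{d\nu}=-\dfrac{\nu(\nu+1)}{\beta}$. 4. For any $\alpha(0),\beta(0),\nu(0)>0$, we have $$\alpha(t)\to\infty,\quad A(\alpha(t))\to1,\quad \nu(t)\to0,\quad \beta(t)\to\beta_*\qquad\text{as }t\to\infty,$$ where $\beta_*:=\left(\beta^2(0)+\nu^2(0)+\frac{2\nu^3(0)}{3}\right)^{1/2}$.
   Context: The right-hand sides are, with $\sigma=\beta(\nu+1)/\nu$ and $\Psi=\Gamma'/\Gamma$ the digamma function, $$\mathbb E\left[\tfrac{\partial K}{\partial\alpha}\right]=\frac1{(2\pi)^{1/2}}\int_{-\infty}^\infty\ln\left(1+\frac V\sigma\frac{z^2}2\right)e^{-z^2/2}dz+\Psi(\alpha)-\Psi\left(\alpha+\tfrac12\right),$$ $$\mathbb E\left[\tfrac{\partial K}{\partial\beta}\right]=\frac1\beta\left(\frac{\alpha+1/2}{(2\pi)^{1/2}}\int_{-\infty}^\infty\frac{1}{1+\frac V\sigma\frac{z^2}2}e^{-z^2/2}dz-\alpha\right),$$ $$\mathbb E\left[\tfrac{\partial K}{\partial\nu}\right]=\frac1{2\nu(\nu+1)}\left(\frac{2\alpha+1}{(2\pi)^{1/2}}\int_{-\infty}^\infty\frac{z^2}{\frac{2\sigma}{V}+z^2}e^{-z^2/2}dz-1\right).$$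 (They arise from the Kullback--Leibler divergence $K$ from a normal-gamma posterior to a normal-gamma prior with parameters $m,\nu,\alpha,\beta$, differentiated with the posterior parameters held fixed and averaged over a normal observation $\mathbf y$ of variance $V$, under the assumption $m=\mathbb E[\mathbf y]$.) For $x>0$ let $F(x)=\frac1{(2\pi)^{1/2}}\int_{-\infty}^\infty\frac1{2x+z^2}e^{-z^2/2}dz$. For $\alpha>0$, $A=A(\alpha)<\alpha$ is the unique root of $F(\alpha-A)=\frac{\alpha}{(2\alpha+1)(\alpha-A)}$. For $\varkappa\ge0$, $\sigma_\varkappa(\alpha):=\left(1-\frac\varkappa\alpha\right)(\alpha-A(\alpha))V$, $\alpha>0$; in particular $\sigma_0(\alpha)=(\alpha-A(\alpha))V$. *)

theory Defs
  imports "HOL-Analysis.Analysis"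
begin

definition sig :: "real \<Rightarrow> real \<Rightarrow> real" where
  "sig \<beta> \<nu> = \<beta> * (\<nu> + 1) / \<nu>"

text \<open>The averaged partial derivatives of the Kullback--Leibler divergence \<open>K\<close>
  from a normal-gamma posterior to the normal-gamma prior with parameters
  \<open>m, \<nu>, \<alpha>, \<beta>\<close>, for a normal observation of mean \<open>m\<close> and variance \<open>V\<close>, in explicit form.\<close>

definition E_dK_dalpha :: "real \<Rightarrow> real \<Rightarrow> real \<Rightarrow> real \<Rightarrow> real" where
  "E_dK_dalpha V \<alpha> \<beta> \<nu> =
     1 / sqrt (2 * pi) *
       (LBINT z. ln (1 + V / sig \<beta> \<nu> * (z\<^sup>2 / 2)) * exp (- z\<^sup>2 / 2))
     + Digamma \<alpha> - Digamma (\<alpha> + 1 / 2)"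

definition E_dK_dbeta :: "real \<Rightarrow> real \<Rightarrow> real \<Rightarrow> real \<Rightarrow> real" where
  "E_dK_dbeta V \<alpha> \<beta> \<nu> =
     1 / \<beta> *
       ((\<alpha> + 1 / 2) / sqrt (2 * pi) *
          (LBINT z. 1 / (1 + V / sig \<beta> \<nu> * (z\<^sup>2 / 2)) * exp (- z\<^sup>2 / 2))
        - \<alpha>)"

definition E_dK_dnu :: "real \<Rightarrow> real \<Rightarrow> real \<Rightarrow> real \<Rightarrow> real" where
  "E_dK_dnu V \<alpha> \<beta> \<nu> =
     1 / (2 * \<nu> * (\<nu> + 1)) *
       ((2 * \<alpha> + 1) / sqrt (2 * pi) *
          (LBINT z. z\<^sup>2 / (2 * sig \<beta> \<nu> / V + z\<^sup>2) * exp (- z\<^sup>2 / 2))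
        - 1)"

definition F :: "real \<Rightarrow> real" where
  "F x = 1 / sqrt (2 * pi) * (LBINT z. 1 / (2 * x + z\<^sup>2) * exp (- z\<^sup>2 / 2))"

definition A :: "real \<Rightarrow> real" where
  "A \<alpha> = (THE a. a < \<alpha> \<and> F (\<alpha> - a) = \<alpha> / ((2 * \<alpha> + 1) * (\<alpha> - a)))"

definition sigma_kappa :: "real \<Rightarrow> real \<Rightarrow> real \<Rightarrow> real" where
  "sigma_kappa V \<kappa> \<alpha> = (1 - \<kappa> / \<alpha>) * (\<alpha> - A \<alpha>) * V"

text \<open>Smoothness is \<open>C\<close>-infinity; the definition is meant for open \<open>S\<close>, where \<^const>\<open>deriv\<close>
  at a point of \<open>S\<close> only depends on the values of the function on \<open>S\<close>.\<close>

definition smooth_on :: "real set \<Rightarrow> (real \<Rightarrow> real) \<Rightarrow> bool" where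
  "smooth_on S f \<longleftrightarrow> (\<forall>k. ((deriv ^^ k) f) differentiable_on S)"

text \<open>Solutions take values in the phase space \<open>\<alpha>, \<beta>, \<nu> > 0\<close>. The time set \<open>J\<close> will be
  \<open>{0..}\<close> or \<open>{0..<T}\<close>; the derivative at \<open>0\<close> is one-sided.\<close>

definition solves_system ::
    "real \<Rightarrow> real set \<Rightarrow> (real \<Rightarrow> real) \<Rightarrow> (real \<Rightarrow> real) \<Rightarrow> (real \<Rightarrow> real) \<Rightarrow> bool" where
  "solves_system V J \<alpha> \<beta> \<nu> \<longleftrightarrow>
     (\<forall>t\<in>J. \<alpha> t > 0 \<and> \<beta> t > 0 \<and> \<nu> t > 0 \<and>
        (\<alpha> has_real_derivative - E_dK_dalpha V (\<alpha> t) (\<beta> t) (\<nu> t)) (at t within J) \<and>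
        (\<beta> has_real_derivative - E_dK_dbeta V (\<alpha> t) (\<beta> t) (\<nu> t)) (at t within J) \<and>
        (\<nu> has_real_derivative - E_dK_dnu V (\<alpha> t) (\<beta> t) (\<nu> t)) (at t within J))"

definition solves_ivp ::
    "real \<Rightarrow> real set \<Rightarrow> real \<Rightarrow> real \<Rightarrow> real \<Rightarrow>
     (real \<Rightarrow> real) \<Rightarrow> (real \<Rightarrow> real) \<Rightarrow> (real \<Rightarrow> real) \<Rightarrow> bool" where
  "solves_ivp V J \<alpha>0 \<beta>0 \<nu>0 \<alpha> \<beta> \<nu> \<longleftrightarrow>
     solves_system V J \<alpha> \<beta> \<nu> \<and> \<alpha> 0 = \<alpha>0 \<and> \<beta> 0 = \<beta>0 \<and> \<nu> 0 = \<nu>0"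

text \<open>Quantifying over solutions on every \<open>{0..<T}\<close> covers solutions on \<open>{0..}\<close> as well, by
  restriction.\<close>

definition forward_invariant :: "real \<Rightarrow> (real \<times> real \<times> real) set \<Rightarrow> bool" where
  "forward_invariant V S \<longleftrightarrow>
     (\<forall>T \<alpha> \<beta> \<nu>. T > 0 \<longrightarrow> solves_system V {0..<T} \<alpha> \<beta> \<nu> \<longrightarrow> (\<alpha> 0, \<beta> 0, \<nu> 0) \<in> S \<longrightarrow>
        (\<forall>t\<in>{0..<T}. (\<alpha> t, \<beta> t, \<nu> t) \<in> S))"

definition S_star :: "real \<Rightarrow> (real \<Rightarrow> real) \<Rightarrow> (real \<times> real \<times> real) set" where
  "S_star V \<sigma>s = {(\<alpha>, \<beta>, \<nu>). \<alpha> > 0 \<and> \<beta> > 0 \<and> \<nu> > 0 \<and>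
      \<sigma>s \<alpha> < \<beta> * (\<nu> + 1) / \<nu> \<and> \<beta> * (\<nu> + 1) / \<nu> < sigma_kappa V 0 \<alpha>}"

text \<open>\<open>\<Gamma>\<close> is an integral curve of \<open>dy/dx = f x y\<close>: the graph of a solution on a nonempty
  open interval.\<close>

definition is_integral_curve :: "(real \<Rightarrow> real \<Rightarrow> real) \<Rightarrow> (real \<times> real) set \<Rightarrow> bool" where
  "is_integral_curve f \<Gamma> \<longleftrightarrow>
     (\<exists>I y. open I \<and> is_interval I \<and> I \<noteq> {} \<and>
        (\<forall>x\<in>I. (y has_real_derivative f x (y x)) (at x)) \<and> \<Gamma> = (\<lambda>x. (x, y x)) ` I)"

text \<open>The part of the curve \<open>\<beta>\<^sup>2 + \<nu>\<^sup>2 + 2\<nu>\<^sup>3/3 = C\<close> in the phase space, as a set of points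
  \<open>(\<nu>, \<beta>)\<close>.\<close>

definition level_curve :: "real \<Rightarrow> (real \<times> real) set" where
  "level_curve C = {(\<nu>, \<beta>). \<nu> > 0 \<and> \<beta> > 0 \<and> \<beta>\<^sup>2 + \<nu>\<^sup>2 + 2 * \<nu> ^ 3 / 3 = C}"

end

theory Submission
  imports Defs "HOL-Probability.Distributions" "HOL-Real_Asymp.Real_Asymp"
begin

text \<open>Put \<open>s = \<sigma>/V\<close>. The averaged derivatives depend on \<open>\<sigma>\<close> only through \<open>s\<close>, and only through the
two Gaussian expectations \<open>G s = E ln (1 + z\<^sup>2/(2s))\<close> (\<open>log_mean\<close>) and
\<open>h s = s F s = E (s/(2s + z\<^sup>2))\<close> (\<open>shrinkage\<close>). With \<open>D \<alpha> = \<Psi>(\<alpha> + 1/2) - \<Psi>(\<alpha>)\<close>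
(\<open>digamma_gap\<close>), \<open>p = D \<alpha> - G s\<close> and \<open>q = \<alpha> - (2\<alpha> + 1) h s\<close>, the system reads
\<open>\<alpha>' = p\<close>, \<open>\<beta>' = q/\<beta>\<close>, \<open>\<nu>' = - q/(\<nu>(\<nu> + 1))\<close>. Hence \<open>\<beta>\<^sup>2 + \<nu>\<^sup>2 + 2\<nu>\<^sup>3/3\<close> is
conserved, and \<open>s'\<close> is a positive multiple of \<open>q\<close>. So the dynamics can be read off from the signs of
\<open>p\<close> and \<open>q\<close> in the \<open>(\<alpha>, s)\<close> plane. As \<open>G\<close> decreases and \<open>h\<close> increases, \<open>p > 0\<close> means that \<open>s\<close>
lies above the curve \<open>s = balance \<alpha>\<close> on which \<open>G s = D \<alpha>\<close>, and \<open>q > 0\<close> means that \<open>s\<close> lies below the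
curve \<open>s = \<alpha> - A \<alpha>\<close>. The function \<open>\<sigma>\<^sub>*\<close> is \<open>V\<close> times \<open>balance\<close>.

The heart of the matter is that the first curve lies below the second one
(\<open>log_mean_at_root_less\<close>). Gaussian integration by parts (\<open>stein_identity\<close>) yields the differential
equation \<open>h' = h + h/(2s) - 1/2\<close>, and differentiating the equation \<open>h (\<alpha> - A) = \<alpha>/(2\<alpha> + 1)\<close> turns it
into \<open>A' = (2\<alpha> + 3 - 2\<alpha>/A)/(2\<alpha> + 1)\<close>. Below its increasing nullcline \<open>2\<alpha>/(2\<alpha> + 3)\<close> a solution
decreases and can never return, so it could not tend to \<open>1\<close>, as \<open>A\<close> does; therefore
\<open>A \<alpha> > 2\<alpha>/(2\<alpha> + 3)\<close> (\<open>A_lower\<close>). On the other hand telescoping gives the trigamma inequality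
\<open>- D' \<alpha> > (2\<alpha> + 3)/(\<alpha>(2\<alpha> + 1)\<^sup>2)\<close> (\<open>trigamma_gap_lower\<close>). The two bounds fit together exactly: they
make \<open>D \<alpha> - G (\<alpha> - A \<alpha>)\<close> strictly decreasing, and since it tends to \<open>0\<close> it is positive. The
asymptotic comparison with \<open>\<sigma>\<^sub>\<kappa>\<close> only needs two terms of the expansions of \<open>G\<close> and \<open>D\<close> at infinity.

Now \<open>p\<close> and \<open>q\<close> are never both nonpositive. Along a trajectory \<open>q\<close> drives \<open>p\<close> upwards when
\<open>p = 0\<close>, and \<open>p\<close> drives \<open>q\<close> upwards when \<open>q = 0\<close>, so \<open>p, q > 0\<close> is forward invariant
(\<open>drift_invariant\<close>). In the same way the quadrants \<open>\<alpha> > a, s > b\<close> with \<open>balance a < b < a - A a\<close> are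
invariant (\<open>trapped\<close>). They exhaust the phase space and, with the conserved quantity, keep every
trajectory in a compact set on bounded time intervals; so Picard iteration for the truncated vector field
gives global solutions. Finally, on a compact rectangle \<open>max p q\<close> is bounded below by a positive constant.
A trajectory with signs of \<open>p\<close> and \<open>q\<close> that do not change therefore leaves every rectangle
(\<open>not_confined\<close>). Applied to \<open>p \<le> 0\<close> or \<open>q \<le> 0\<close> this forces entry into the region \<open>p, q > 0\<close>;
applied inside that region it gives \<open>\<alpha> \<rightarrow> \<infinity>\<close>, then \<open>s \<rightarrow> \<infinity>\<close>, and conservation yields the
limits of \<open>\<nu>\<close> and \<open>\<beta>\<close>.\<close>

section \<open>Gaussian expectations\<close>

text \<open>The mean value theorem bounds the difference quotients by the same integrable function that bounds the
derivatives, so dominated convergence applies along every sequence that converges to \<open>x\<close>.\<close>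

lemma DERIV_integral_parameter:
  fixes f f' :: "real \<Rightarrow> 'a \<Rightarrow> real"
  assumes U: "open U" "convex U" "x \<in> U"
    and der: "\<And>y z. y \<in> U \<Longrightarrow> z \<in> space M \<Longrightarrow> ((\<lambda>y. f y z) has_real_derivative f' y z) (at y)"
    and int: "\<And>y. y \<in> U \<Longrightarrow> integrable M (f y)"
    and bound: "\<And>y z. y \<in> U \<Longrightarrow> z \<in> space M \<Longrightarrow> \<bar>f' y z\<bar> \<le> g z"
    and g: "integrable M g"
    and meas: "f' x \<in> borel_measurable M"
  shows "((\<lambda>y. integral\<^sup>L M (f y)) has_real_derivative integral\<^sup>L M (f' x)) (at x)"
proof -
  have "((\<lambda>y. (integral\<^sup>L M (f y) - integral\<^sup>L M (f x)) / (y - x)) \<longlongrightarrow> integral\<^sup>L M (f' x)) (at x within U)"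
    unfolding tendsto_at_iff_sequentially comp_def
  proof (intro allI impI)
    fix X :: "nat \<Rightarrow> real"
    assume X: "\<forall>i. X i \<in> U - {x}" and lim: "X \<longlonglongrightarrow> x"
    have XU: "X i \<in> U" "X i \<noteq> x" for i using X by auto
    have quot_bound: "\<bar>(f (X i) z - f x z) / (X i - x)\<bar> \<le> g z" if z: "z \<in> space M" for i z
    proof -
      have "norm (f (X i) z - f x z) \<le> g z * norm (X i - x)"
        by (rule field_differentiable_bound[of U "\<lambda>y. f y z" "\<lambda>y. f' y z"])
          (use U XU bound z in \<open>auto intro: has_field_derivative_at_within der\<close>)
      then show ?thesis using XU(2)[of i] by (simp add: divide_simps)
    qed
    have quot_lim: "(\<lambda>i. (f (X i) z - f x z) / (X i - x)) \<longlonglongrightarrow> f' x z" if z: "z \<in> space M" for z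
    proof -
      have "((\<lambda>y. (f y z - f x z) / (y - x)) \<longlongrightarrow> f' x z) (at x)"
        using der[OF U(3) z] by (simp add: has_field_derivative_iff)
      then show ?thesis
        using XU(2) lim unfolding tendsto_at_iff_sequentially comp_def by auto
    qed
    have "(\<lambda>i. integral\<^sup>L M (\<lambda>z. (f (X i) z - f x z) / (X i - x))) \<longlonglongrightarrow> integral\<^sup>L M (f' x)"
      by (rule integral_dominated_convergence[where w = g])
        (use meas g quot_lim quot_bound int XU U(3) in \<open>auto intro!: borel_measurable_integrable\<close>)
    moreover have "integral\<^sup>L M (\<lambda>z. (f (X i) z - f x z) / (X i - x))
        = (integral\<^sup>L M (f (X i)) - integral\<^sup>L M (f x)) / (X i - x)" for i
      by (simp only: integral_divide_zero Bochner_Integration.integral_diff[OF int[OF XU(1)] int[OF U(3)]])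
    ultimately show "(\<lambda>i. (integral\<^sup>L M (f (X i)) - integral\<^sup>L M (f x)) / (X i - x)) \<longlonglongrightarrow> integral\<^sup>L M (f' x)"
      by (simp only:)
  qed
  then show ?thesis
    by (simp add: has_field_derivative_iff at_within_open[OF U(3,1)])
qed

abbreviation gauss :: "real measure" where
  "gauss \<equiv> density lborel (\<lambda>z. ennreal (std_normal_density z))"

lemma prob_space_gauss: "prob_space gauss"
  by (rule prob_space_normal_density) simp

lemma integral_gauss_eq:
  assumes [measurable]: "f \<in> borel_measurable borel"
  shows "(LINT z|gauss. f z) = 1 / sqrt (2 * pi) * (LBINT z. f z * exp (- z\<^sup>2 / 2))"
proof -
  have "(LINT z|gauss. f z) = (LBINT z. 1 / sqrt (2 * pi) * (f z * exp (- z\<^sup>2 / 2)))"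
    by (subst integral_density) (simp_all add: std_normal_density_def mult_ac)
  then show ?thesis by simp
qed

lemma integrable_gauss_bounded:
  fixes f :: "real \<Rightarrow> real"
  assumes "f \<in> borel_measurable borel" "\<And>z. \<bar>f z\<bar> \<le> B"
  shows "integrable gauss f"
proof -
  interpret prob_space gauss by (rule prob_space_gauss)
  show ?thesis by (rule integrable_const_bound[of _ B]) (use assms in auto)
qed

lemma integrable_gauss_power: "integrable gauss (\<lambda>z. z ^ k)"
  by (subst integrable_density) (simp_all add: integrable_std_normal_moment)

lemma gauss_even_moment: "(LINT z|gauss. z ^ (2 * k)) = fact (2 * k) / (2 ^ k * fact k)"
  by (subst integral_density) (simp_all add: integral_std_normal_moment_even)

lemma gauss_moments:
  "(LINT z|gauss. z ^ 2) = 1" "(LINT z|gauss. z ^ 4) = 3" "(LINT z|gauss. z ^ 6) = 15"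
  using gauss_even_moment[of 1] gauss_even_moment[of 2] gauss_even_moment[of 3]
  by (simp_all add: fact_numeral)

text \<open>The derivative of \<open>\<phi>\<close> times the normal density is \<open>\<phi>' z - z \<phi> z\<close> times that density, and a bounded
\<open>\<phi>\<close> leaves no boundary terms at infinity.\<close>

lemma stein_identity:
  assumes der: "\<And>z. (\<phi> has_real_derivative \<phi>' z) (at z)"
    and cont: "continuous_on UNIV \<phi>'"
    and bd: "\<And>z. \<bar>\<phi> z\<bar> \<le> B" "\<And>z. \<bar>\<phi>' z\<bar> \<le> B'"
  shows "(LINT z|gauss. z * \<phi> z) = (LINT z|gauss. \<phi>' z)"
proof -
  have cont\<phi>: "continuous_on UNIV \<phi>"
    using der by (meson DERIV_isCont continuous_at_imp_continuous_on)
  have [measurable]: "\<phi> \<in> borel_measurable borel" "\<phi>' \<in> borel_measurable borel"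
    by (auto intro: borel_measurable_continuous_onI cont\<phi> cont)
  define n where "n z = std_normal_density z" for z
  have dn: "(n has_real_derivative - z * n z) (at z)" for z
  proof -
    define c where "c = 1 / sqrt (2 * pi)"
    have "n = (\<lambda>z. c * exp (- z\<^sup>2 / 2))"
      by (simp add: n_def[abs_def] std_normal_density_def c_def)
    then show ?thesis by (auto intro!: derivative_eq_intros)
  qed
  have int1: "integrable gauss (\<lambda>z. z * \<phi> z)"
  proof (rule Bochner_Integration.integrable_bound)
    show "integrable gauss (\<lambda>z. B * \<bar>z ^ 1\<bar>)"
      using integrable_gauss_power[of 1] by (intro integrable_mult_right integrable_abs)
    show "AE z in gauss. norm (z * \<phi> z) \<le> norm (B * \<bar>z ^ 1\<bar>)"
    proof (rule AE_I2)
      fix z :: real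
      have "\<bar>z\<bar> * \<bar>\<phi> z\<bar> \<le> \<bar>z\<bar> * \<bar>B\<bar>" by (rule mult_left_mono) (use bd(1)[of z] in auto)
      then show "norm (z * \<phi> z) \<le> norm (B * \<bar>z ^ 1\<bar>)" by (simp add: abs_mult mult_ac)
    qed
  qed simp
  have int2: "integrable gauss \<phi>'"
    by (rule integrable_gauss_bounded) (use bd in auto)
  define f where "f z = n z * (\<phi>' z - z * \<phi> z)" for z
  have intf: "integrable lborel f"
    using Bochner_Integration.integrable_diff[OF int2 int1]
    by (subst (asm) integrable_density) (simp_all add: f_def[abs_def] n_def)
  have nlim: "(n \<longlongrightarrow> 0) at_top" "(n \<longlongrightarrow> 0) at_bot"
    unfolding n_def std_normal_density_def by real_asymp+
  have prodlim: "((\<lambda>z. \<phi> z * n z) \<longlongrightarrow> 0) at_top" "((\<lambda>z. \<phi> z * n z) \<longlongrightarrow> 0) at_bot"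
  proof -
    have bf: "Bfun \<phi> F'" for F' by (rule BfunI[of _ B]) (use bd in auto)
    show "((\<lambda>z. \<phi> z * n z) \<longlongrightarrow> 0) at_top" "((\<lambda>z. \<phi> z * n z) \<longlongrightarrow> 0) at_bot"
      using bounded_bilinear.Bfun_prod_Zfun[OF bounded_bilinear_mult bf] nlim
      by (simp_all add: tendsto_Zfun_iff)
  qed
  have "(LBINT z=-\<infinity>..\<infinity>. f z) = 0 - 0"
  proof (rule interval_integral_FTC_integrable[where F = "\<lambda>z. \<phi> z * n z"])
    show "((\<lambda>z. \<phi> z * n z) has_vector_derivative f z) (at z)" for z
      unfolding has_real_derivative_iff_has_vector_derivative[symmetric] f_def
      by (rule derivative_eq_intros der dn)+ (simp add: algebra_simps)
    have "continuous_on UNIV n"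
      using dn by (meson DERIV_isCont continuous_at_imp_continuous_on)
    then have "continuous_on UNIV f"
      unfolding f_def by (intro continuous_intros cont cont\<phi>)
    then show "isCont f z" for z by (simp add: continuous_on_eq_continuous_at)
    show "set_integrable lborel (einterval (-\<infinity>) \<infinity>) f"
      using intf by (simp add: set_integrable_def)
    show "(((\<lambda>z. \<phi> z * n z) \<circ> real_of_ereal) \<longlongrightarrow> 0) (at_right (-\<infinity>))"
      "(((\<lambda>z. \<phi> z * n z) \<circ> real_of_ereal) \<longlongrightarrow> 0) (at_left \<infinity>)"
      using prodlim by (simp_all add: ereal_tendsto_simps)
  qed simp
  then have "integral\<^sup>L lborel f = 0"
    by (simp add: interval_lebesgue_integral_def set_lebesgue_integral_def)
  moreover have "integral\<^sup>L lborel f = (LINT z|gauss. \<phi>' z - z * \<phi> z)"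
    by (subst integral_density) (simp_all add: f_def[abs_def] n_def[abs_def])
  ultimately show ?thesis
    using int1 int2 by simp
qed

text \<open>The logarithmic expectation in the \<open>\<alpha>\<close> component, as a function of \<open>s = \<sigma>/V\<close>.\<close>

definition log_mean :: "real \<Rightarrow> real" where
  "log_mean s = (LINT z|gauss. ln (1 + z\<^sup>2 / (2 * s)))"

lemma F_eq: "F x = (LINT z|gauss. 1 / (2 * x + z\<^sup>2))"
  unfolding F_def by (subst integral_gauss_eq) simp_all

lemma ln_1p_sq_bounds: "s > 0 \<Longrightarrow> 0 \<le> ln (1 + z\<^sup>2 / (2 * s)) \<and> ln (1 + z\<^sup>2 / (2 * s)) \<le> z\<^sup>2 / (2 * s)" for s z :: real
  by (auto intro!: ln_ge_zero ln_add_one_self_le_self)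

lemma integrable_log: "s > 0 \<Longrightarrow> integrable gauss (\<lambda>z. ln (1 + z\<^sup>2 / (2 * s)))"
  by (rule Bochner_Integration.integrable_bound[OF integrable_divide[OF integrable_gauss_power[of 2], of "2 * s"]])
    (use ln_1p_sq_bounds in auto)

lemma sq_denominator: "x > 0 \<Longrightarrow> 2 * x \<le> 2 * x + z\<^sup>2 \<and> 0 < 2 * x + z\<^sup>2" for x z :: real
  by (auto intro: add_pos_nonneg)

lemma integrable_F_kernels:
  assumes "x > 0"
  shows "integrable gauss (\<lambda>z. 1 / (2 * x + z\<^sup>2))"
    "integrable gauss (\<lambda>z. 1 / (2 * x + z\<^sup>2)\<^sup>2)"
    "integrable gauss (\<lambda>z. z\<^sup>2 / (2 * x + z\<^sup>2)\<^sup>2)"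
proof -
  note d = sq_denominator[OF assms]
  have b1: "\<bar>1 / (2 * x + z\<^sup>2)\<bar> \<le> 1 / (2 * x)" for z
    using d[of z] assms by (auto simp: divide_simps)
  have b2: "\<bar>1 / (2 * x + z\<^sup>2)\<^sup>2\<bar> \<le> 1 / (2 * x) ^ 2" for z
    using power_mono[OF b1[of z], of 2] by (simp add: power_divide)
  have b3: "\<bar>z\<^sup>2 / (2 * x + z\<^sup>2)\<^sup>2\<bar> \<le> 1 / (2 * x)" for z
  proof -
    have "z\<^sup>2 / (2 * x + z\<^sup>2)\<^sup>2 \<le> (2 * x + z\<^sup>2) / (2 * x + z\<^sup>2)\<^sup>2"
      using assms by (intro divide_right_mono) auto
    also have "\<dots> = 1 / (2 * x + z\<^sup>2)" using d[of z] by (simp add: power2_eq_square)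
    also have "\<dots> \<le> 1 / (2 * x)" using b1[of z] by linarith
    finally show ?thesis by simp
  qed
  show "integrable gauss (\<lambda>z. 1 / (2 * x + z\<^sup>2))"
    by (rule integrable_gauss_bounded[OF _ b1]) simp
  show "integrable gauss (\<lambda>z. 1 / (2 * x + z\<^sup>2)\<^sup>2)"
    by (rule integrable_gauss_bounded[OF _ b2]) simp
  show "integrable gauss (\<lambda>z. z\<^sup>2 / (2 * x + z\<^sup>2)\<^sup>2)"
    by (rule integrable_gauss_bounded[OF _ b3]) simp
qed

lemma integral_sq_ratio:
  assumes "x > 0"
  shows "(LINT z|gauss. z\<^sup>2 / (2 * x + z\<^sup>2)) = 1 - 2 * x * F x"
proof -
  interpret prob_space gauss by (rule prob_space_gauss)
  have "z\<^sup>2 / (2 * x + z\<^sup>2) = 1 - 2 * x * (1 / (2 * x + z\<^sup>2))" for z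
    using sq_denominator[OF assms, of z] by (simp add: field_simps)
  then have "(LINT z|gauss. z\<^sup>2 / (2 * x + z\<^sup>2)) = (LINT z|gauss. 1 - 2 * x * (1 / (2 * x + z\<^sup>2)))"
    by (simp only:)
  also have "\<dots> = (LINT z|gauss. 1) - (LINT z|gauss. 2 * x * (1 / (2 * x + z\<^sup>2)))"
    by (intro Bochner_Integration.integral_diff integrable_const integrable_mult_right integrable_F_kernels assms)
  also have "\<dots> = 1 - 2 * x * F x"
    by (simp only: integral_mult_right_zero F_eq) (simp add: prob_space[simplified])
  finally show ?thesis .
qed

lemma DERIV_F_integral:
  assumes "x > 0"
  shows "(F has_real_derivative (LINT z|gauss. - 2 * (1 / (2 * x + z\<^sup>2)\<^sup>2))) (at x)"
proof -
  have "((\<lambda>x. LINT z|gauss. 1 / (2 * x + z\<^sup>2)) has_real_derivative (LINT z|gauss. - 2 * (1 / (2 * x + z\<^sup>2)\<^sup>2))) (at x)"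
  proof (rule DERIV_integral_parameter[where U = "{x/2<..}" and g = "\<lambda>_. 2 / x\<^sup>2"])
    fix y z :: real assume y: "y \<in> {x/2<..}"
    then have y0: "y > 0" using assms by simp
    note d = sq_denominator[OF y0, of z]
    show "((\<lambda>y. 1 / (2 * y + z\<^sup>2)) has_real_derivative - 2 * (1 / (2 * y + z\<^sup>2)\<^sup>2)) (at y)"
      using d by (auto intro!: derivative_eq_intros simp: power2_eq_square field_simps)
    have "x\<^sup>2 \<le> (2 * y + z\<^sup>2)\<^sup>2"
      proof (rule power_mono)
      show "x \<le> 2 * y + z\<^sup>2" using y zero_le_power2[of z] unfolding greaterThan_iff by linarith
    qed (use assms in simp)
    then have "2 / (2 * y + z\<^sup>2)\<^sup>2 \<le> 2 / x\<^sup>2"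
      by (rule divide_left_mono) (use assms d in simp_all)
    then show "\<bar>- 2 * (1 / (2 * y + z\<^sup>2)\<^sup>2)\<bar> \<le> 2 / x\<^sup>2"
      by (simp only: abs_mult) simp
  qed (use assms integrable_F_kernels in \<open>auto intro!: prob_space_gauss finite_measure.integrable_const prob_space.finite_measure\<close>)
  then show ?thesis by (simp add: F_eq[abs_def])
qed

text \<open>Stein's identity for \<open>\<phi> z = z/(2x + z\<^sup>2)\<close>. The square of the kernel that it produces is, up to a
constant, the derivative of \<^const>\<open>F\<close>, so that \<^const>\<open>F\<close> solves a first-order linear differential
equation.\<close>

lemma stein_F:
  assumes "x > 0"
  shows "1 - 2 * x * F x = 4 * x * (LINT z|gauss. 1 / (2 * x + z\<^sup>2)\<^sup>2) - F x"
proof -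
  note d = sq_denominator[OF assms]
  have b1: "\<bar>1 / (2 * x + z\<^sup>2)\<bar> \<le> 1 / (2 * x)" for z
    using d[of z] assms by (auto simp: divide_simps)
  define \<phi>' where "\<phi>' z = 4 * x * (1 / (2 * x + z\<^sup>2)\<^sup>2) - 1 / (2 * x + z\<^sup>2)" for z
  have "(LINT z|gauss. z * (z / (2 * x + z\<^sup>2))) = (LINT z|gauss. \<phi>' z)"
  proof (rule stein_identity)
    fix z
    have "((\<lambda>z. z / (2 * x + z\<^sup>2)) has_real_derivative
        (2 * x + z\<^sup>2 - z * (2 * z)) / (2 * x + z\<^sup>2)\<^sup>2) (at z)"
      using d[of z] by (auto intro!: derivative_eq_intros simp: power2_eq_square)
    also have "(2 * x + z\<^sup>2 - z * (2 * z)) / (2 * x + z\<^sup>2)\<^sup>2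
        = (4 * x - (2 * x + z\<^sup>2)) / (2 * x + z\<^sup>2)\<^sup>2"
      by (simp add: power2_eq_square)
    also have "\<dots> = \<phi>' z"
    proof -
      have "(4 * x - D) / D\<^sup>2 = 4 * x * (1 / D\<^sup>2) - 1 / D" if "D \<noteq> 0" for D :: real
        using that by (simp add: field_simps power2_eq_square)
      moreover have "2 * x + z\<^sup>2 \<noteq> 0" using d[of z] by simp
      ultimately show ?thesis unfolding \<phi>'_def by blast
    qed
    finally show "((\<lambda>z. z / (2 * x + z\<^sup>2)) has_real_derivative \<phi>' z) (at z)" .
    have "0 \<le> (\<bar>z\<bar> - 1 / 2)\<^sup>2 + 3 / 4" by simp
    also have "\<dots> = 1 + z\<^sup>2 - \<bar>z\<bar>" by (simp add: power2_diff power_divide)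
    finally have "\<bar>z\<bar> \<le> 1 + z\<^sup>2" by simp
    then have "\<bar>z / (2 * x + z\<^sup>2)\<bar> \<le> (1 + z\<^sup>2) / (2 * x + z\<^sup>2)"
      using d[of z] by (auto simp: divide_right_mono)
    also have "\<dots> = 1 / (2 * x + z\<^sup>2) + z\<^sup>2 / (2 * x + z\<^sup>2)" by (simp add: add_divide_distrib)
    also have "\<dots> \<le> 1 / (2 * x) + 1" using b1[of z] d[of z] assms by (intro add_mono) auto
    finally show "\<bar>z / (2 * x + z\<^sup>2)\<bar> \<le> 1 / (2 * x) + 1" .
    have "\<bar>1 / (2 * x + z\<^sup>2)\<^sup>2\<bar> \<le> 1 / (2 * x) ^ 2"
      using power_mono[OF b1[of z], of 2] by (simp add: power_divide)
    then have "4 * x * \<bar>1 / (2 * x + z\<^sup>2)\<^sup>2\<bar> \<le> 4 * x * (1 / (2 * x) ^ 2)"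
      using assms by (intro mult_left_mono) auto
    then show "\<bar>\<phi>' z\<bar> \<le> 4 * x * (1 / (2 * x) ^ 2) + 1 / (2 * x)"
      unfolding \<phi>'_def using b1[of z] assms by (intro order_trans[OF abs_triangle_ineq4] add_mono) (simp_all add: abs_mult)
  next
    show "continuous_on UNIV \<phi>'"
      unfolding \<phi>'_def by (intro continuous_intros) (use d in \<open>auto simp: less_imp_neq[THEN not_sym]\<close>)
  qed
  also have "(LINT z|gauss. \<phi>' z) = 4 * x * (LINT z|gauss. 1 / (2 * x + z\<^sup>2)\<^sup>2) - F x"
    unfolding \<phi>'_def F_eq
    by (simp only: Bochner_Integration.integral_diff integrable_mult_right integrable_F_kernels[OF assms]
        integral_mult_right_zero)
  finally show ?thesis using integral_sq_ratio[OF assms] by (simp add: power2_eq_square)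
qed

lemma DERIV_F:
  assumes "x > 0"
  shows "(F has_real_derivative F x - F x / (2 * x) - 1 / (2 * x)) (at x)"
proof -
  have "(LINT z|gauss. - 2 * (1 / (2 * x + z\<^sup>2)\<^sup>2)) = - 2 * (LINT z|gauss. 1 / (2 * x + z\<^sup>2)\<^sup>2)"
    by (simp only: integral_mult_right_zero)
  also have "\<dots> = F x - F x / (2 * x) - 1 / (2 * x)"
  proof -
    have "- 2 * I = F x - F x / (2 * x) - 1 / (2 * x)" if "1 - 2 * x * F x = 4 * x * I - F x" for I
    proof -
      have "- 2 * I = - (4 * x * I) / (2 * x)" using assms by simp
      also have "- (4 * x * I) = 2 * x * F x - F x - 1" using that by linarith
      finally show ?thesis using assms by (simp add: diff_divide_distrib)
    qed
    then show ?thesis using stein_F[OF assms] .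
  qed
  finally show ?thesis using DERIV_F_integral[OF assms] by metis
qed

text \<open>Differentiation gives \<open>- (1/s) E (z\<^sup>2/(2s + z\<^sup>2))\<close>: the derivative is expressed through \<^const>\<open>F\<close>
again, so no further integrals arise from differentiation.\<close>

lemma DERIV_log_mean:
  assumes "s > 0"
  shows "(log_mean has_real_derivative 2 * F s - 1 / s) (at s)"
proof -
  have "((\<lambda>s. LINT z|gauss. ln (1 + z\<^sup>2 / (2 * s))) has_real_derivative (LINT z|gauss. - (1 / s) * (z\<^sup>2 / (2 * s + z\<^sup>2)))) (at s)"
  proof (rule DERIV_integral_parameter[where U = "{s/2<..}" and g = "\<lambda>_. 2 / s"])
    fix y z :: real assume y: "y \<in> {s/2<..}"
    then have y0: "y > 0" using assms by simp
    note d = sq_denominator[OF y0, of z]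
    have "1 + z\<^sup>2 / (2 * y) > 0" using y0 by (auto intro: add_pos_nonneg)
    then have "((\<lambda>y. ln (1 + z\<^sup>2 / (2 * y))) has_real_derivative (- z\<^sup>2 / (2 * y\<^sup>2)) / (1 + z\<^sup>2 / (2 * y))) (at y)"
      using y0 by (auto intro!: derivative_eq_intros simp: power2_eq_square)
    moreover have "(- z\<^sup>2 / (2 * y\<^sup>2)) / (1 + z\<^sup>2 / (2 * y)) = - (1 / y) * (z\<^sup>2 / (2 * y + z\<^sup>2))"
      using d y0 by (simp add: divide_simps) (simp add: power2_eq_square algebra_simps)
    ultimately show "((\<lambda>y. ln (1 + z\<^sup>2 / (2 * y))) has_real_derivative - (1 / y) * (z\<^sup>2 / (2 * y + z\<^sup>2))) (at y)"
      by (simp only:)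
    have "\<bar>- (1 / y) * (z\<^sup>2 / (2 * y + z\<^sup>2))\<bar> = (1 / y) * (z\<^sup>2 / (2 * y + z\<^sup>2))"
      using y0 d by (simp add: abs_mult)
    also have "\<dots> \<le> (2 / s) * 1"
    proof (rule mult_mono)
      show "1 / y \<le> 2 / s" using y assms by (simp add: field_simps)
      show "z\<^sup>2 / (2 * y + z\<^sup>2) \<le> 1" using d y0 by simp
    qed (use assms d in auto)
    finally show "\<bar>- (1 / y) * (z\<^sup>2 / (2 * y + z\<^sup>2))\<bar> \<le> 2 / s" by simp
  qed (use assms integrable_log in \<open>auto intro!: prob_space_gauss finite_measure.integrable_const prob_space.finite_measure\<close>)
  also have "(LINT z|gauss. - (1 / s) * (z\<^sup>2 / (2 * s + z\<^sup>2))) = - (1 / s) * (1 - 2 * s * F s)"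
    using integral_sq_ratio[OF assms] by (simp only: integral_mult_right_zero)
  also have "\<dots> = 2 * F s - 1 / s" using assms by (simp add: field_simps)
  finally show ?thesis by (simp add: log_mean_def[abs_def])
qed

text \<open>Half the expectation of \<open>1/(1 + z\<^sup>2/(2s))\<close>, which lies between \<open>0\<close> and \<open>1/2\<close>; the equation
for \<^const>\<open>A\<close> says \<open>shrinkage (\<alpha> - A \<alpha>) = \<alpha>/(2\<alpha> + 1)\<close>.\<close>

definition shrinkage :: "real \<Rightarrow> real" where
  "shrinkage s = s * F s"

lemma AE_gauss_nonzero: "AE z in gauss. z \<noteq> 0"
  by (subst AE_density) (auto simp: AE_lborel_singleton intro: AE_mp[OF AE_lborel_singleton])

lemma DERIV_shrinkage:
  assumes "s > 0"
  shows "(shrinkage has_real_derivative shrinkage s + shrinkage s / (2 * s) - 1 / 2) (at s)"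
proof -
  have "((\<lambda>s. s * F s) has_real_derivative 1 * F s + (F s - F s / (2 * s) - 1 / (2 * s)) * s) (at s)"
    by (rule DERIV_mult[OF DERIV_ident DERIV_F[OF assms]])
  also have "1 * F s + (F s - F s / (2 * s) - 1 / (2 * s)) * s
      = shrinkage s + shrinkage s / (2 * s) - 1 / 2"
    using assms by (simp add: shrinkage_def field_simps)
  finally show ?thesis by (simp add: shrinkage_def[abs_def])
qed

text \<open>The right-hand side of the differential equation is \<open>E (z\<^sup>2/(2s + z\<^sup>2)\<^sup>2)\<close>.\<close>

lemma shrinkage_deriv_pos:
  assumes "s > 0"
  shows "shrinkage s + shrinkage s / (2 * s) - 1 / 2 > 0"
proof -
  define I where "I = (LINT z|gauss. 1 / (2 * s + z\<^sup>2)\<^sup>2)"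
  have *: "1 - 2 * s * F s = 4 * s * I - F s"
    using stein_F[OF assms] unfolding I_def .
  have "z\<^sup>2 / (2 * s + z\<^sup>2)\<^sup>2 = 1 / (2 * s + z\<^sup>2) - 2 * s * (1 / (2 * s + z\<^sup>2)\<^sup>2)" for z
  proof -
    have "(D - 2 * s) / D\<^sup>2 = 1 / D - 2 * s * (1 / D\<^sup>2)" if "D \<noteq> 0" for D :: real
      using that by (simp add: field_simps power2_eq_square)
    moreover have "2 * s + z\<^sup>2 \<noteq> 0" using sq_denominator[OF assms, of z] by simp
    ultimately show ?thesis by (metis add_diff_cancel_left')
  qed
  then have "(LINT z|gauss. z\<^sup>2 / (2 * s + z\<^sup>2)\<^sup>2)
      = (LINT z|gauss. 1 / (2 * s + z\<^sup>2) - 2 * s * (1 / (2 * s + z\<^sup>2)\<^sup>2))"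
    by (simp only:)
  also have "\<dots> = F s - 2 * s * I"
    unfolding I_def F_eq
    by (simp only: Bochner_Integration.integral_diff integrable_mult_right integrable_F_kernels[OF assms]
        integral_mult_right_zero)
  also have "\<dots> = shrinkage s + shrinkage s / (2 * s) - 1 / 2"
    using * assms by (simp add: shrinkage_def)
  finally have eq: "(LINT z|gauss. z\<^sup>2 / (2 * s + z\<^sup>2)\<^sup>2) = shrinkage s + shrinkage s / (2 * s) - 1 / 2" .
  have "(LINT z|gauss. 0) < (LINT z|gauss. z\<^sup>2 / (2 * s + z\<^sup>2)\<^sup>2)"
  proof (rule finite_measure.integral_less_AE_space)
    show "finite_measure gauss" by (intro prob_space.finite_measure prob_space_gauss)
    show "emeasure gauss (space gauss) \<noteq> 0"
      using prob_space.emeasure_space_1[OF prob_space_gauss] by simp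
    show "AE z in gauss. 0 < z\<^sup>2 / (2 * s + z\<^sup>2)\<^sup>2"
      using AE_gauss_nonzero by eventually_elim
        (rule divide_pos_pos, simp, use sq_denominator[OF assms] in \<open>metis zero_less_power\<close>)
  qed (use integrable_F_kernels[OF assms] in auto)
  then show ?thesis using eq by simp
qed

lemma strict_mono_shrinkage:
  assumes "0 < s" "s < t" shows "shrinkage s < shrinkage t"
proof (rule DERIV_pos_imp_increasing[OF assms(2)])
  fix x assume "s \<le> x" "x \<le> t"
  then have "x > 0" using assms by simp
  then show "\<exists>y. (shrinkage has_real_derivative y) (at x) \<and> y > 0"
    using DERIV_shrinkage shrinkage_deriv_pos by blast
qed

lemma one_minus_shrinkage:
  assumes "s > 0"
  shows "1 - 2 * shrinkage s = (LINT z|gauss. z\<^sup>2 / (2 * s + z\<^sup>2))"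
  using integral_sq_ratio[OF assms] by (simp add: shrinkage_def)

lemma shrinkage_range:
  assumes "s > 0" shows "0 < shrinkage s" "shrinkage s < 1 / 2"
proof -
  have nonneg: "0 \<le> shrinkage s" if "s > 0" for s
    using that unfolding shrinkage_def F_eq
    by (intro mult_nonneg_nonneg Bochner_Integration.integral_nonneg) (auto simp: add_pos_nonneg intro: less_imp_le)
  have le: "shrinkage s \<le> 1 / 2" if "s > 0" for s
  proof -
    have "0 \<le> (LINT z|gauss. z\<^sup>2 / (2 * s + z\<^sup>2))"
      using that by (intro Bochner_Integration.integral_nonneg) auto
    then show ?thesis using one_minus_shrinkage[OF that] by simp
  qed
  show "0 < shrinkage s" using nonneg[of "s/2"] strict_mono_shrinkage[of "s/2" s] assms by simp
  show "shrinkage s < 1 / 2" using le[of "s+1"] strict_mono_shrinkage[of s "s+1"] assms by simp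
qed

lemma gauss_mono:
  fixes f g :: "real \<Rightarrow> real"
  assumes "integrable gauss f" "integrable gauss g" "\<And>z. f z \<le> g z"
  shows "(LINT z|gauss. f z) \<le> (LINT z|gauss. g z)"
  using assms by (intro integral_mono) auto

lemma gauss_polynomial:
  shows "integrable gauss (\<lambda>z. a * z ^ 2 + b * z ^ 4 + c * z ^ 6)"
    and "(LINT z|gauss. a * z ^ 2 + b * z ^ 4 + c * z ^ 6) = a + 3 * b + 15 * c"
proof -
  show "integrable gauss (\<lambda>z. a * z ^ 2 + b * z ^ 4 + c * z ^ 6)"
    by (intro Bochner_Integration.integrable_add integrable_mult_right integrable_gauss_power)
  show "(LINT z|gauss. a * z ^ 2 + b * z ^ 4 + c * z ^ 6) = a + 3 * b + 15 * c"
    by (simp only: Bochner_Integration.integral_add Bochner_Integration.integrable_add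
        integrable_mult_right integrable_gauss_power integral_mult_right_zero gauss_moments mult_1_right mult.commute)
qed

lemma integrable_sq_ratio:
  assumes "s > 0" shows "integrable gauss (\<lambda>z. z\<^sup>2 / (2 * s + z\<^sup>2))"
  by (rule integrable_gauss_bounded[of _ 1]) (use sq_denominator[OF assms] assms in auto)

text \<open>With \<open>y = z\<^sup>2/(2s)\<close> the integrand \<open>y/(1 + y)\<close> lies between the partial sums of its geometric series,
whose expectations are the Gaussian moments \<open>1, 3, 15\<close>.\<close>

lemma shrinkage_expansion:
  assumes "s > 0"
  shows "1 - 2 * shrinkage s \<le> 1 / (2 * s)"
    and "1 / (2 * s) - 3 / (4 * s\<^sup>2) \<le> 1 - 2 * shrinkage s"
    and "1 - 2 * shrinkage s \<le> 1 / (2 * s) - 3 / (4 * s\<^sup>2) + 15 / (8 * s ^ 3)"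
proof -
  have ratio: "z\<^sup>2 / (2 * s + z\<^sup>2) = (z\<^sup>2 / (2 * s)) / (1 + z\<^sup>2 / (2 * s))" for z
    using sq_denominator[OF assms, of z] assms by (simp add: divide_simps)
  have nn: "0 \<le> z\<^sup>2 / (2 * s)" for z using assms by simp
  have t: "y / (1 + y) \<le> y" "y - y\<^sup>2 \<le> y / (1 + y)" "y / (1 + y) \<le> y - y\<^sup>2 + y ^ 3" if "0 \<le> y" for y :: real
  proof -
    show "y / (1 + y) \<le> y" using that by (simp add: divide_simps algebra_simps)
    have "y / (1 + y) - (y - y\<^sup>2) = y ^ 3 / (1 + y)"
      using that by (simp add: field_simps power2_eq_square power3_eq_cube)
    moreover have "0 \<le> y ^ 3 / (1 + y)" using that by simp
    ultimately show "y - y\<^sup>2 \<le> y / (1 + y)" by linarith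
    have "y - y\<^sup>2 + y ^ 3 - y / (1 + y) = y ^ 4 / (1 + y)"
      using that by (simp add: field_simps power2_eq_square power3_eq_cube power4_eq_xxxx)
    moreover have "0 \<le> y ^ 4 / (1 + y)" using that by simp
    ultimately show "y / (1 + y) \<le> y - y\<^sup>2 + y ^ 3" by linarith
  qed
  have p: "(z\<^sup>2 / (2 * s))\<^sup>2 = 1 / (4 * s\<^sup>2) * z ^ 4" "(z\<^sup>2 / (2 * s)) ^ 3 = 1 / (8 * s ^ 3) * z ^ 6" for z
    by (simp_all add: power_divide power_mult_distrib flip: power_mult)
  note m = gauss_mono[OF integrable_sq_ratio[OF assms] gauss_polynomial(1), unfolded gauss_polynomial(2)]
  note m' = gauss_mono[OF gauss_polynomial(1) integrable_sq_ratio[OF assms], unfolded gauss_polynomial(2)]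
  have "(LINT z|gauss. z\<^sup>2 / (2 * s + z\<^sup>2)) \<le> 1 / (2 * s) + 3 * 0 + 15 * 0"
  proof (rule m)
    show "z\<^sup>2 / (2 * s + z\<^sup>2) \<le> 1 / (2 * s) * z ^ 2 + 0 * z ^ 4 + 0 * z ^ 6" for z
      using t(1)[OF nn, of z] unfolding ratio by simp
  qed
  then show "1 - 2 * shrinkage s \<le> 1 / (2 * s)"
    using one_minus_shrinkage[OF assms] by simp
  have "1 / (2 * s) + 3 * (- (1 / (4 * s\<^sup>2))) + 15 * 0 \<le> (LINT z|gauss. z\<^sup>2 / (2 * s + z\<^sup>2))"
  proof (rule m')
    show "1 / (2 * s) * z ^ 2 + - (1 / (4 * s\<^sup>2)) * z ^ 4 + 0 * z ^ 6 \<le> z\<^sup>2 / (2 * s + z\<^sup>2)" for z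
      using t(2)[OF nn, of z] unfolding ratio p by simp
  qed
  then show "1 / (2 * s) - 3 / (4 * s\<^sup>2) \<le> 1 - 2 * shrinkage s"
    using one_minus_shrinkage[OF assms] by simp
  have "(LINT z|gauss. z\<^sup>2 / (2 * s + z\<^sup>2)) \<le> 1 / (2 * s) + 3 * (- (1 / (4 * s\<^sup>2))) + 15 * (1 / (8 * s ^ 3))"
  proof (rule m)
    show "z\<^sup>2 / (2 * s + z\<^sup>2) \<le> 1 / (2 * s) * z ^ 2 + - (1 / (4 * s\<^sup>2)) * z ^ 4 + 1 / (8 * s ^ 3) * z ^ 6" for z
      using t(3)[OF nn, of z] unfolding ratio p by simp
  qed
  then show "1 - 2 * shrinkage s \<le> 1 / (2 * s) - 3 / (4 * s\<^sup>2) + 15 / (8 * s ^ 3)"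
    using one_minus_shrinkage[OF assms] by simp
qed

text \<open>The same comparison for \<open>ln (1 + y)\<close>, between \<open>y - y\<^sup>2/2\<close> and \<open>y\<close>.\<close>

lemma log_mean_bounds:
  assumes "s > 0"
  shows "0 \<le> log_mean s" "log_mean s \<le> 1 / (2 * s)" "1 / (2 * s) - 3 / (8 * s\<^sup>2) \<le> log_mean s"
proof -
  show "0 \<le> log_mean s"
    unfolding log_mean_def using ln_1p_sq_bounds[OF assms] by (intro Bochner_Integration.integral_nonneg) auto
  have nn: "0 \<le> z\<^sup>2 / (2 * s)" for z using assms by simp
  have p: "(z\<^sup>2 / (2 * s))\<^sup>2 = 1 / (4 * s\<^sup>2) * z ^ 4" for z
    by (simp_all add: power_divide power_mult_distrib flip: power_mult)
  have "log_mean s \<le> 1 / (2 * s) + 3 * 0 + 15 * 0"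
    unfolding log_mean_def
    by (rule gauss_mono[OF integrable_log[OF assms] gauss_polynomial(1), unfolded gauss_polynomial(2)])
      (use ln_1p_sq_bounds[OF assms] in simp)
  then show "log_mean s \<le> 1 / (2 * s)" by simp
  have ln: "y - y\<^sup>2 / 2 \<le> ln (1 + y)" if "0 \<le> y" for y :: real
  proof -
    have "(\<lambda>y. ln (1 + y) - (y - y\<^sup>2 / 2)) 0 \<le> (\<lambda>y. ln (1 + y) - (y - y\<^sup>2 / 2)) y"
    proof (rule DERIV_nonneg_imp_nondecreasing[OF that])
      fix x :: real assume x: "0 \<le> x" "x \<le> y"
      have "((\<lambda>y. ln (1 + y) - (y - y\<^sup>2 / 2)) has_real_derivative 1 / (1 + x) - (1 - x)) (at x)"
        using x by (auto intro!: derivative_eq_intros)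
      moreover have "1 / (1 + x) - (1 - x) = x\<^sup>2 / (1 + x)" using x by (simp add: field_simps power2_eq_square)
      ultimately show "\<exists>D. ((\<lambda>y. ln (1 + y) - (y - y\<^sup>2 / 2)) has_real_derivative D) (at x) \<and> 0 \<le> D"
        using x by (intro exI[of _ "x\<^sup>2 / (1 + x)"]) simp
    qed
    then show ?thesis by simp
  qed
  have "1 / (2 * s) + 3 * (- (1 / (8 * s\<^sup>2))) + 15 * 0 \<le> log_mean s"
    unfolding log_mean_def
    by (rule gauss_mono[OF gauss_polynomial(1) integrable_log[OF assms], unfolded gauss_polynomial(2)])
      (use ln[OF nn] p in simp)
  then show "1 / (2 * s) - 3 / (8 * s\<^sup>2) \<le> log_mean s" by simp
qed

lemma log_mean_deriv_neg:
  assumes "s > 0" shows "2 * F s - 1 / s < 0"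
  using shrinkage_range(2)[OF assms] assms by (simp add: shrinkage_def field_simps)

lemma strict_antimono_log_mean:
  assumes "0 < s" "s < t" shows "log_mean t < log_mean s"
proof (rule DERIV_neg_imp_decreasing[OF assms(2)])
  fix x assume "s \<le> x" "x \<le> t"
  then have "x > 0" using assms by simp
  then show "\<exists>y. (log_mean has_real_derivative y) (at x) \<and> y < 0"
    using DERIV_log_mean log_mean_deriv_neg by blast
qed

text \<open>The integrand tends to \<open>0\<close> away from \<open>z = 0\<close> and never exceeds \<open>1/2\<close>.\<close>

lemma shrinkage_small:
  assumes "c > 0" shows "\<exists>s>0. shrinkage s < c"
proof -
  define X :: "nat \<Rightarrow> real" where "X n = 1 / real (Suc n)" for n
  have X: "X n > 0" for n by (simp add: X_def)
  have X0: "X \<longlonglongrightarrow> 0" unfolding X_def[abs_def] by real_asymp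
  have "(\<lambda>n. LINT z|gauss. X n * (1 / (2 * X n + z\<^sup>2))) \<longlonglongrightarrow> (LINT z|gauss. 0)"
  proof (rule integral_dominated_convergence[where w = "\<lambda>_. 1 / 2"])
    show "AE z in gauss. (\<lambda>n. X n * (1 / (2 * X n + z\<^sup>2))) \<longlonglongrightarrow> 0"
      using AE_gauss_nonzero
    proof eventually_elim
      fix z :: real assume "z \<noteq> 0"
      then have "(\<lambda>n. X n * (1 / (2 * X n + z\<^sup>2))) \<longlonglongrightarrow> 0 * (1 / (2 * 0 + z\<^sup>2))"
        by (intro tendsto_intros X0) auto
      then show "(\<lambda>n. X n * (1 / (2 * X n + z\<^sup>2))) \<longlonglongrightarrow> 0" by simp
    qed
    show "AE z in gauss. norm (X n * (1 / (2 * X n + z\<^sup>2))) \<le> 1 / 2" for n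
      using X[of n] by (intro AE_I2) (simp add: divide_simps add_pos_nonneg abs_mult)
    show "integrable gauss (\<lambda>_. 1 / 2 :: real)"
      by (rule integrable_gauss_bounded[of _ 1]) auto
  qed auto
  moreover have "(LINT z|gauss. X n * (1 / (2 * X n + z\<^sup>2))) = shrinkage (X n)" for n
    by (simp only: integral_mult_right_zero shrinkage_def F_eq)
  ultimately have "(\<lambda>n. shrinkage (X n)) \<longlonglongrightarrow> 0" by simp
  then have "eventually (\<lambda>n. shrinkage (X n) < c) sequentially"
    using assms by (rule order_tendstoD)
  then show ?thesis using X by (auto dest!: eventually_happens)
qed

lemma shrinkage_large:
  assumes "c < 1 / 2" shows "\<exists>s>0. c < shrinkage s"
proof -
  \<comment> \<open>the point at which the bound \<open>1/(2s)\<close> for \<open>1 - 2 shrinkage s\<close> is half of \<open>1 - 2c\<close>\<close>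
  define s where "s = 1 / (1 - 2 * c)"
  have "s > 0" using assms by (simp add: s_def)
  have "1 / (2 * s) = (1 - 2 * c) / 2" by (simp add: s_def)
  then have "1 - 2 * shrinkage s \<le> (1 - 2 * c) / 2"
    using shrinkage_expansion(1)[OF \<open>s > 0\<close>] by metis
  then have "c < shrinkage s" using assms by argo
  then show ?thesis using \<open>s > 0\<close> by blast
qed

text \<open>Where \<open>shrinkage\<close> is below \<open>1/4\<close> the derivative of \<open>log_mean\<close> is at most \<open>- 1/(2s)\<close>, so
\<open>log_mean\<close> grows at least like \<open>- (ln s)/2\<close> near \<open>0\<close>.\<close>

lemma log_mean_large: "\<exists>s>0. c < log_mean s"
proof -
  obtain s\<^sub>1 where s1: "s\<^sub>1 > 0" "shrinkage s\<^sub>1 < 1 / 4" using shrinkage_small[of "1/4"] by auto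
  \<comment> \<open>far enough to the left for a gain of \<open>\<bar>c\<bar> + 1\<close>\<close>
  define s where "s = s\<^sub>1 * exp (- 2 * \<bar>c\<bar> - 2)"
  have s: "s > 0" "s \<le> s\<^sub>1" using s1 by (auto simp: s_def mult_le_cancel_left1)
  have "(\<lambda>s. log_mean s + ln s / 2) s\<^sub>1 \<le> (\<lambda>s. log_mean s + ln s / 2) s"
  proof (rule DERIV_nonpos_imp_nonincreasing[OF s(2)])
    fix x assume x: "s \<le> x" "x \<le> s\<^sub>1"
    then have x0: "x > 0" using s by simp
    have "((\<lambda>s. log_mean s + ln s / 2) has_real_derivative (2 * F x - 1 / x) + 1 / x / 2) (at x)"
      using x0 by (auto intro!: derivative_eq_intros DERIV_log_mean)
    moreover have "shrinkage x < 1 / 4"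
      using strict_mono_shrinkage[OF x0, of s\<^sub>1] x s1 by (cases "x = s\<^sub>1") auto
    then have "(2 * F x - 1 / x) + 1 / x / 2 \<le> 0"
      using x0 by (simp add: shrinkage_def field_simps)
    ultimately show "\<exists>D. ((\<lambda>s. log_mean s + ln s / 2) has_real_derivative D) (at x) \<and> D \<le> 0"
      by blast
  qed
  moreover have "ln s = ln s\<^sub>1 - 2 * \<bar>c\<bar> - 2" using s1 by (simp add: s_def ln_mult)
  ultimately have "c < log_mean s" using log_mean_bounds(1)[OF s1(1)] abs_ge_self[of c] by argo
  then show ?thesis using s by blast
qed

section \<open>The gap of the digamma function over a half step\<close>

definition digamma_gap :: "real \<Rightarrow> real" where
  "digamma_gap a = Digamma (a + 1 / 2) - Digamma a"

definition trigamma_gap :: "real \<Rightarrow> real" where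
  "trigamma_gap a = Polygamma 1 a - Polygamma 1 (a + 1 / 2)"

lemma not_nonpos_Int: "x > 0 \<Longrightarrow> (x :: real) \<notin> \<int>\<^sub>\<le>\<^sub>0"
  by (auto elim!: nonpos_Ints_cases)

lemma DERIV_digamma_gap:
  assumes "a > 0" shows "(digamma_gap has_real_derivative - trigamma_gap a) (at a)"
  unfolding digamma_gap_def[abs_def] trigamma_gap_def
  using assms by (auto intro!: derivative_eq_intros not_nonpos_Int simp: eval_nat_numeral)

lemma digamma_gap_step:
  assumes "a > 0" shows "digamma_gap a - digamma_gap (a + 1) = 1 / a - 1 / (a + 1 / 2)"
  using Digamma_plus1[of a] Digamma_plus1[of "a + 1/2"] assms
  by (simp add: digamma_gap_def algebra_simps)

lemma trigamma_gap_step: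
  assumes "a > 0" shows "trigamma_gap a - trigamma_gap (a + 1) = 1 / a\<^sup>2 - 1 / (a + 1 / 2)\<^sup>2"
  using Polygamma_plus1[of a 1] Polygamma_plus1[of "a + 1/2" 1] assms
  by (simp add: trigamma_gap_def algebra_simps power2_eq_square)

lemma digamma_gap_bounds:
  assumes "a > 0" shows "0 < digamma_gap a" "digamma_gap a \<le> 1 / a"
proof -
  show "0 < digamma_gap a"
    using Polygamma_real_strict_mono[of a "a + 1/2" 0] assms by (simp add: digamma_gap_def)
  have "Digamma (a + 1 / 2) < Digamma (a + 1)"
    using Polygamma_real_strict_mono[of "a + 1/2" "a + 1" 0] assms by simp
  then show "digamma_gap a \<le> 1 / a"
    using Digamma_plus1[of a] assms by (simp add: digamma_gap_def)
qed

lemma trigamma_gap_bounds: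
  assumes "a > 0" shows "0 < trigamma_gap a" "trigamma_gap a \<le> 1 / a\<^sup>2"
proof -
  show "0 < trigamma_gap a"
    using Polygamma_real_strict_antimono[of a "a + 1/2" 1] assms by (simp add: trigamma_gap_def)
  have "Polygamma 1 (a + 1 / 2) > Polygamma 1 (a + 1)"
    using Polygamma_real_strict_antimono[of "a + 1/2" "a + 1" 1] assms by simp
  then show "trigamma_gap a \<le> 1 / a\<^sup>2"
    using Polygamma_plus1[of a 1] assms by (simp add: trigamma_gap_def power2_eq_square)
qed

lemma strict_antimono_digamma_gap:
  assumes "0 < a" "a < b" shows "digamma_gap b < digamma_gap a"
proof (rule DERIV_neg_imp_decreasing[OF assms(2)])
  fix x assume "a \<le> x" "x \<le> b"
  then have "x > 0" using assms by simp
  then show "\<exists>y. (digamma_gap has_real_derivative y) (at x) \<and> y < 0"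
    using DERIV_digamma_gap trigamma_gap_bounds(1) by (metis neg_less_0_iff_less)
qed

text \<open>The increments of the digamma and trigamma gaps over a unit step are rational functions, so this principle
reduces the comparison of a gap with a rational function to a polynomial inequality.\<close>

lemma positive_by_telescoping:
  fixes f :: "real \<Rightarrow> real"
  assumes "a > 0" and step: "\<And>x. x > 0 \<Longrightarrow> f (x + 1) < f x"
    and lim: "(f \<longlongrightarrow> 0) at_top"
  shows "0 < f a"
proof -
  have "decseq (\<lambda>n. f (a + 1 + real n))"
  proof (rule decseq_SucI)
    show "f (a + 1 + real (Suc n)) \<le> f (a + 1 + real n)" for n
      using step[of "a + 1 + real n"] assms(1) by (simp add: add_ac)
  qed
  moreover have "(\<lambda>n. f (a + 1 + real n)) \<longlonglongrightarrow> 0"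
    by (rule filterlim_compose[OF lim]) real_asymp
  ultimately have "0 \<le> f (a + 1 + real 0)" by (rule decseq_ge)
  then show ?thesis using step[OF assms(1)] by simp
qed

lemma digamma_gap_tendsto: "(digamma_gap \<longlongrightarrow> 0) at_top"
proof (rule tendsto_sandwich[of "\<lambda>_. 0" _ _ "\<lambda>a. 1 / a"])
  show "\<forall>\<^sub>F a in at_top. 0 \<le> digamma_gap a"
    using eventually_gt_at_top[of 0] by eventually_elim (simp add: digamma_gap_bounds less_imp_le)
  show "\<forall>\<^sub>F a in at_top. digamma_gap a \<le> 1 / a"
    using eventually_gt_at_top[of 0] by eventually_elim (simp add: digamma_gap_bounds)
qed real_asymp+

lemma trigamma_gap_tendsto: "(trigamma_gap \<longlongrightarrow> 0) at_top"
proof (rule tendsto_sandwich[of "\<lambda>_. 0" _ _ "\<lambda>a. 1 / a\<^sup>2"])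
  show "\<forall>\<^sub>F a in at_top. 0 \<le> trigamma_gap a"
    using eventually_gt_at_top[of 0] by eventually_elim (simp add: trigamma_gap_bounds less_imp_le)
  show "\<forall>\<^sub>F a in at_top. trigamma_gap a \<le> 1 / a\<^sup>2"
    using eventually_gt_at_top[of 0] by eventually_elim (simp add: trigamma_gap_bounds)
qed real_asymp+

lemma digamma_gap_upper:
  assumes "a > 0" shows "digamma_gap a < 1 / (2 * a) + 1 / (8 * a\<^sup>2)"
proof -
  define f where "f x = 1 / (2 * x) + 1 / (8 * x\<^sup>2) - digamma_gap x" for x
  have "0 < f a"
  proof (rule positive_by_telescoping[OF assms])
    fix x :: real assume x: "x > 0"
    \<comment> \<open>the increments differ by \<open>(2x + 1)\<^sup>2 - 4x(x + 1) = 1\<close> over a positive denominator\<close>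
    have "1 / (2 * x) + 1 / (8 * x\<^sup>2) - (1 / (2 * (x + 1)) + 1 / (8 * (x + 1)\<^sup>2)) - (1 / x - 1 / (x + 1 / 2))
        = 1 / (8 * x\<^sup>2 * (x + 1)\<^sup>2 * (2 * x + 1))"
      using x by (simp add: divide_simps) (simp add: algebra_simps power2_eq_square)
    also have "\<dots> > 0" using x by simp
    finally show "f (x + 1) < f x" using digamma_gap_step[OF x] by (simp add: f_def)
  next
    have "((\<lambda>x. 1 / (2 * x) + 1 / (8 * x\<^sup>2) - digamma_gap x) \<longlongrightarrow> 0 - 0) at_top"
      by (intro tendsto_diff digamma_gap_tendsto) real_asymp
    then show "(f \<longlongrightarrow> 0) at_top" by (simp add: f_def[abs_def])
  qed
  then show ?thesis by (simp add: f_def)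
qed

text \<open>The bound is what Cauchy and Schwarz give for the variance of \<open>ln B\<close>, for a beta variable \<open>B\<close> with
parameters \<open>a\<close> and \<open>1/2\<close>, in terms of its covariance with \<open>B\<close>; it is verified by telescoping.\<close>

lemma trigamma_gap_lower:
  assumes "a > 0" shows "(2 * a + 3) / (a * (2 * a + 1)\<^sup>2) < trigamma_gap a"
proof -
  define f where "f x = trigamma_gap x - (2 * x + 3) / (x * (2 * x + 1)\<^sup>2)" for x
  have "0 < f a"
  proof (rule positive_by_telescoping[OF assms])
    fix x :: real assume x: "x > 0"
    have "1 / x\<^sup>2 - 1 / (x + 1 / 2)\<^sup>2 - ((2 * x + 3) / (x * (2 * x + 1)\<^sup>2) - (2 * (x + 1) + 3) / ((x + 1) * (2 * (x + 1) + 1)\<^sup>2))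
        = (24 * x\<^sup>2 + 30 * x + 9) / (x\<^sup>2 * (x + 1) * (2 * x + 1)\<^sup>2 * (2 * x + 3)\<^sup>2)"
    proof -
      have "x + 1 / 2 = (2 * x + 1) / 2" "2 * (x + 1) + 1 = 2 * x + 3" "2 * (x + 1) + 3 = 2 * x + 5" by simp_all
      moreover have "2 * x + 1 \<noteq> 0" "2 * x + 3 \<noteq> 0" "x + 1 \<noteq> 0" "x \<noteq> 0" using x by simp_all
      ultimately show ?thesis
        by (simp only: power_divide) (simp add: divide_simps, simp add: algebra_simps power2_eq_square)
    qed
    also have "\<dots> > 0" using x by (auto intro!: divide_pos_pos mult_pos_pos add_pos_pos)
    finally show "f (x + 1) < f x" using trigamma_gap_step[OF x] by (simp add: f_def)
  next
    have "((\<lambda>x. trigamma_gap x - (2 * x + 3) / (x * (2 * x + 1)\<^sup>2)) \<longlongrightarrow> 0 - 0) at_top"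
      by (intro tendsto_diff trigamma_gap_tendsto) real_asymp
    then show "(f \<longlongrightarrow> 0) at_top" by (simp add: f_def[abs_def])
  qed
  then show ?thesis by (simp add: f_def)
qed

lemma digamma_gap_large:
  assumes "0 < a" "a < 1 / (c + 2)" "c > 0" shows "c < digamma_gap a"
proof -
  have "1 / a > c + 2" using assms by (simp add: field_simps)
  moreover have "1 / (a + 1 / 2) \<le> 2" using assms by (simp add: field_simps)
  ultimately show ?thesis
    using digamma_gap_step[OF assms(1)] digamma_gap_bounds(1)[of "a + 1"] assms by linarith
qed

section \<open>Invariant quadrants and implicit functions\<close>

text \<open>At a first boundary point one of the functions vanishes and has a positive derivative, so it was negative
just before, against the minimality of that point.\<close>

lemma quadrant_invariant:
  fixes u v :: "real \<Rightarrow> real"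
  assumes u: "\<And>t. t \<in> {a..b} \<Longrightarrow> (u has_real_derivative u' t) (at t within {a..b})"
    and v: "\<And>t. t \<in> {a..b} \<Longrightarrow> (v has_real_derivative v' t) (at t within {a..b})"
    and init: "u a > 0" "v a > 0"
    and edge_u: "\<And>t. t \<in> {a..b} \<Longrightarrow> u t = 0 \<Longrightarrow> v t \<ge> 0 \<Longrightarrow> u' t > 0"
    and edge_v: "\<And>t. t \<in> {a..b} \<Longrightarrow> v t = 0 \<Longrightarrow> u t \<ge> 0 \<Longrightarrow> v' t > 0"
    and t: "t \<in> {a..b}"
  shows "u t > 0 \<and> v t > 0"
proof (rule ccontr)
  assume contra: "\<not> (u t > 0 \<and> v t > 0)"
  define m where "m t = min (u t) (v t)" for t
  have cont_u: "continuous_on {a..b} u" using u by (intro DERIV_continuous_on)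
  have cont_v: "continuous_on {a..b} v" using v by (intro DERIV_continuous_on)
  have cont: "continuous_on {a..b} m"
    unfolding m_def by (intro continuous_intros cont_u cont_v)
  define S where "S = {x \<in> {a..b}. m x \<le> 0}"
  have "closed S"
    using continuous_closed_preimage[OF cont, of "{..0}"] by (simp add: S_def vimage_def Int_def)
  moreover have bdd: "bdd_below S" by (auto simp: S_def intro!: bdd_belowI[of _ a])
  moreover have "t \<in> S" using contra t by (auto simp: S_def m_def)
  ultimately have inf: "Inf S \<in> S" by (intro closed_contains_Inf) auto
  define \<tau> where "\<tau> = Inf S"
  have \<tau>: "\<tau> \<in> {a..b}" "m \<tau> \<le> 0" using inf by (auto simp: S_def \<tau>_def)
  have "\<tau> \<noteq> a" using \<tau> init by (auto simp: m_def)
  then have a\<tau>: "a < \<tau>" using \<tau> by auto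
  have before: "u x > 0" "v x > 0" if "a \<le> x" "x < \<tau>" for x
  proof -
    have "x \<notin> S" using that cInf_lower[OF _ bdd, of x] by (auto simp: \<tau>_def)
    then show "u x > 0" "v x > 0" using that \<tau> by (auto simp: S_def m_def)
  qed
  have sub: "{a..\<tau>} \<subseteq> {a..b}" using \<tau> by auto
  have at\<tau>: "u \<tau> \<ge> 0" "v \<tau> \<ge> 0"
  proof -
    have "closure {a..<\<tau>} = {a..\<tau>}" using a\<tau> by simp
    then show "u \<tau> \<ge> 0" "v \<tau> \<ge> 0"
      using continuous_ge_on_closure[of "{a..<\<tau>}" u \<tau> 0] continuous_ge_on_closure[of "{a..<\<tau>}" v \<tau> 0]
        continuous_on_subset[OF cont_u sub] continuous_on_subset[OF cont_v sub] a\<tau> before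
      by (auto simp: less_imp_le)
  qed
  have no_touch: False
    if w: "(w has_real_derivative w') (at \<tau> within {a..b})" "w' > 0" "w \<tau> = 0"
      and pos: "\<And>x. a \<le> x \<Longrightarrow> x < \<tau> \<Longrightarrow> w x > 0" for w :: "real \<Rightarrow> real" and w'
  proof -
    obtain d where d: "d > 0" "\<And>h. 0 < h \<Longrightarrow> \<tau> - h \<in> {a..b} \<Longrightarrow> h < d \<Longrightarrow> w (\<tau> - h) < w \<tau>"
      using has_real_derivative_pos_inc_left[OF w(1,2)] by blast
    define h where "h = min (d / 2) (\<tau> - a)"
    have "0 < h" "h < d" "\<tau> - h \<in> {a..b}" using d(1) a\<tau> \<tau>(1) by (auto simp: h_def)
    then show False using d(2)[of h] pos[of "\<tau> - h"] w(3) by auto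
  qed
  from \<tau>(2) at\<tau> consider "u \<tau> = 0" | "v \<tau> = 0" by (auto simp: m_def min_def split: if_splits)
  then show False
  proof cases
    case 1 then show False using no_touch[OF u[OF \<tau>(1)] edge_u[OF \<tau>(1)]] at\<tau> before by blast
  next
    case 2 then show False using no_touch[OF v[OF \<tau>(1)] edge_v[OF \<tau>(1)]] at\<tau> before by blast
  qed
qed

text \<open>Monotonicity of \<open>g\<close> makes \<open>s\<close> continuous; then the quotients in Caratheodory's form of the derivatives
of \<open>g\<close> and \<open>k\<close> can be divided.\<close>

lemma DERIV_implicit:
  fixes g s k :: "real \<Rightarrow> real"
  assumes mono: "\<And>x y. 0 < x \<Longrightarrow> x < y \<Longrightarrow> g x < g y"
    and g: "(g has_real_derivative g') (at (s a))" "g' \<noteq> 0"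
    and s: "\<And>b. b > 0 \<Longrightarrow> s b > 0" "\<And>b. b > 0 \<Longrightarrow> g (s b) = k b"
    and k: "(k has_real_derivative k') (at a)"
    and a: "a > 0"
  shows "(s has_real_derivative k' / g') (at a)"
proof -
  have near: "\<forall>\<^sub>F b in at a. b > 0"
    using order_tendstoD(1)[OF tendsto_ident_at a] .
  have klim: "(k \<longlongrightarrow> k a) (at a)"
    using DERIV_isCont[OF k] by (simp add: isCont_def)
  have slim: "(s \<longlongrightarrow> s a) (at a)"
  proof (rule order_tendstoI)
    fix l assume "l < s a"
    then have l: "0 < max l (s a / 2)" "max l (s a / 2) < s a" using s(1)[OF a] by auto
    then have "g (max l (s a / 2)) < k a" using mono[OF l] s(2)[OF a] by simp
    from order_tendstoD(1)[OF klim this] near show "\<forall>\<^sub>F b in at a. l < s b"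
    proof eventually_elim
      case (elim b)
      then have "\<not> s b \<le> max l (s a / 2)"
        using mono[OF s(1), of b "max l (s a / 2)"] s(2)[of b] by (cases "s b = max l (s a / 2)") auto
      then show ?case by simp
    qed
  next
    fix l assume "s a < l"
    then have "k a < g l" using mono[OF s(1)[OF a]] s(2)[OF a] by simp
    from order_tendstoD(2)[OF klim this] near show "\<forall>\<^sub>F b in at a. s b < l"
    proof eventually_elim
      case (elim b)
      then have "\<not> l \<le> s b"
        using mono[of l "s b"] s(2)[of b] \<open>s a < l\<close> s(1)[OF a] by (cases "s b = l") auto
      then show ?case by simp
    qed
  qed
  obtain q where q: "\<And>z. g z - g (s a) = q z * (z - s a)" "isCont q (s a)" "q (s a) = g'"
    using g(1) unfolding CARAT_DERIV by blast
  obtain r where r: "\<And>z. k z - k a = r z * (z - a)" "isCont r a" "r a = k'"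
    using k unfolding CARAT_DERIV by blast
  have qlim: "((\<lambda>b. q (s b)) \<longlongrightarrow> g') (at a)"
    using isCont_tendsto_compose[OF q(2) slim] q(3) by simp
  moreover have "(r \<longlongrightarrow> k') (at a)" using r(2,3) by (simp add: isCont_def)
  ultimately have "((\<lambda>b. r b / q (s b)) \<longlongrightarrow> k' / g') (at a)"
    using g(2) by (intro tendsto_divide)
  moreover have "\<forall>\<^sub>F b in at a. r b / q (s b) = (s b - s a) / (b - a)"
    using near tendsto_imp_eventually_ne[OF qlim g(2)] eventually_neq_at_within[of a]
  proof eventually_elim
    case (elim b)
    then have "r b * (b - a) = q (s b) * (s b - s a)"
      using r(1)[of b] q(1)[of "s b"] s(2)[of b] s(2)[OF a] by simp
    then show ?case using elim by (simp add: divide_simps mult_ac)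
  qed
  ultimately show ?thesis
    unfolding has_field_derivative_iff by (rule Lim_transform_eventually)
qed

section \<open>The zero curve of the \<open>\<beta>\<close> and \<open>\<nu>\<close> components\<close>

lemma A_root:
  assumes "\<alpha> > 0"
  shows "A \<alpha> < \<alpha>" "shrinkage (\<alpha> - A \<alpha>) = \<alpha> / (2 * \<alpha> + 1)"
proof -
  define c where "c = \<alpha> / (2 * \<alpha> + 1)"
  have c: "0 < c" "c < 1 / 2" using assms by (auto simp: c_def field_simps)
  obtain x y where xy: "x > 0" "shrinkage x < c" "y > 0" "c < shrinkage y"
    using shrinkage_small[OF c(1)] shrinkage_large[OF c(2)] by blast
  have "x \<le> y"
    using strict_mono_shrinkage[OF xy(3), of x] xy by (cases "x \<le> y") auto
  then obtain s where s: "x \<le> s" "shrinkage s = c"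
    using IVT[of shrinkage x c y] xy DERIV_isCont[OF DERIV_shrinkage] by auto
  have "F x = \<alpha> / (p * x) \<longleftrightarrow> x * F x = \<alpha> / p" if "x > 0" "p > 0" for x p
    using that by (simp add: field_simps)
  from this[of "\<alpha> - a" "2 * \<alpha> + 1" for a] have root_iff:
    "a < \<alpha> \<and> F (\<alpha> - a) = \<alpha> / ((2 * \<alpha> + 1) * (\<alpha> - a)) \<longleftrightarrow> a < \<alpha> \<and> shrinkage (\<alpha> - a) = c" for a
    using assms unfolding shrinkage_def c_def by auto
  \<comment> \<open>uniqueness makes the definite description meaningful\<close>
  define P where "P a \<longleftrightarrow> a < \<alpha> \<and> shrinkage (\<alpha> - a) = c" for a
  have "P (THE a. P a)"
  proof (rule theI[of P "\<alpha> - s"])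
    show "P (\<alpha> - s)" using s xy by (simp add: P_def)
    show "a = \<alpha> - s" if "P a" for a
      using strict_mono_shrinkage[of "\<alpha> - a" s] strict_mono_shrinkage[of s "\<alpha> - a"] that s xy
      by (cases "\<alpha> - a" s rule: linorder_cases) (auto simp: P_def)
  qed
  moreover have "A \<alpha> = (THE a. P a)" by (simp only: A_def root_iff P_def)
  ultimately have "A \<alpha> < \<alpha> \<and> shrinkage (\<alpha> - A \<alpha>) = c" by (simp add: P_def)
  then show "A \<alpha> < \<alpha>" "shrinkage (\<alpha> - A \<alpha>) = \<alpha> / (2 * \<alpha> + 1)" by (auto simp: c_def)
qed

text \<open>The differential equation of \<open>shrinkage\<close>, evaluated on the curve: \<^const>\<open>A\<close> itself is the slope of
\<open>shrinkage\<close> there, up to a positive factor, hence positive.\<close>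

lemma shrinkage_deriv_at_root:
  assumes "\<alpha> > 0"
  defines "s \<equiv> \<alpha> - A \<alpha>"
  shows "shrinkage s + shrinkage s / (2 * s) - 1 / 2 = A \<alpha> / (2 * s * (2 * \<alpha> + 1))"
proof -
  have s: "s > 0" "shrinkage s = \<alpha> / (2 * \<alpha> + 1)" "A \<alpha> = \<alpha> - s"
    using A_root[OF assms(1)] by (auto simp: s_def)
  show ?thesis unfolding s(2) s(3) using s(1) assms(1)
    by (simp add: divide_simps) (simp add: algebra_simps)
qed

lemma A_pos:
  assumes "\<alpha> > 0" shows "A \<alpha> > 0"
proof -
  have "0 < A \<alpha> / (2 * (\<alpha> - A \<alpha>) * (2 * \<alpha> + 1))"
    using shrinkage_deriv_pos[of "\<alpha> - A \<alpha>"] A_root(1)[OF assms]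
    unfolding shrinkage_deriv_at_root[OF assms] by simp
  moreover have "0 < 2 * (\<alpha> - A \<alpha>) * (2 * \<alpha> + 1)" using A_root(1)[OF assms] assms by simp
  ultimately show ?thesis by (metis less_asym zero_less_divide_iff)
qed

lemma DERIV_root:
  assumes "\<alpha> > 0"
  shows "((\<lambda>\<alpha>. \<alpha> - A \<alpha>) has_real_derivative 2 * (\<alpha> - A \<alpha>) / (A \<alpha> * (2 * \<alpha> + 1))) (at \<alpha>)"
proof -
  have k: "((\<lambda>\<alpha>. \<alpha> / (2 * \<alpha> + 1)) has_real_derivative 1 / (2 * \<alpha> + 1)\<^sup>2) (at \<alpha>)"
    using assms by (auto intro!: derivative_eq_intros simp: power2_eq_square)
  have g: "(shrinkage has_real_derivative A \<alpha> / (2 * (\<alpha> - A \<alpha>) * (2 * \<alpha> + 1))) (at (\<alpha> - A \<alpha>))"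
    using DERIV_shrinkage[of "\<alpha> - A \<alpha>"] shrinkage_deriv_at_root[OF assms] A_root(1)[OF assms] by simp
  have "((\<lambda>\<alpha>. \<alpha> - A \<alpha>) has_real_derivative
      (1 / (2 * \<alpha> + 1)\<^sup>2) / (A \<alpha> / (2 * (\<alpha> - A \<alpha>) * (2 * \<alpha> + 1)))) (at \<alpha>)"
    by (rule DERIV_implicit[where s = "\<lambda>\<alpha>. \<alpha> - A \<alpha>", OF strict_mono_shrinkage g _ _ _ k assms])
      (use A_root A_pos[OF assms] assms in \<open>auto simp: less_imp_neq[THEN not_sym]\<close>)
  also have "(1 / (2 * \<alpha> + 1)\<^sup>2) / (A \<alpha> / (2 * (\<alpha> - A \<alpha>) * (2 * \<alpha> + 1)))
      = 2 * (\<alpha> - A \<alpha>) / (A \<alpha> * (2 * \<alpha> + 1))"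
    using assms by (simp add: power2_eq_square)
  finally show ?thesis .
qed

text \<open>The closed differential equation for \<^const>\<open>A\<close>, with nullcline \<open>A = 2\<alpha>/(2\<alpha> + 3)\<close>.\<close>

lemma DERIV_A:
  assumes "\<alpha> > 0"
  shows "(A has_real_derivative ((2 * \<alpha> + 3) - 2 * \<alpha> / A \<alpha>) / (2 * \<alpha> + 1)) (at \<alpha>)"
proof -
  have "((\<lambda>\<alpha>. \<alpha> - (\<alpha> - A \<alpha>)) has_real_derivative 1 - 2 * (\<alpha> - A \<alpha>) / (A \<alpha> * (2 * \<alpha> + 1))) (at \<alpha>)"
    by (intro DERIV_diff DERIV_ident DERIV_root assms)
  also have "1 - 2 * (\<alpha> - A \<alpha>) / (A \<alpha> * (2 * \<alpha> + 1)) = ((2 * \<alpha> + 3) - 2 * \<alpha> / A \<alpha>) / (2 * \<alpha> + 1)"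
    using A_pos[OF assms] assms by (simp add: divide_simps) (simp add: algebra_simps)
  finally show ?thesis by simp
qed

lemma strict_mono_root:
  assumes "0 < a" "a < b" shows "a - A a < b - A b"
proof (rule DERIV_pos_imp_increasing[OF assms(2)])
  fix x assume "a \<le> x" "x \<le> b"
  then have "x > 0" using assms by simp
  then have "2 * (x - A x) / (A x * (2 * x + 1)) > 0" using A_pos A_root(1)[of x] by simp
  then show "\<exists>y. ((\<lambda>\<alpha>. \<alpha> - A \<alpha>) has_real_derivative y) (at x) \<and> y > 0"
    using DERIV_root[OF \<open>x > 0\<close>] by blast
qed

lemma root_at_top: "filterlim (\<lambda>\<alpha>. \<alpha> - A \<alpha>) at_top at_top"
  unfolding filterlim_at_top_gt[where c = 0]
proof (intro allI impI)
  fix M :: real assume M: "M > 0"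
  have "((\<lambda>\<alpha> :: real. \<alpha> / (2 * \<alpha> + 1)) \<longlongrightarrow> 1 / 2) at_top" by real_asymp
  from order_tendstoD(1)[OF this shrinkage_range(2)[OF M]]
  show "\<forall>\<^sub>F \<alpha> in at_top. M \<le> \<alpha> - A \<alpha>"
    using eventually_gt_at_top[of 0]
  proof eventually_elim
    case (elim \<alpha>)
    then show ?case using strict_mono_shrinkage[of "\<alpha> - A \<alpha>" M] A_root[of \<alpha>]
      by (cases "M \<le> \<alpha> - A \<alpha>") auto
  qed
qed

text \<open>Solving the equation \<open>shrinkage s = \<alpha>/(2\<alpha> + 1)\<close> for \<open>\<alpha>\<close> writes \<open>A \<alpha> = \<alpha> - s\<close> as an explicit
function \<open>\<phi>\<close> of \<open>s\<close> and \<open>shrinkage s\<close>, and the expansion of \<open>shrinkage\<close> squeezes \<open>\<phi>\<close>.\<close>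

lemma A_tendsto: "(A \<longlongrightarrow> 1) at_top"
proof -
  define \<phi> where "\<phi> s = (1 / (1 - 2 * shrinkage s) - 1) / 2 - s" for s
  define p where "p s = 1 / (2 * s) - 3 / (4 * s\<^sup>2)" for s :: real
  define q where "q s = 1 / (2 * s) - 3 / (4 * s\<^sup>2) + 15 / (8 * s ^ 3)" for s :: real
  have "(\<phi> \<longlongrightarrow> 1) at_top"
  proof (rule tendsto_sandwich[of "\<lambda>s. (1 / q s - 1) / 2 - s" _ _ "\<lambda>s. (1 / p s - 1) / 2 - s"])
    have p: "p s > 0" if "s > 2" for s
      using that by (simp add: p_def field_simps power2_eq_square)
    show "\<forall>\<^sub>F s in at_top. (1 / q s - 1) / 2 - s \<le> \<phi> s"
      using eventually_gt_at_top[of 2]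
    proof eventually_elim
      case (elim s)
      then have "1 / q s \<le> 1 / (1 - 2 * shrinkage s)"
        using p[of s] shrinkage_expansion[of s] by (intro divide_left_mono) (auto simp: p_def q_def)
      then show ?case by (simp add: \<phi>_def)
    qed
    show "\<forall>\<^sub>F s in at_top. \<phi> s \<le> (1 / p s - 1) / 2 - s"
      using eventually_gt_at_top[of 2]
    proof eventually_elim
      case (elim s)
      then have "1 / (1 - 2 * shrinkage s) \<le> 1 / p s"
        using p[of s] shrinkage_expansion[of s] by (intro divide_left_mono) (auto simp: p_def)
      then show ?case by (simp add: \<phi>_def)
    qed
    show "((\<lambda>s. (1 / q s - 1) / 2 - s) \<longlongrightarrow> 1) at_top" unfolding q_def by real_asymp
    show "((\<lambda>s. (1 / p s - 1) / 2 - s) \<longlongrightarrow> 1) at_top" unfolding p_def by real_asymp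
  qed
  then have "((\<lambda>\<alpha>. \<phi> (\<alpha> - A \<alpha>)) \<longlongrightarrow> 1) at_top"
    using root_at_top by (rule filterlim_compose)
  moreover have "\<forall>\<^sub>F \<alpha> in at_top. \<phi> (\<alpha> - A \<alpha>) = A \<alpha>"
    using eventually_gt_at_top[of 0]
  proof eventually_elim
    case (elim \<alpha>)
    then have "1 - 2 * shrinkage (\<alpha> - A \<alpha>) = 1 / (2 * \<alpha> + 1)"
      using A_root(2)[OF elim] by (simp add: field_simps)
    then show ?case by (simp add: \<phi>_def)
  qed
  ultimately show ?thesis by (rule Lim_transform_eventually)
qed

text \<open>If \<^const>\<open>A\<close> were on or below the nullcline \<open>Q\<close> at some point, it would stay below the increasing
function \<open>Q\<close> and decrease from then on, to a limit less than \<open>1\<close>.\<close>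

lemma A_lower:
  assumes "a > 0" shows "2 * a / (2 * a + 3) < A a"
proof (rule ccontr)
  define Q where "Q x = 2 * x / (2 * x + 3)" for x :: real
  define A' where "A' x = ((2 * x + 3) - 2 * x / A x) / (2 * x + 1)" for x
  assume "\<not> 2 * a / (2 * a + 3) < A a"
  then have start: "A a \<le> Q a" by (simp add: Q_def)
  have A': "(A has_real_derivative A' x) (at x)" if "x > 0" for x
    using DERIV_A[OF that] by (simp add: A'_def)
  have Q': "(Q has_real_derivative 6 / (2 * x + 3)\<^sup>2) (at x)" if "x > 0" for x
    unfolding Q_def using that by (auto intro!: derivative_eq_intros simp: power2_eq_square algebra_simps)
  have below: "A' x \<le> 0" if "x > 0" "A x \<le> Q x" for x
  proof -
    have "2 * x + 3 \<le> 2 * x / A x"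
      using that A_pos[of x] by (simp add: Q_def field_simps)
    then show ?thesis using that by (simp add: A'_def divide_nonpos_pos)
  qed
  have diff: "((\<lambda>x. Q x - A x) has_real_derivative 6 / (2 * x + 3)\<^sup>2 - A' x) (at x)" if "x > 0" for x
    by (intro DERIV_diff Q' A' that)
  have slope: "6 / (2 * x + 3)\<^sup>2 - A' x > 0" if "x > 0" "A x \<le> Q x" for x
    using below[OF that] that by (smt (verit) zero_less_divide_iff zero_less_power)
  \<comment> \<open>a step to the right makes the inequality strict, also when it starts with equality\<close>
  obtain b where b: "a \<le> b" "A b < Q b"
  proof -
    obtain d where "d > 0" "\<And>h. 0 < h \<Longrightarrow> h < d \<Longrightarrow> Q a - A a < Q (a + h) - A (a + h)"
      using DERIV_pos_inc_right[OF diff[OF assms] slope[OF assms start]] by blast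
    from this(1) this(2)[of "d / 2"] have "A (a + d/2) < Q (a + d/2)" using start by simp
    then show ?thesis using that[of "a + d/2"] \<open>d > 0\<close> by simp
  qed
  have "b > 0" using b assms by simp
  have stay: "A x < Q x" if "x \<ge> b" for x
  proof -
    have "0 < Q x - A x \<and> 0 < (1 :: real)"
      by (rule quadrant_invariant[where a = b and b = x and v' = "\<lambda>_. 0" and u' = "\<lambda>x. 6 / (2 * x + 3)\<^sup>2 - A' x"])
        (use b \<open>b > 0\<close> that slope in \<open>auto intro!: has_field_derivative_at_within[OF diff]\<close>)
    then show ?thesis by simp
  qed
  have dec: "A x \<le> A b" if "x \<ge> b" for x
  proof (rule DERIV_nonpos_imp_nonincreasing[OF that])
    fix y assume "b \<le> y" "y \<le> x"
    then show "\<exists>D. (A has_real_derivative D) (at y) \<and> D \<le> 0"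
      using A'[of y] below[of y] stay[of y] \<open>b > 0\<close> by (intro exI[of _ "A' y"]) auto
  qed
  have "1 \<le> A b"
    by (rule tendsto_upperbound[OF A_tendsto])
      (use dec in \<open>auto intro: eventually_mono[OF eventually_ge_at_top[of b]]\<close>)
  moreover have "Q b < 1" using \<open>b > 0\<close> by (simp add: Q_def)
  ultimately show False using b by simp
qed

text \<open>The derivative of the difference \<open>\<Delta>\<close> is \<open>2/((2\<alpha> + 1)\<^sup>2 A) - trigamma_gap \<alpha>\<close>. The lower bounds for
\<^const>\<open>A\<close> and for \<open>trigamma_gap\<close> match exactly and make it negative.\<close>

lemma log_mean_at_root_less:
  assumes "a > 0" shows "log_mean (a - A a) < digamma_gap a"
proof -
  define \<Delta> where "\<Delta> x = digamma_gap x - log_mean (x - A x)" for x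
  have dec: "\<Delta> y < \<Delta> x" if "0 < x" "x < y" for x y
  proof (rule DERIV_neg_imp_decreasing[OF that(2)])
    fix t assume "x \<le> t" "t \<le> y"
    then have t: "t > 0" using that by simp
    define s where "s = t - A t"
    have s: "s > 0" using A_root[OF t] by (simp add: s_def)
    have Fs: "2 * F s - 1 / s = - 1 / (s * (2 * t + 1))"
    proof -
      have "s * F s = t / (2 * t + 1)"
        using A_root(2)[OF t] unfolding s_def[symmetric] shrinkage_def .
      then have "F s = t / (2 * t + 1) / s" using s by (metis less_irrefl nonzero_mult_div_cancel_left)
      then show ?thesis using s t by (simp add: divide_simps) (simp add: algebra_simps)
    qed
    have "(\<Delta> has_real_derivative - trigamma_gap t - (2 * F s - 1 / s) * (2 * s / (A t * (2 * t + 1)))) (at t)"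
      unfolding \<Delta>_def s_def
      by (intro DERIV_diff DERIV_digamma_gap DERIV_chain2[OF DERIV_log_mean DERIV_root] t)
        (use s in \<open>simp add: s_def\<close>)
    also have "- trigamma_gap t - (2 * F s - 1 / s) * (2 * s / (A t * (2 * t + 1)))
        = 2 / (2 * t + 1)\<^sup>2 / A t - trigamma_gap t"
      unfolding Fs using s t A_pos[OF t] by (simp add: divide_simps power2_eq_square)
    finally have D: "(\<Delta> has_real_derivative 2 / (2 * t + 1)\<^sup>2 / A t - trigamma_gap t) (at t)" .
    have "1 / A t < 1 / (2 * t / (2 * t + 3))"
      using A_lower[OF t] A_pos[OF t] t by (intro divide_strict_left_mono) auto
    then have "2 / (2 * t + 1)\<^sup>2 * (1 / A t) < 2 / (2 * t + 1)\<^sup>2 * (1 / (2 * t / (2 * t + 3)))"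
      using t by (intro mult_strict_left_mono) auto
    also have "\<dots> = (2 * t + 3) / (t * (2 * t + 1)\<^sup>2)"
      using t by (simp add: field_simps)
    also have "\<dots> < trigamma_gap t" by (rule trigamma_gap_lower[OF t])
    finally show "\<exists>D. (\<Delta> has_real_derivative D) (at t) \<and> D < 0" using D by auto
  qed
  have "0 < \<Delta> a"
  proof (rule positive_by_telescoping[OF assms])
    show "\<Delta> (x + 1) < \<Delta> x" if "x > 0" for x using dec that by simp
    have "((\<lambda>x. log_mean (x - A x)) \<longlongrightarrow> 0) at_top"
    proof (rule filterlim_compose[OF _ root_at_top])
      show "(log_mean \<longlongrightarrow> 0) at_top"
      proof (rule tendsto_sandwich[of "\<lambda>_. 0" _ _ "\<lambda>s. 1 / (2 * s)"])
        show "\<forall>\<^sub>F s in at_top. 0 \<le> log_mean s" "\<forall>\<^sub>F s in at_top. log_mean s \<le> 1 / (2 * s)"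
          using log_mean_bounds by (auto intro: eventually_mono[OF eventually_gt_at_top[of 0]])
      qed real_asymp+
    qed
    then have "((\<lambda>x. digamma_gap x - log_mean (x - A x)) \<longlongrightarrow> 0 - 0) at_top"
      by (intro tendsto_diff digamma_gap_tendsto)
    then show "(\<Delta> \<longlongrightarrow> 0) at_top" by (simp add: \<Delta>_def[abs_def])
  qed
  then show ?thesis by (simp add: \<Delta>_def)
qed

section \<open>The zero curve of the \<open>\<alpha>\<close> component\<close>

text \<open>For \<open>a > 0\<close>, the value of \<open>\<sigma>/V\<close> at which the \<open>\<alpha>\<close> component vanishes.\<close>

definition balance :: "real \<Rightarrow> real" where
  "balance a = (THE s. s > 0 \<and> log_mean s = digamma_gap a)"

text \<open>The inequality on the curve \<open>a - A a\<close> provides the right end point for the intermediate value theorem.\<close>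

lemma balance_root:
  assumes "a > 0"
  shows "balance a > 0" "log_mean (balance a) = digamma_gap a"
proof -
  obtain x where x: "x > 0" "digamma_gap a < log_mean x" using log_mean_large by blast
  define y where "y = a - A a"
  have y: "y > 0" "log_mean y < digamma_gap a"
    using A_root[OF assms] log_mean_at_root_less[OF assms] by (auto simp: y_def)
  have "x \<le> y"
    using strict_antimono_log_mean[OF y(1), of x] x y by (cases "x \<le> y") auto
  then obtain s where s: "x \<le> s" "log_mean s = digamma_gap a"
    using IVT2[of log_mean y "digamma_gap a" x] x y DERIV_isCont[OF DERIV_log_mean] by auto
  define P where "P t \<longleftrightarrow> t > 0 \<and> log_mean t = digamma_gap a" for t
  have "P (THE t. P t)"
  proof (rule theI[of P s])
    show "P s" using s x by (simp add: P_def)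
    show "t = s" if "P t" for t
      using strict_antimono_log_mean[of t s] strict_antimono_log_mean[of s t] that s x
      by (cases t s rule: linorder_cases) (auto simp: P_def)
  qed
  moreover have "balance a = (THE t. P t)" by (simp only: balance_def P_def)
  ultimately have "balance a > 0 \<and> log_mean (balance a) = digamma_gap a" by (simp add: P_def)
  then show "balance a > 0" "log_mean (balance a) = digamma_gap a" by auto
qed

lemma log_mean_less_iff: "0 < s \<Longrightarrow> 0 < t \<Longrightarrow> log_mean s < log_mean t \<longleftrightarrow> t < s"
  using strict_antimono_log_mean[of s t] strict_antimono_log_mean[of t s]
  by (cases s t rule: linorder_cases) auto

lemma shrinkage_less_iff: "0 < s \<Longrightarrow> 0 < t \<Longrightarrow> shrinkage s < shrinkage t \<longleftrightarrow> s < t"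
  using strict_mono_shrinkage[of s t] strict_mono_shrinkage[of t s]
  by (cases s t rule: linorder_cases) auto

lemma balance_less_root:
  assumes "a > 0" shows "balance a < a - A a"
  using log_mean_at_root_less[OF assms] log_mean_less_iff[of "a - A a" "balance a"]
    balance_root[OF assms] A_root[OF assms] by simp

lemma strict_mono_balance:
  assumes "0 < a" "a < b" shows "balance a < balance b"
  using strict_antimono_digamma_gap[OF assms] log_mean_less_iff[of "balance b" "balance a"]
    balance_root[of a] balance_root[of b] assms by simp

lemma less_balance_iff:
  assumes "a > 0" "s > 0" shows "s < balance a \<longleftrightarrow> digamma_gap a < log_mean s"
  using log_mean_less_iff[of "balance a" s] balance_root[OF assms(1)] assms by simp

lemma balance_less_iff:
  assumes "a > 0" "s > 0" shows "balance a < s \<longleftrightarrow> log_mean s < digamma_gap a"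
  using log_mean_less_iff[of s "balance a"] balance_root[OF assms(1)] assms by simp

lemma less_root_iff:
  assumes "a > 0" "s > 0" shows "s < a - A a \<longleftrightarrow> 0 < a - (2 * a + 1) * shrinkage s"
proof -
  have "s < a - A a \<longleftrightarrow> shrinkage s < a / (2 * a + 1)"
    using shrinkage_less_iff[of s "a - A a"] A_root[OF assms(1)] assms by simp
  also have "\<dots> \<longleftrightarrow> 0 < a - (2 * a + 1) * shrinkage s" using assms by (simp add: field_simps)
  finally show ?thesis .
qed

lemma balance_at_right_0: "(balance \<longlongrightarrow> 0) (at_right 0)"
proof (rule order_tendstoI)
  fix l :: real assume "l < 0"
  then show "\<forall>\<^sub>F a in at_right 0. l < balance a"
    using balance_root(1) by (auto simp: eventually_at_right_field intro!: exI[of _ 1] intro: less_trans)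
next
  fix l :: real assume l: "0 < l"
  define c where "c = log_mean l + 1"
  have c: "c > 0" using log_mean_bounds(1)[OF l] by (simp add: c_def)
  have "balance a < l" if "0 < a" "a < 1 / (c + 2)" for a
    using digamma_gap_large[OF that c] balance_less_iff[OF that(1) l] by (simp add: c_def)
  then show "\<forall>\<^sub>F a in at_right 0. balance a < l"
    using c by (auto simp: eventually_at_right_field intro!: exI[of _ "1 / (c + 2)"])
qed

lemma balance_at_top: "filterlim balance at_top at_top"
  unfolding filterlim_at_top_gt[where c = 0]
proof (intro allI impI)
  fix M :: real assume M: "M > 0"
  have "log_mean M > 0"
    using strict_antimono_log_mean[of M "M+1"] log_mean_bounds(1)[of "M + 1"] M by simp
  from order_tendstoD(2)[OF digamma_gap_tendsto this]
  show "\<forall>\<^sub>F a in at_top. M \<le> balance a"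
    using eventually_gt_at_top[of 0]
    by eventually_elim (use less_balance_iff M in \<open>auto intro: less_imp_le\<close>)
qed

text \<open>At \<open>x = (1 - \<kappa>/a)(a - A a)\<close> the difference of the lower expansion of \<open>log_mean\<close> and the upper expansion
of \<open>digamma_gap\<close> is \<open>L a/a\<^sup>2\<close>, where \<open>L\<close> tends to \<open>\<kappa>/2\<close> because \<open>a - x\<close> tends to \<open>1 + \<kappa>\<close>.\<close>

lemma balance_above_shrunk_root:
  assumes "\<kappa> > 0"
  shows "\<forall>\<^sub>F a in at_top. (1 - \<kappa> / a) * (a - A a) < balance a"
proof -
  define y where "y a = (1 - \<kappa> / a) * (1 - A a / a)" for a
  define L where "L a = (a * (1 - y a) / y a) / 2 - 3 / (8 * (y a)\<^sup>2) - 1 / 8" for a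
  have A_over: "((\<lambda>a. A a / a) \<longlongrightarrow> 0) at_top"
    by (rule tendsto_divide_0[OF A_tendsto]) (rule filterlim_at_top_imp_at_infinity, rule filterlim_ident)
  have ylim: "(y \<longlongrightarrow> 1) at_top"
  proof -
    have "((\<lambda>a. \<kappa> / a) \<longlongrightarrow> 0) at_top" by real_asymp
    with A_over have "(y \<longlongrightarrow> (1 - 0) * (1 - 0)) at_top"
      unfolding y_def by (intro tendsto_intros)
    then show ?thesis by simp
  qed
  have "((\<lambda>a. a * (1 - y a)) \<longlongrightarrow> 1 + \<kappa> - \<kappa> * 0) at_top"
  proof (rule Lim_transform_eventually)
    show "((\<lambda>a. A a + \<kappa> - \<kappa> * (A a / a)) \<longlongrightarrow> 1 + \<kappa> - \<kappa> * 0) at_top"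
      by (intro tendsto_intros A_tendsto A_over)
    show "\<forall>\<^sub>F a in at_top. A a + \<kappa> - \<kappa> * (A a / a) = a * (1 - y a)"
      using eventually_gt_at_top[of 0]
      by eventually_elim (simp add: y_def field_simps)
  qed
  then have "(L \<longlongrightarrow> ((1 + \<kappa> - \<kappa> * 0) / 1) / 2 - 3 / (8 * 1\<^sup>2) - 1 / 8) at_top"
    unfolding L_def by (intro tendsto_intros ylim) auto
  then have "(L \<longlongrightarrow> \<kappa> / 2) at_top" by (simp add: field_simps)
  from order_tendstoD(1)[OF this, of 0] have "\<forall>\<^sub>F a in at_top. 0 < L a" using assms by simp
  moreover have "\<forall>\<^sub>F a in at_top. 0 < y a" using order_tendstoD(1)[OF ylim, of 0] by simp
  ultimately show ?thesis
    using eventually_gt_at_top[of 0]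
  proof eventually_elim
    case (elim a)
    define x where "x = a * y a"
    have x: "x > 0" using elim by (simp add: x_def)
    have x_eq: "(1 - \<kappa> / a) * (a - A a) = x"
      using elim(3) by (simp add: x_def y_def field_simps)
    have "1 / (2 * x) - 3 / (8 * x\<^sup>2) - (1 / (2 * a) + 1 / (8 * a\<^sup>2)) = L a / a\<^sup>2"
      using elim by (simp add: L_def x_def divide_simps) (simp add: algebra_simps power2_eq_square)
    also have "\<dots> > 0" using elim by simp
    finally have "digamma_gap a < log_mean x"
      using digamma_gap_upper[OF elim(3)] log_mean_bounds(3)[OF x] by linarith
    then show ?case using less_balance_iff[OF elim(3) x] x_eq by simp
  qed
qed

section \<open>Smoothness of the curve\<close>

text \<open>The algebra of functions generated by \<open>\<G>\<close>. If the derivatives of the generators stay in it, it is a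
differential algebra and all its members are smooth.\<close>

inductive generated :: "(real \<Rightarrow> real) set \<Rightarrow> (real \<Rightarrow> real) \<Rightarrow> bool" for \<G> where
  const: "generated \<G> (\<lambda>_. c)"
| gen: "g \<in> \<G> \<Longrightarrow> generated \<G> g"
| add: "generated \<G> f \<Longrightarrow> generated \<G> g \<Longrightarrow> generated \<G> (\<lambda>x. f x + g x)"
| mult: "generated \<G> f \<Longrightarrow> generated \<G> g \<Longrightarrow> generated \<G> (\<lambda>x. f x * g x)"

lemma generated_derivative:
  assumes gens: "\<And>g. g \<in> \<G> \<Longrightarrow> \<exists>g'. generated \<G> g' \<and> (\<forall>x\<in>S. (g has_real_derivative g' x) (at x))"
    and "generated \<G> f"
  shows "\<exists>f'. generated \<G> f' \<and> (\<forall>x\<in>S. (f has_real_derivative f' x) (at x))"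
  using assms(2)
proof induction
  case (const c)
  show ?case by (intro exI[of _ "\<lambda>_. 0"]) (auto intro: generated.const)
next
  case (gen g) then show ?case by (rule gens)
next
  case (add f g)
  then obtain f' g' where "generated \<G> f'" "generated \<G> g'"
    "\<forall>x\<in>S. (f has_real_derivative f' x) (at x)" "\<forall>x\<in>S. (g has_real_derivative g' x) (at x)" by blast
  then show ?case
    by (intro exI[of _ "\<lambda>x. f' x + g' x"]) (auto intro: generated.add DERIV_add)
next
  case (mult f g)
  then obtain f' g' where *: "generated \<G> f'" "generated \<G> g'"
    "\<forall>x\<in>S. (f has_real_derivative f' x) (at x)" "\<forall>x\<in>S. (g has_real_derivative g' x) (at x)" by blast
  then show ?case using mult.hyps
    by (intro exI[of _ "\<lambda>x. f' x * g x + g' x * f x"])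
      (auto intro: generated.add generated.mult DERIV_mult)
qed

lemma smooth_on_generated:
  assumes "open S"
    and gens: "\<And>g. g \<in> \<G> \<Longrightarrow> \<exists>g'. generated \<G> g' \<and> (\<forall>x\<in>S. (g has_real_derivative g' x) (at x))"
    and f: "generated \<G> f"
  shows "smooth_on S f"
proof -
  have diff: "\<exists>q'. generated \<G> q' \<and> (\<forall>x\<in>S. (q has_real_derivative q' x) (at x))"
    if "generated \<G> q" for q
    using gens that by (rule generated_derivative)
  have step: "\<exists>p. generated \<G> p \<and> (\<forall>x\<in>S. (deriv ^^ k) f x = p x)" for k
  proof (induction k)
    case 0 then show ?case using f by auto
  next
    case (Suc k)
    then obtain p where p: "generated \<G> p" "\<forall>x\<in>S. (deriv ^^ k) f x = p x" by blast
    obtain p' where p': "generated \<G> p'" "\<forall>x\<in>S. (p has_real_derivative p' x) (at x)"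
      using diff[OF p(1)] by blast
    have "(deriv ^^ Suc k) f x = p' x" if "x \<in> S" for x
    proof -
      have "\<forall>\<^sub>F y in nhds x. (deriv ^^ k) f y = p y"
        using p(2) eventually_nhds_in_open[OF assms(1) that] by (auto elim: eventually_mono)
      then have "deriv ((deriv ^^ k) f) x = deriv p x" by (rule deriv_cong_ev) simp
      then show ?thesis using p'(2) that by (simp add: DERIV_imp_deriv)
    qed
    then show ?case using p'(1) by blast
  qed
  show ?thesis unfolding smooth_on_def
  proof
    fix k
    obtain p where p: "generated \<G> p" "\<forall>x\<in>S. (deriv ^^ k) f x = p x" using step by blast
    obtain p' where p': "generated \<G> p' \<and> (\<forall>x\<in>S. (p has_real_derivative p' x) (at x))"
      using diff[OF p(1)] by (rule exE)
    have "p differentiable_on S"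
      unfolding differentiable_on_def
    proof (rule ballI, rule differentiable_at_withinI)
      fix x assume "x \<in> S"
      with p' have "(p has_real_derivative p' x) (at x)" by simp
      then show "p differentiable (at x)" unfolding real_differentiable_def by (rule exI)
    qed
    have "(deriv ^^ k) f differentiable (at x within S)" if "x \<in> S" for x
    proof (rule differentiable_transform_within[OF _ zero_less_one that])
      show "p differentiable (at x within S)"
        using \<open>p differentiable_on S\<close> that by (simp add: differentiable_on_def)
    qed (simp add: p(2))
    then show "(deriv ^^ k) f differentiable_on S" by (simp add: differentiable_on_def)
  qed
qed

lemma DERIV_balance:
  assumes "a > 0"
  shows "(balance has_real_derivative (trigamma_gap a) / (1 / balance a - 2 * F (balance a))) (at a)"
proof (rule DERIV_implicit[where g = "\<lambda>s. - log_mean s" and k = "\<lambda>a. - digamma_gap a"])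
  show "((\<lambda>s. - log_mean s) has_real_derivative 1 / balance a - 2 * F (balance a)) (at (balance a))"
    using DERIV_minus[OF DERIV_log_mean[OF balance_root(1)[OF assms]]] by simp
  show "((\<lambda>a. - digamma_gap a) has_real_derivative trigamma_gap a) (at a)"
    using DERIV_minus[OF DERIV_digamma_gap[OF assms]] by simp
  show "1 / balance a - 2 * F (balance a) \<noteq> 0"
    using log_mean_deriv_neg[OF balance_root(1)[OF assms]] by simp
qed (use strict_antimono_log_mean balance_root assms in auto)

text \<open>By implicit differentiation the derivative of \<open>balance\<close> is a polynomial in polygamma functions and
\<open>w = 1/(1/balance - 2F(balance))\<close>; together with \<open>F(balance)\<close> and \<open>1/balance\<close> these functions generate an
algebra that is closed under differentiation.\<close>

lemma smooth_on_balance: "smooth_on {0<..} (\<lambda>a. c * balance a)"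
proof -
  define w where "w a = 1 / (1 / balance a - 2 * F (balance a))" for a
  define \<G> where "\<G> = {balance, \<lambda>a. F (balance a), \<lambda>a. 1 / balance a, w}
      \<union> range (\<lambda>n a. Polygamma n a) \<union> range (\<lambda>n a. Polygamma n (a + 1 / 2))"
  define b' where "b' a = (Polygamma 1 a + (-1) * Polygamma 1 (a + 1 / 2)) * w a" for a
  define F' where "F' a = F (balance a) + (-1/2) * (F (balance a) * (1 / balance a)) + (-1/2) * (1 / balance a)" for a
  have gen: "generated \<G> balance" "generated \<G> (\<lambda>a. F (balance a))" "generated \<G> (\<lambda>a. 1 / balance a)"
    "generated \<G> w" "generated \<G> (\<lambda>a. Polygamma n a)" "generated \<G> (\<lambda>a. Polygamma n (a + 1 / 2))" for n
    by (rule generated.gen; force simp: \<G>_def)+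
  note alg = generated.const generated.add generated.mult gen
  have gb': "generated \<G> b'" unfolding b'_def by (intro alg)
  have gF': "generated \<G> F'" unfolding F'_def by (intro alg)
  have b': "(balance has_real_derivative b' a) (at a)" if "a > 0" for a
    using DERIV_balance[OF that] by (simp add: b'_def w_def trigamma_gap_def)
  have dF: "((\<lambda>a. F (balance a)) has_real_derivative F' a * b' a) (at a)" if "a > 0" for a
    using DERIV_chain2[OF DERIV_F[OF balance_root(1)[OF that]] b'[OF that]] by (simp add: F'_def)
  have dinv: "((\<lambda>a. 1 / balance a) has_real_derivative (-1) * (1 / balance a) * (1 / balance a) * b' a) (at a)"
    if "a > 0" for a
    using balance_root(1)[OF that]
    by (auto intro!: derivative_eq_intros b'[OF that] simp: power2_eq_square)
  have dw: "(w has_real_derivative (-1) * (w a * w a) *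
      ((-1) * (1 / balance a) * (1 / balance a) * b' a + (-2) * (F' a * b' a))) (at a)" if a: "a > 0" for a
  proof -
    have "1 / balance a - 2 * F (balance a) \<noteq> 0"
      using log_mean_deriv_neg[OF balance_root(1)[OF a]] by simp
    moreover have "((\<lambda>a. 1 / balance a - 2 * F (balance a)) has_real_derivative
        ((-1) * (1 / balance a) * (1 / balance a) * b' a) - 2 * (F' a * b' a)) (at a)"
      by (intro DERIV_diff DERIV_cmult dinv dF a)
    ultimately have "((\<lambda>a. inverse (1 / balance a - 2 * F (balance a))) has_real_derivative
        - (w a * (((-1) * (1 / balance a) * (1 / balance a) * b' a) - 2 * (F' a * b' a)) * w a)) (at a)"
      unfolding w_def inverse_eq_divide[symmetric] by (intro DERIV_inverse') (simp_all add: inverse_eq_divide)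
    then show ?thesis by (simp add: w_def[abs_def] inverse_eq_divide mult_ac)
  qed
  have "\<exists>g'. generated \<G> g' \<and> (\<forall>x\<in>{0<..}. (g has_real_derivative g' x) (at x))" if "g \<in> \<G>" for g
  proof -
    from that consider "g = balance" | "g = (\<lambda>a. F (balance a))" | "g = (\<lambda>a. 1 / balance a)" | "g = w"
      | n where "g = (\<lambda>a. Polygamma n a)" | n where "g = (\<lambda>a. Polygamma n (a + 1 / 2))"
      by (auto simp: \<G>_def)
    then show ?thesis
    proof cases
      case 1 then show ?thesis using b' gb' by auto
    next
      case 2
      have "generated \<G> (\<lambda>a. F' a * b' a)" by (intro alg gb' gF')
      then show ?thesis unfolding 2 by - (rule exI, rule conjI, assumption, intro ballI dF, simp)
    next
      case 3
      have "generated \<G> (\<lambda>a. (-1) * (1 / balance a) * (1 / balance a) * b' a)" by (intro alg gb' gF')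
      then show ?thesis unfolding 3 by - (rule exI, rule conjI, assumption, intro ballI dinv, simp)
    next
      case 4
      have "generated \<G> (\<lambda>a. (-1) * (w a * w a) *
          ((-1) * (1 / balance a) * (1 / balance a) * b' a + (-2) * (F' a * b' a)))" by (intro alg gb' gF')
      then show ?thesis unfolding 4 by - (rule exI, rule conjI, assumption, intro ballI dw, simp)
    next
      case 5
      then show ?thesis using gen(5)[of "Suc n"]
        by (intro exI[of _ "\<lambda>a. Polygamma (Suc n) a"]) (auto intro!: derivative_eq_intros not_nonpos_Int)
    next
      case 6
      then show ?thesis using gen(6)[of "Suc n"]
        by (intro exI[of _ "\<lambda>a. Polygamma (Suc n) (a + 1 / 2)"]) (auto intro!: derivative_eq_intros not_nonpos_Int)
    qed
  qed
  from smooth_on_generated[OF open_greaterThan this generated.mult[OF generated.const gen(1)]]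
  show ?thesis .
qed

section \<open>Global solutions of ordinary differential equations\<close>

definition ode_solution :: "('a::real_normed_vector \<Rightarrow> 'a) \<Rightarrow> 'a set \<Rightarrow> real set \<Rightarrow> (real \<Rightarrow> 'a) \<Rightarrow> bool" where
  "ode_solution f D J x \<longleftrightarrow> (\<forall>t\<in>J. x t \<in> D \<and> (x has_vector_derivative f (x t)) (at t within J))"

lemma at_within_Ici_eq_Icc:
  fixes t :: real assumes "0 \<le> t" "t < T"
  shows "at t within {0..} = at t within {0..T}" "at t within {0..<T} = at t within {0..T}"
  by (rule at_within_nhd[of t "{..<T}"]; use assms in auto)+

lemma has_vector_derivative_integral_Ici:
  fixes g :: "real \<Rightarrow> 'a::banach"
  assumes "continuous_on {0..} g" "0 \<le> t"
  shows "((\<lambda>t. integral {0..t} g) has_vector_derivative g t) (at t within {0..})"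
  using integral_has_vector_derivative[of 0 "t + 1" g t] continuous_on_subset[OF assms(1)] assms(2)
    at_within_Ici_eq_Icc(1)[of t "t + 1"] by auto

lemma norm_integral_le_exp:
  fixes g :: "real \<Rightarrow> 'a::banach"
  assumes g: "continuous_on {0..} g" and bd: "\<And>u. 0 \<le> u \<Longrightarrow> norm (g u) \<le> M * exp (c * u)"
    and "c > 0" "M \<ge> 0" "0 \<le> t"
  shows "norm (integral {0..t} g) \<le> M / c * exp (c * t)"
proof -
  have int: "((\<lambda>u. M * exp (c * u)) has_integral M / c * exp (c * t) - M / c * exp (c * 0)) {0..t}"
    by (rule fundamental_theorem_of_calculus)
      (use assms in \<open>auto intro!: derivative_eq_intros simp: has_real_derivative_iff_has_vector_derivative[symmetric]\<close>)
  have "norm (integral {0..t} g) \<le> integral {0..t} (\<lambda>u. M * exp (c * u))"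
    by (rule integral_norm_bound_integral)
      (use bd int in \<open>auto intro!: integrable_continuous_interval continuous_intros continuous_on_subset[OF g] intro: has_integral_integrable\<close>)
  also have "\<dots> = M / c * exp (c * t) - M / c" using integral_unique[OF int] by simp
  also have "\<dots> \<le> M / c * exp (c * t)" using assms by simp
  finally show ?thesis .
qed

text \<open>Picard iteration on the whole half line at once. In the weighted unknown \<open>exp (- 2Kt)(x t - x\<^sub>0)\<close> the integral
operator preserves bounded continuous functions and contracts by the factor \<open>1/2\<close>, so Banach's fixed
point theorem replaces any continuation argument.\<close>

lemma global_ode_solution:
  fixes f :: "'a::banach \<Rightarrow> 'a"
  assumes "L-lipschitz_on UNIV f"
  shows "\<exists>x. x 0 = x\<^sub>0 \<and> ode_solution f UNIV {0..} x"
proof -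
  \<comment> \<open>a positive Lipschitz constant, as \<open>L\<close> may be \<open>0\<close>\<close>
  define K where "K = L + 1"
  have K: "K > 0" "norm (f x - f y) \<le> K * norm (x - y)" for x y
  proof -
    show "K > 0" using lipschitz_on_nonneg[OF assms] by (simp add: K_def)
    show "norm (f x - f y) \<le> K * norm (x - y)"
      using lipschitz_on_normD[OF assms UNIV_I UNIV_I, of x y] norm_ge_zero[of "x - y"]
      unfolding K_def distrib_right by linarith
  qed
  have contf: "continuous_on S f" for S
    using lipschitz_on_continuous_on[OF assms] continuous_on_subset by blast
  define g where "g y u = f (x\<^sub>0 + exp (2 * K * u) *\<^sub>R apply_bcontfun y u)" for y u
  have contg: "continuous_on S (g y)" for S y
    unfolding g_def by (intro continuous_on_compose2[OF contf[of UNIV]] continuous_intros) auto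
  \<comment> \<open>constant for negative times, since the bounded continuous functions live on the whole line\<close>
  define \<Phi> where "\<Phi> y t = exp (- 2 * K * max 0 t) *\<^sub>R integral {0..max 0 t} (g y)" for y t
  have scale: "norm (exp (- 2 * K * max 0 t) *\<^sub>R integral {0..max 0 t} h) \<le> M / (2 * K)"
    if "continuous_on {0..} h" "\<And>u. 0 \<le> u \<Longrightarrow> norm (h u) \<le> M * exp (2 * K * u)" "M \<ge> 0" for h :: "real \<Rightarrow> 'a" and M t
  proof -
    have "norm (integral {0..max 0 t} h) \<le> M / (2 * K) * exp (2 * K * max 0 t)"
      by (rule norm_integral_le_exp) (use that K in auto)
    then have "exp (- 2 * K * max 0 t) * norm (integral {0..max 0 t} h)
        \<le> exp (- 2 * K * max 0 t) * (M / (2 * K) * exp (2 * K * max 0 t))"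
      by (intro mult_left_mono) auto
    also have "\<dots> = M / (2 * K) * exp (- 2 * K * max 0 t + 2 * K * max 0 t)"
      unfolding exp_add by simp
    finally show ?thesis by simp
  qed
  have \<Phi>: "\<Phi> y \<in> bcontfun" for y
  proof (rule bcontfun_normI)
    have "continuous_on {0..} (\<lambda>t. integral {0..t} (g y))"
      using has_vector_derivative_integral_Ici[OF contg]
      by (intro continuous_on_vector_derivative) auto
    then have "continuous_on UNIV (\<lambda>t. integral {0..max 0 t} (g y))"
      by (rule continuous_on_compose2) (auto intro!: continuous_intros)
    then show "continuous_on UNIV (\<Phi> y)"
      unfolding \<Phi>_def by (intro continuous_intros)
    define M where "M = norm (f x\<^sub>0) + K * norm y"
    have "norm (g y u) \<le> M * exp (2 * K * u)" if "0 \<le> u" for u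
    proof -
      have "norm (g y u) \<le> norm (f x\<^sub>0) + norm (g y u - f x\<^sub>0)" by (rule norm_triangle_sub)
      also have "norm (g y u - f x\<^sub>0) \<le> K * (exp (2 * K * u) * norm (apply_bcontfun y u))"
        using K(2)[of "x\<^sub>0 + exp (2 * K * u) *\<^sub>R apply_bcontfun y u" x\<^sub>0] by (simp add: g_def)
      also have "\<dots> \<le> K * (exp (2 * K * u) * norm y)"
        using K(1) norm_bounded[of y u] by (intro mult_left_mono) auto
      also have "norm (f x\<^sub>0) \<le> norm (f x\<^sub>0) * exp (2 * K * u)"
        using that K(1) by (simp add: mult_le_cancel_left1)
      finally show ?thesis by (simp add: M_def algebra_simps)
    qed
    then show "norm (\<Phi> y t) \<le> M / (2 * K)" for t
      unfolding \<Phi>_def by (intro scale contg) (use K in \<open>auto simp: M_def\<close>)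
  qed
  define P where "P y = Bcontfun (\<Phi> y)" for y
  have P: "apply_bcontfun (P y) = \<Phi> y" for y
    unfolding P_def by (rule Bcontfun_inverse[OF \<Phi>])
  have contraction: "dist (P y) (P z) \<le> 1 / 2 * dist y z" for y z
  proof (rule dist_bound)
    fix t
    have gi: "g w integrable_on {0..max 0 t}" for w
      by (intro integrable_continuous_interval contg)
    have "\<Phi> y t - \<Phi> z t = exp (- 2 * K * max 0 t) *\<^sub>R integral {0..max 0 t} (\<lambda>u. g y u - g z u)"
      unfolding \<Phi>_def integral_diff[OF gi gi] by (simp add: scaleR_diff_right)
    also have "norm \<dots> \<le> (K * dist y z) / (2 * K)"
    proof (rule scale)
      fix u :: real assume "0 \<le> u"
      have "norm (g y u - g z u) \<le> K * (exp (2 * K * u) * dist (apply_bcontfun y u) (apply_bcontfun z u))"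
        using K(2)[of "x\<^sub>0 + exp (2 * K * u) *\<^sub>R apply_bcontfun y u" "x\<^sub>0 + exp (2 * K * u) *\<^sub>R apply_bcontfun z u"]
        by (simp add: g_def dist_norm flip: scaleR_diff_right)
      also have "\<dots> \<le> K * (exp (2 * K * u) * dist y z)"
        using K(1) dist_bounded[of y u z] by (intro mult_left_mono) auto
      finally show "norm (g y u - g z u) \<le> K * dist y z * exp (2 * K * u)" by (simp add: mult_ac)
    qed (use K in \<open>auto intro!: continuous_intros contg\<close>)
    finally show "dist (apply_bcontfun (P y) t) (apply_bcontfun (P z) t) \<le> 1 / 2 * dist y z"
      using K(1) by (simp add: P dist_norm)
  qed
  have "\<exists>!y. P y = y"
    by (rule banach_fix_type[of "1/2"]) (use contraction in auto)
  then obtain y where y: "P y = y" by blast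
  define x where "x t = x\<^sub>0 + exp (2 * K * t) *\<^sub>R apply_bcontfun y t" for t
  have x_eq: "x t = x\<^sub>0 + integral {0..t} (g y)" if "t \<ge> 0" for t
  proof -
    have "apply_bcontfun y t = \<Phi> y t" using P[of y] y by simp
    then show ?thesis using that by (simp add: x_def \<Phi>_def flip: exp_add)
  qed
  have "(x has_vector_derivative f (x t)) (at t within {0..})" if "t \<ge> 0" for t
  proof (rule has_vector_derivative_transform)
    show "((\<lambda>t. x\<^sub>0 + integral {0..t} (g y)) has_vector_derivative f (x t)) (at t within {0..})"
      using has_vector_derivative_add[OF has_vector_derivative_const has_vector_derivative_integral_Ici[OF contg that]]
      by (simp add: g_def x_def)
  qed (use that x_eq in auto)
  moreover have "x 0 = x\<^sub>0" using x_eq[of 0] by simp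
  ultimately show ?thesis unfolding ode_solution_def by auto
qed

lemma ode_solution_mono:
  assumes "ode_solution f D J x" "I \<subseteq> J" shows "ode_solution f D I x"
  using assms unfolding ode_solution_def by (blast intro: has_vector_derivative_within_subset)

lemma nonincreasing_if_derivative_within_nonpos:
  fixes w :: "real \<Rightarrow> real"
  assumes "a \<le> b" and w: "\<And>t. t \<in> {a..b} \<Longrightarrow> (w has_real_derivative w' t) (at t within {a..b})"
    and "\<And>t. t \<in> {a..b} \<Longrightarrow> w' t \<le> 0"
  shows "w b \<le> w a"
proof (rule DERIV_nonpos_imp_decreasing_open[OF assms(1)])
  fix t assume "a < t" "t < b"
  then show "\<exists>y. (w has_real_derivative y) (at t) \<and> y \<le> 0"
    using w[of t] assms(3)[of t] at_within_Icc_at[of a t b] by auto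
next
  show "continuous_on {a..b} w" using w by (rule DERIV_continuous_on)
qed

text \<open>Gronwall's argument: \<open>exp (- 2Lt) (norm (x t - y t))\<^sup>2\<close> is nonincreasing.\<close>

lemma ode_solution_unique:
  fixes f :: "'a::real_inner \<Rightarrow> 'a"
  assumes f: "L-lipschitz_on D f"
    and x: "ode_solution f D {0..T} x" and y: "ode_solution f D {0..T} y"
    and init: "x 0 = y 0" and t: "t \<in> {0..T}"
  shows "x t = y t"
proof -
  define w where "w t = exp (- 2 * L * t) * ((x t - y t) \<bullet> (x t - y t))" for t
  define w' where "w' t = exp (- 2 * L * t) * (2 * ((f (x t) - f (y t)) \<bullet> (x t - y t))) +
      (- 2 * L) * exp (- 2 * L * t) * ((x t - y t) \<bullet> (x t - y t))" for t
  have "w t \<le> w 0"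
  proof (rule nonincreasing_if_derivative_within_nonpos[where w = w and w' = w'])
    fix s assume "s \<in> {0..t}"
    then have s: "s \<in> {0..T}" using t by auto
    have D: "x s \<in> D" "y s \<in> D" using x y s unfolding ode_solution_def by auto
    have der: "((\<lambda>t. x t - y t) has_vector_derivative f (x s) - f (y s)) (at s within {0..t})"
    proof (rule has_vector_derivative_diff)
      show "(x has_vector_derivative f (x s)) (at s within {0..t})"
        "(y has_vector_derivative f (y s)) (at s within {0..t})"
        using ode_solution_mono[OF x, of "{0..t}"] ode_solution_mono[OF y, of "{0..t}"] \<open>s \<in> {0..t}\<close> t
        by (simp_all add: ode_solution_def)
    qed
    have "((\<lambda>t. (x t - y t) \<bullet> (x t - y t)) has_vector_derivative
        (x s - y s) \<bullet> (f (x s) - f (y s)) + (f (x s) - f (y s)) \<bullet> (x s - y s)) (at s within {0..t})"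
      using bounded_bilinear.has_vector_derivative[OF bounded_bilinear_inner der der] .
    then have ip: "((\<lambda>t. (x t - y t) \<bullet> (x t - y t)) has_real_derivative
        2 * ((f (x s) - f (y s)) \<bullet> (x s - y s))) (at s within {0..t})"
      by (simp add: has_real_derivative_iff_has_vector_derivative inner_commute)
    show "(w has_real_derivative w' s) (at s within {0..t})"
      unfolding w_def w'_def by (auto intro!: derivative_eq_intros ip)
    have "(f (x s) - f (y s)) \<bullet> (x s - y s) \<le> norm (f (x s) - f (y s)) * norm (x s - y s)"
      by (rule norm_cauchy_schwarz)
    also have "\<dots> \<le> L * norm (x s - y s) * norm (x s - y s)"
      using lipschitz_on_normD[OF f D] by (intro mult_right_mono) auto
    also have "\<dots> = L * ((x s - y s) \<bullet> (x s - y s))"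
      by (simp add: dot_square_norm power2_eq_square)
    finally have "exp (- 2 * L * s) * (2 * ((f (x s) - f (y s)) \<bullet> (x s - y s)) - 2 * L * ((x s - y s) \<bullet> (x s - y s))) \<le> 0"
      by (intro mult_nonneg_nonpos) auto
    then show "w' s \<le> 0" unfolding w'_def by (simp add: algebra_simps)
  qed (use t in auto)
  then have "(x t - y t) \<bullet> (x t - y t) \<le> 0" using init by (simp add: w_def mult_le_0_iff)
  then show ?thesis using inner_ge_zero[of "x t - y t"] by (metis antisym eq_iff_diff_eq_0 inner_eq_zero_iff)
qed

lemma stays_in_closed_subset:
  fixes x :: "real \<Rightarrow> 'a::topological_space"
  assumes cont: "continuous_on {0..T} x" and "x 0 \<in> K" "closed K" "K \<subseteq> B" "open B"
    and step: "\<And>t. t \<in> {0..T} \<Longrightarrow> (\<forall>u\<in>{0..t}. x u \<in> B) \<Longrightarrow> x t \<in> K"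
    and t: "t \<in> {0..T}"
  shows "x t \<in> K"
proof (rule ccontr)
  assume "x t \<notin> K"
  define S where "S = {u \<in> {0..T}. x u \<notin> B}"
  obtain u where "u \<in> {0..t}" "x u \<notin> B" using step[OF t] \<open>x t \<notin> K\<close> by blast
  then have "u \<in> S" using t by (simp add: S_def)
  then have "S \<noteq> {}" by blast
  have "closed S"
    using continuous_closed_preimage[OF cont, of "- B"] \<open>open B\<close>
    by (simp add: S_def vimage_def Int_def closed_Compl)
  have bdd: "bdd_below S" by (auto simp: S_def intro!: bdd_belowI[of _ 0])
  define \<tau> where "\<tau> = Inf S"
  have "\<tau> \<in> S" unfolding \<tau>_def by (rule closed_contains_Inf) fact+
  then have \<tau>: "\<tau> \<in> {0..T}" "x \<tau> \<notin> B" by (auto simp: S_def)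
  then have "\<tau> > 0" using assms(2,4) by (cases "\<tau> = 0") auto
  have before: "x u \<in> B" if "u \<in> {0..<\<tau>}" for u
    using that cInf_lower[OF _ bdd, of u] \<tau> by (force simp: S_def \<tau>_def)
  have inK: "x u \<in> K" if "u \<in> {0..<\<tau>}" for u
    using step[of u] before that \<tau> by auto
  have "x ` closure {0..<\<tau>} \<subseteq> K"
    by (rule image_closure_subset)
      (use inK \<open>closed K\<close> \<tau> \<open>\<tau> > 0\<close> in \<open>auto intro: continuous_on_subset[OF cont]\<close>)
  then have "x \<tau> \<in> K" using \<open>\<tau> > 0\<close> by auto
  then show False using \<tau> assms(4) by auto
qed

text \<open>Composing the field with the projection onto the box makes it globally Lipschitz. The a priori bound keeps
the solution of the projected equation in \<open>K\<close>, where the projection changes nothing.\<close>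

lemma ode_solution_in_box:
  fixes f :: "'a::euclidean_space \<Rightarrow> 'a"
  assumes f: "L-lipschitz_on (cbox a b) f"
    and K: "x\<^sub>0 \<in> K" "closed K" "K \<subseteq> box a b"
    and apriori: "\<And>x t. t \<in> {0..T} \<Longrightarrow> x 0 = x\<^sub>0 \<Longrightarrow> ode_solution f (box a b) {0..t} x \<Longrightarrow> x t \<in> K"
  shows "\<exists>x. x 0 = x\<^sub>0 \<and> ode_solution f K {0..T} x"
proof -
  have sub: "box a b \<subseteq> cbox a b" by (rule box_subset_cbox)
  have "x\<^sub>0 \<in> cbox a b" using K sub by blast
  then have ab: "a \<bullet> i \<le> b \<bullet> i" if "i \<in> Basis" for i
    using that by (auto simp: mem_box intro: order_trans)
  have clamp: "clamp a b x \<in> cbox a b" for x using ab by simp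
  have "(L * 1)-lipschitz_on UNIV (\<lambda>x. f (clamp a b x))"
  proof (rule lipschitz_on_compose2[where f = "clamp a b" and g = f])
    show "1-lipschitz_on UNIV (clamp a b)"
      by (rule lipschitz_onI) (simp_all add: dist_clamps_le_dist_args)
    show "L-lipschitz_on (range (clamp a b)) f"
      by (rule lipschitz_on_subset[OF f]) (use clamp in auto)
  qed
  then obtain x where x: "x 0 = x\<^sub>0" "ode_solution (\<lambda>x. f (clamp a b x)) UNIV {0..} x"
    using global_ode_solution by blast
  have unclamped: "(x has_vector_derivative f (x u)) (at u within {0..t})"
    if "0 \<le> u" "x u \<in> box a b" for u t
  proof -
    have "clamp a b (x u) = x u" using that sub by (intro clamp_cancel_cbox) blast
    moreover have "(x has_vector_derivative f (clamp a b (x u))) (at u within {0..})"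
      using x(2) that(1) by (simp add: ode_solution_def)
    ultimately have "(x has_vector_derivative f (x u)) (at u within {0..})" by (simp only:)
    then show ?thesis by (rule has_vector_derivative_within_subset) auto
  qed
  have inK: "x t \<in> K" if "t \<in> {0..T}" for t
  proof (rule stays_in_closed_subset[where x = x and K = K and B = "box a b" and T = T])
    show "continuous_on {0..T} x"
      by (rule continuous_on_vector_derivative)
        (use x(2) in \<open>auto simp: ode_solution_def intro: has_vector_derivative_within_subset\<close>)
    show "x 0 \<in> K" using x K by simp
    show "x t \<in> K" if "t \<in> {0..T}" and "\<forall>u\<in>{0..t}. x u \<in> box a b" for t
      by (rule apriori[where x = x and t = t]) (use x that unclamped in \<open>auto simp: ode_solution_def\<close>) 
  qed (use that K in \<open>auto simp: open_box\<close>)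
  then have "ode_solution f K {0..T} x"
    using unclamped K(3) unfolding ode_solution_def by (meson atLeastAtMost_iff subsetD)
  then show ?thesis using x(1) by blast
qed

text \<open>Patching \<open>x t = X (t + 1) t\<close> leaves room to the right of \<open>t\<close>, so that the derivative is that of a single
solution.\<close>

lemma ode_solution_glue:
  fixes f :: "'a::real_normed_vector \<Rightarrow> 'a"
  assumes ex: "\<And>T. T > 0 \<Longrightarrow> \<exists>x. x 0 = x\<^sub>0 \<and> ode_solution f D {0..T} x"
    and uniq: "\<And>T x y t. x 0 = x\<^sub>0 \<Longrightarrow> y 0 = x\<^sub>0 \<Longrightarrow> ode_solution f D {0..T} x \<Longrightarrow>
      ode_solution f D {0..T} y \<Longrightarrow> t \<in> {0..T} \<Longrightarrow> x t = y t"
  shows "\<exists>x. x 0 = x\<^sub>0 \<and> ode_solution f D {0..} x"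
proof -
  obtain X where X: "\<And>T. T > 0 \<Longrightarrow> X T 0 = x\<^sub>0" "\<And>T. T > 0 \<Longrightarrow> ode_solution f D {0..T} (X T)"
    using ex by metis
  define x where "x t = X (t + 1) t" for t
  have eq: "x u = X T u" if "0 \<le> u" "u + 1 \<le> T" for u T
    unfolding x_def
    by (rule uniq[of _ _ "u + 1"]) (use that X ode_solution_mono[OF X(2)[of T], of "{0..u+1}"] in auto)
  have "x t \<in> D \<and> (x has_vector_derivative f (x t)) (at t within {0..})" if "t \<ge> 0" for t
  proof -
    have sol: "X (t + 2) t \<in> D" "(X (t + 2) has_vector_derivative f (X (t + 2) t)) (at t within {0..t + 2})"
      using X(2)[of "t + 2"] that by (auto simp: ode_solution_def)
    have xt: "x t = X (t + 2) t" using eq that by simp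
    have "(X (t + 2) has_vector_derivative f (x t)) (at t within {0..t + 1})"
      using sol(2) unfolding xt by (rule has_vector_derivative_within_subset) auto
    then have "(x has_vector_derivative f (x t)) (at t within {0..t + 1})"
      by (rule has_vector_derivative_transform[rotated 2]) (use eq that in auto)
    then show ?thesis using sol(1) xt at_within_Ici_eq_Icc(1)[of t "t + 1"] that by simp
  qed
  moreover have "x 0 = x\<^sub>0" using X(1)[of 1] by (simp add: x_def)
  ultimately show ?thesis unfolding ode_solution_def by auto
qed

section \<open>Trajectories in the plane of \<open>\<alpha>\<close> and \<open>\<sigma>/V\<close>\<close>

definition shape_drift :: "real \<Rightarrow> real \<Rightarrow> real" where
  "shape_drift a s = digamma_gap a - log_mean s"

text \<open>The velocities of \<open>\<beta>\<close>, of \<open>\<nu>\<close> and of \<open>s = \<sigma>/V\<close> are multiples of this quantity, with a negative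
factor for \<open>\<nu>\<close>.\<close>

definition scale_drift :: "real \<Rightarrow> real \<Rightarrow> real" where
  "scale_drift a s = a - (2 * a + 1) * shrinkage s"

lemma drift_sign_iff:
  assumes "a > 0" "s > 0"
  shows "shape_drift a s > 0 \<longleftrightarrow> balance a < s" "scale_drift a s > 0 \<longleftrightarrow> s < a - A a"
  using balance_less_iff[OF assms] less_root_iff[OF assms] by (auto simp: shape_drift_def scale_drift_def)

lemma drift_dichotomy:
  assumes "a > 0" "s > 0" shows "shape_drift a s > 0 \<or> scale_drift a s > 0"
  using drift_sign_iff[OF assms] balance_less_root[OF assms(1)] by linarith

text \<open>Everything is expressed through \<open>s\<close> by \<open>1/(1 + z\<^sup>2/(2s)) = 2s/(2s + z\<^sup>2)\<close> and
\<open>z\<^sup>2/(2s + z\<^sup>2) = 1 - 2s/(2s + z\<^sup>2)\<close>.\<close>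

lemma E_dK_eq:
  assumes "V > 0" "\<beta> > 0" "\<nu> > 0"
  defines "s \<equiv> sig \<beta> \<nu> / V"
  shows "- E_dK_dalpha V \<alpha> \<beta> \<nu> = shape_drift \<alpha> s"
    "- E_dK_dbeta V \<alpha> \<beta> \<nu> = scale_drift \<alpha> s / \<beta>"
    "- E_dK_dnu V \<alpha> \<beta> \<nu> = - scale_drift \<alpha> s / (\<nu> * (\<nu> + 1))"
proof -
  have sig: "sig \<beta> \<nu> > 0" using assms by (simp add: sig_def)
  have s: "s > 0" using sig assms(1) by (simp add: s_def)
  have arg: "V / sig \<beta> \<nu> * (z\<^sup>2 / 2) = z\<^sup>2 / (2 * s)" for z
    using sig assms(1) by (simp add: s_def ac_simps)
  show "- E_dK_dalpha V \<alpha> \<beta> \<nu> = shape_drift \<alpha> s"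
    unfolding E_dK_dalpha_def arg shape_drift_def log_mean_def digamma_gap_def
    by (subst integral_gauss_eq) simp_all
  have "(1 / sqrt (2 * pi)) * (LBINT z. 1 / (1 + z\<^sup>2 / (2 * s)) * exp (- z\<^sup>2 / 2))
      = (LINT z|gauss. 1 / (1 + z\<^sup>2 / (2 * s)))"
    by (subst integral_gauss_eq) simp_all
  also have "\<dots> = (LINT z|gauss. 2 * s * (1 / (2 * s + z\<^sup>2)))"
    using s sq_denominator[OF s] by (intro Bochner_Integration.integral_cong) (auto simp: divide_simps)
  also have "\<dots> = 2 * shrinkage s"
    by (simp only: integral_mult_right_zero shrinkage_def F_eq mult.assoc)
  finally have *: "(1 / sqrt (2 * pi)) * (LBINT z. 1 / (1 + z\<^sup>2 / (2 * s)) * exp (- z\<^sup>2 / 2)) = 2 * shrinkage s" .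
  have "E_dK_dbeta V \<alpha> \<beta> \<nu> = 1 / \<beta> * ((\<alpha> + 1 / 2) *
      ((1 / sqrt (2 * pi)) * (LBINT z. 1 / (1 + z\<^sup>2 / (2 * s)) * exp (- z\<^sup>2 / 2))) - \<alpha>)"
    unfolding E_dK_dbeta_def arg by simp
  then show "- E_dK_dbeta V \<alpha> \<beta> \<nu> = scale_drift \<alpha> s / \<beta>"
    unfolding * scale_drift_def using assms(2) by (simp add: field_simps)
  have "(1 / sqrt (2 * pi)) * (LBINT z. z\<^sup>2 / (2 * s + z\<^sup>2) * exp (- z\<^sup>2 / 2)) = 1 - 2 * shrinkage s"
    using one_minus_shrinkage[OF s] by (subst (asm) integral_gauss_eq) simp_all
  moreover have "E_dK_dnu V \<alpha> \<beta> \<nu> = 1 / (2 * \<nu> * (\<nu> + 1)) * ((2 * \<alpha> + 1) *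
      ((1 / sqrt (2 * pi)) * (LBINT z. z\<^sup>2 / (2 * s + z\<^sup>2) * exp (- z\<^sup>2 / 2))) - 1)"
    unfolding E_dK_dnu_def s_def by simp
  ultimately have "E_dK_dnu V \<alpha> \<beta> \<nu> = 1 / (2 * \<nu> * (\<nu> + 1)) * ((2 * \<alpha> + 1) * (1 - 2 * shrinkage s) - 1)"
    by (simp only:)
  also have "(2 * \<alpha> + 1) * (1 - 2 * shrinkage s) - 1 = 2 * scale_drift \<alpha> s"
    by (simp add: scale_drift_def algebra_simps)
  also have "1 / (2 * \<nu> * (\<nu> + 1)) * (2 * scale_drift \<alpha> s) = scale_drift \<alpha> s / (\<nu> * (\<nu> + 1))"
    by (simp add: mult.assoc)
  finally show "- E_dK_dnu V \<alpha> \<beta> \<nu> = - scale_drift \<alpha> s / (\<nu> * (\<nu> + 1))" by simp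
qed

lemma DERIV_shape_drift:
  assumes "(a has_real_derivative a') (at t within S)" "(s has_real_derivative s') (at t within S)"
    and "a t > 0" "s t > 0"
  shows "((\<lambda>t. shape_drift (a t) (s t)) has_real_derivative
    - trigamma_gap (a t) * a' + (1 / s t - 2 * F (s t)) * s') (at t within S)"
  unfolding shape_drift_def
  using DERIV_diff[OF DERIV_chain2[OF DERIV_digamma_gap[OF assms(3)] assms(1)]
      DERIV_chain2[OF DERIV_log_mean[OF assms(4)] assms(2)]]
  by (simp add: algebra_simps)

lemma DERIV_scale_drift:
  assumes "(a has_real_derivative a') (at t within S)" "(s has_real_derivative s') (at t within S)"
    and "s t > 0"
  shows "((\<lambda>t. scale_drift (a t) (s t)) has_real_derivative
    (1 - 2 * shrinkage (s t)) * a'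
      - (2 * a t + 1) * (shrinkage (s t) + shrinkage (s t) / (2 * s t) - 1 / 2) * s') (at t within S)"
  unfolding scale_drift_def
  by (rule derivative_eq_intros DERIV_chain2[OF DERIV_shrinkage[OF assms(3)] assms(2)] assms(1) refl)+
    (simp add: algebra_simps)

text \<open>The time set is arbitrary because solutions on \<open>{0..}\<close>, on \<open>{0..<T}\<close> and on \<open>{0..t}\<close> all occur.\<close>

locale trajectory =
  fixes V :: real and \<alpha> \<beta> \<nu> :: "real \<Rightarrow> real" and J :: "real set"
  assumes V: "V > 0" and sol: "solves_system V J \<alpha> \<beta> \<nu>"
begin

definition s :: "real \<Rightarrow> real" where "s t = sig (\<beta> t) (\<nu> t) / V"

definition ratio_rate :: "real \<Rightarrow> real" where
  "ratio_rate t = s t * (1 / (\<beta> t)\<^sup>2 + 1 / (\<nu> t * (\<nu> t + 1))\<^sup>2)"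

lemma pos:
  assumes "t \<in> J" shows "\<alpha> t > 0" "\<beta> t > 0" "\<nu> t > 0" "s t > 0" "ratio_rate t > 0"
proof -
  show *: "\<alpha> t > 0" "\<beta> t > 0" "\<nu> t > 0" using sol assms by (auto simp: solves_system_def)
  show "s t > 0" using * V by (simp add: s_def sig_def)
  then show "ratio_rate t > 0" using * by (auto simp: ratio_rate_def intro!: mult_pos_pos add_pos_pos)
qed

lemma deriv:
  assumes "t \<in> J" "I \<subseteq> J"
  shows "(\<alpha> has_real_derivative shape_drift (\<alpha> t) (s t)) (at t within I)"
    and "(\<beta> has_real_derivative scale_drift (\<alpha> t) (s t) / \<beta> t) (at t within I)"
    and "(\<nu> has_real_derivative - scale_drift (\<alpha> t) (s t) / (\<nu> t * (\<nu> t + 1))) (at t within I)"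
    and "(s has_real_derivative ratio_rate t * scale_drift (\<alpha> t) (s t)) (at t within I)"
proof -
  show a: "(\<alpha> has_real_derivative shape_drift (\<alpha> t) (s t)) (at t within I)"
    and b: "(\<beta> has_real_derivative scale_drift (\<alpha> t) (s t) / \<beta> t) (at t within I)"
    and n: "(\<nu> has_real_derivative - scale_drift (\<alpha> t) (s t) / (\<nu> t * (\<nu> t + 1))) (at t within I)"
  proof -
    have "(\<alpha> has_real_derivative - E_dK_dalpha V (\<alpha> t) (\<beta> t) (\<nu> t)) (at t within I)"
      "(\<beta> has_real_derivative - E_dK_dbeta V (\<alpha> t) (\<beta> t) (\<nu> t)) (at t within I)"
      "(\<nu> has_real_derivative - E_dK_dnu V (\<alpha> t) (\<beta> t) (\<nu> t)) (at t within I)"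
      using sol assms(1) by (blast intro: DERIV_subset[OF _ assms(2)] dest: sol[unfolded solves_system_def, rule_format])+
    then show "(\<alpha> has_real_derivative shape_drift (\<alpha> t) (s t)) (at t within I)"
      "(\<beta> has_real_derivative scale_drift (\<alpha> t) (s t) / \<beta> t) (at t within I)"
      "(\<nu> has_real_derivative - scale_drift (\<alpha> t) (s t) / (\<nu> t * (\<nu> t + 1))) (at t within I)"
      unfolding E_dK_eq[OF V pos(2,3)[OF assms(1)]] s_def .
  qed
  have s: "s = (\<lambda>t. \<beta> t * (\<nu> t + 1) / \<nu> t / V)" by (simp add: s_def[abs_def] sig_def)
  define q where "q = scale_drift (\<alpha> t) (s t)"
  have "((\<lambda>t. \<beta> t * (\<nu> t + 1) / \<nu> t / V) has_real_derivative
      (((q / \<beta> t) * (\<nu> t + 1) + (- q / (\<nu> t * (\<nu> t + 1)) + 0) * \<beta> t) * \<nu> t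
        - \<beta> t * (\<nu> t + 1) * (- q / (\<nu> t * (\<nu> t + 1)))) / (\<nu> t * \<nu> t) / V) (at t within I)"
    using pos[OF assms(1)] unfolding q_def
    by (intro DERIV_cdivide DERIV_divide DERIV_mult DERIV_add a b n DERIV_const) auto
  also have "(((q / \<beta> t) * (\<nu> t + 1) + (- q / (\<nu> t * (\<nu> t + 1)) + 0) * \<beta> t) * \<nu> t
        - \<beta> t * (\<nu> t + 1) * (- q / (\<nu> t * (\<nu> t + 1)))) / (\<nu> t * \<nu> t) / V = ratio_rate t * q"
  proof -
    have alg: "((q / b) * m + (- q / (n * m) + 0) * b) * n - b * m * (- q / (n * m))
      = (b * m * n) * (1 / b\<^sup>2 + 1 / (n * m)\<^sup>2) * q" if "b > 0" "n > 0" "m = n + 1" for b n m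
    proof -
      have m: "m > 0" "1 / n - 1 / m = 1 / (n * m)" using that by (auto simp: field_simps)
      have "((q / b) * m + (- q / (n * m) + 0) * b) * n - b * m * (- q / (n * m))
          = q * (m * n / b) + q * b * (1 / n - 1 / m)"
        using that(1,2) m(1) by (simp add: divide_simps) (simp add: algebra_simps)
      also have "\<dots> = (b * m * n) * (1 / b\<^sup>2 + 1 / (n * m)\<^sup>2) * q"
        unfolding m(2) using that(1,2) m(1) by (simp add: power2_eq_square divide_simps) (simp add: algebra_simps)
      finally show ?thesis .
    qed
    show ?thesis unfolding alg[OF pos(2,3)[OF assms(1)] refl] ratio_rate_def s_def sig_def
      using pos[OF assms(1)] by simp
  qed
  finally show "(s has_real_derivative ratio_rate t * scale_drift (\<alpha> t) (s t)) (at t within I)"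
    unfolding q_def s .
qed

definition energy :: "real \<Rightarrow> real" where
  "energy t = (\<beta> t)\<^sup>2 + (\<nu> t)\<^sup>2 + 2 * (\<nu> t) ^ 3 / 3"

lemma energy_const:
  assumes "convex J" "t \<in> J" "u \<in> J"
  shows "energy t = energy u"
proof -
  have "(energy has_real_derivative 0) (at x within J)" if "x \<in> J" for x
  proof -
    have "(energy has_real_derivative 2 * \<beta> x * (scale_drift (\<alpha> x) (s x) / \<beta> x) +
        2 * (\<nu> x * (\<nu> x + 1)) * (- scale_drift (\<alpha> x) (s x) / (\<nu> x * (\<nu> x + 1)))) (at x within J)"
    proof -
      have "((\<lambda>t. (\<beta> t)\<^sup>2 + (\<nu> t)\<^sup>2 + 2 * (\<nu> t) ^ 3 / 3) has_real_derivative
          2 * \<beta> x * d + 2 * (\<nu> x * (\<nu> x + 1)) * e) (at x within J)"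
        if "(\<beta> has_real_derivative d) (at x within J)" "(\<nu> has_real_derivative e) (at x within J)" for d e
        by (auto intro!: derivative_eq_intros that simp: algebra_simps power2_eq_square)
      then show ?thesis unfolding energy_def[abs_def] using deriv[OF that order_refl] by blast
    qed
    also have "2 * \<beta> x * (scale_drift (\<alpha> x) (s x) / \<beta> x) +
        2 * (\<nu> x * (\<nu> x + 1)) * (- scale_drift (\<alpha> x) (s x) / (\<nu> x * (\<nu> x + 1))) = 0"
      using pos[OF that] by simp
    finally show ?thesis .
  qed
  from has_field_derivative_zero_constant[OF assms(1) this] show ?thesis using assms(2,3) by metis
qed

lemma ratio_rate_lower:
  assumes "t \<in> J" shows "s t / energy t \<le> ratio_rate t"
proof -
  have "(\<beta> t)\<^sup>2 \<le> energy t" using pos[OF assms] by (simp add: energy_def)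
  then have "1 / energy t \<le> 1 / (\<beta> t)\<^sup>2"
    using pos[OF assms] by (intro divide_left_mono) (auto simp: energy_def intro!: mult_pos_pos add_pos_pos)
  then have "s t * (1 / energy t) \<le> s t * (1 / (\<beta> t)\<^sup>2 + 1 / (\<nu> t * (\<nu> t + 1))\<^sup>2)"
    using pos[OF assms] by (intro mult_left_mono) (auto intro: add_increasing2)
  then show ?thesis by (simp add: ratio_rate_def)
qed

text \<open>On the edge \<open>p = 0, q \<ge> 0\<close> of the quadrant of the two drifts \<open>p, q\<close> the dichotomy gives \<open>q > 0\<close>; there
\<open>\<alpha>\<close> is stationary while \<open>s\<close> grows, so \<open>p\<close> grows. The other edge is similar.\<close>

lemma drift_invariant:
  assumes "{a..b} \<subseteq> J" "t \<in> {a..b}"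
    and "shape_drift (\<alpha> a) (s a) > 0" "scale_drift (\<alpha> a) (s a) > 0"
  shows "shape_drift (\<alpha> t) (s t) > 0 \<and> scale_drift (\<alpha> t) (s t) > 0"
proof (rule quadrant_invariant[where a = a and b = b
      and u = "\<lambda>t. shape_drift (\<alpha> t) (s t)" and v = "\<lambda>t. scale_drift (\<alpha> t) (s t)"])
  fix t assume "t \<in> {a..b}"
  then have t: "t \<in> J" using assms(1) by auto
  note p = pos[OF t]
  let ?u' = "- trigamma_gap (\<alpha> t) * shape_drift (\<alpha> t) (s t)
      + (1 / s t - 2 * F (s t)) * (ratio_rate t * scale_drift (\<alpha> t) (s t))"
  let ?v' = "(1 - 2 * shrinkage (s t)) * shape_drift (\<alpha> t) (s t)
      - (2 * \<alpha> t + 1) * (shrinkage (s t) + shrinkage (s t) / (2 * s t) - 1 / 2)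
        * (ratio_rate t * scale_drift (\<alpha> t) (s t))"
  show "((\<lambda>t. shape_drift (\<alpha> t) (s t)) has_real_derivative ?u') (at t within {a..b})"
    by (intro DERIV_shape_drift deriv t assms(1) p)
  show "((\<lambda>t. scale_drift (\<alpha> t) (s t)) has_real_derivative ?v') (at t within {a..b})"
    by (intro DERIV_scale_drift deriv t assms(1) p)
  show "0 < ?u'"
    if "shape_drift (\<alpha> t) (s t) = 0" "scale_drift (\<alpha> t) (s t) \<ge> 0"
  proof -
    have "scale_drift (\<alpha> t) (s t) > 0" using drift_dichotomy[OF p(1,4)] that by auto
    moreover have "1 / s t - 2 * F (s t) > 0" using log_mean_deriv_neg[OF p(4)] by simp
    ultimately show ?thesis using that p(5) by simp
  qed
  show "0 < ?v'"
    if "scale_drift (\<alpha> t) (s t) = 0" "shape_drift (\<alpha> t) (s t) \<ge> 0"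
  proof -
    have "shape_drift (\<alpha> t) (s t) > 0" using drift_dichotomy[OF p(1,4)] that by auto
    then show ?thesis using that shrinkage_range(2)[OF p(4)] by simp
  qed
qed (use assms in auto)

text \<open>On the left edge \<open>\<alpha> = a\<close> every admissible \<open>s\<close> is above \<open>balance a\<close>, so \<open>\<alpha>\<close> grows; on the lower edge
\<open>s = b\<close> is below \<open>\<alpha> - A \<alpha>\<close>, so \<open>s\<close> grows.\<close>

lemma trapped:
  assumes "{0..T} \<subseteq> J" "t \<in> {0..T}" "a > 0" "balance a < b" "b < a - A a" "a < \<alpha> 0" "b < s 0"
  shows "a < \<alpha> t \<and> b < s t"
proof -
  have b: "b > 0" using balance_root(1)[OF assms(3)] assms(4) by simp
  have "0 < \<alpha> t - a \<and> 0 < s t - b"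
  proof (rule quadrant_invariant[where a = 0 and b = T and u = "\<lambda>t. \<alpha> t - a" and v = "\<lambda>t. s t - b"])
    fix t assume "t \<in> {0..T}"
    then have t: "t \<in> J" using assms(1) by auto
    note p = pos[OF t]
    show "((\<lambda>t. \<alpha> t - a) has_real_derivative shape_drift (\<alpha> t) (s t)) (at t within {0..T})"
      "((\<lambda>t. s t - b) has_real_derivative ratio_rate t * scale_drift (\<alpha> t) (s t)) (at t within {0..T})"
      by (auto intro!: derivative_eq_intros deriv t assms(1))
    show "0 < shape_drift (\<alpha> t) (s t)" if "\<alpha> t - a = 0" "0 \<le> s t - b"
      using that drift_sign_iff(1)[OF p(1,4)] assms(4) by simp
    show "0 < ratio_rate t * scale_drift (\<alpha> t) (s t)" if "s t - b = 0" "0 \<le> \<alpha> t - a"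
    proof -
      have "a - A a \<le> \<alpha> t - A (\<alpha> t)"
        using strict_mono_root[OF assms(3), of "\<alpha> t"] that by (cases "\<alpha> t = a") auto
      then show ?thesis using that drift_sign_iff(2)[OF p(1,4)] assms(5) p by simp
    qed
  qed (use assms in auto)
  then show ?thesis by simp
qed

end

section \<open>A priori bounds and well-posedness\<close>

context trajectory begin

text \<open>The velocity \<open>digamma_gap \<alpha> - log_mean s\<close> is at most \<open>digamma_gap a\<close> as long as \<open>\<alpha> \<ge> a\<close>.\<close>

lemma shape_upper:
  assumes J: "{0..T} \<subseteq> J" and t: "t \<in> {0..T}"
    and a: "a > 0" "\<And>t. t \<in> {0..T} \<Longrightarrow> a \<le> \<alpha> t"
  shows "\<alpha> t \<le> \<alpha> 0 + digamma_gap a * t"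
proof -
  have "\<alpha> t - digamma_gap a * t \<le> \<alpha> 0 - digamma_gap a * 0"
  proof (rule nonincreasing_if_derivative_within_nonpos[where w = "\<lambda>t. \<alpha> t - digamma_gap a * t"])
    fix u assume "u \<in> {0..t}"
    then have u: "u \<in> {0..T}" "u \<in> J" "{0..t} \<subseteq> J" using J t by auto
    show "((\<lambda>t. \<alpha> t - digamma_gap a * t) has_real_derivative shape_drift (\<alpha> u) (s u) - digamma_gap a) (at u within {0..t})"
      by (auto intro!: derivative_eq_intros deriv u)
    have "digamma_gap (\<alpha> u) \<le> digamma_gap a"
      using strict_antimono_digamma_gap[OF a(1), of "\<alpha> u"] a(2)[OF u(1)] by (cases "a = \<alpha> u") auto
    then show "shape_drift (\<alpha> u) (s u) - digamma_gap a \<le> 0"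
      using log_mean_bounds(1)[OF pos(4)[OF u(2)]] by (simp add: shape_drift_def)
  qed (use t in auto)
  then show ?thesis by simp
qed

text \<open>At a level \<open>M\<close> above the curve \<open>\<alpha> - A \<alpha>\<close> for all \<open>\<alpha>\<close> that are reached, \<open>s\<close> decreases.\<close>

lemma ratio_upper:
  assumes J: "{0..T} \<subseteq> J" and t: "t \<in> {0..T}"
    and \<alpha>: "\<And>t. t \<in> {0..T} \<Longrightarrow> \<alpha> t \<le> h" and M: "s 0 < M" "h - A h < M"
  shows "s t < M"
proof -
  have "0 < M - s t \<and> 0 < (1 :: real)"
  proof (rule quadrant_invariant[where a = 0 and b = T and u = "\<lambda>t. M - s t" and v = "\<lambda>_. 1" and v' = "\<lambda>_. 0"])
    fix t assume t': "t \<in> {0..T}"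
    then have t: "t \<in> J" using J by auto
    note p = pos[OF t]
    show "((\<lambda>t. M - s t) has_real_derivative - (ratio_rate t * scale_drift (\<alpha> t) (s t))) (at t within {0..T})"
      by (auto intro!: derivative_eq_intros deriv t J)
    show "0 < - (ratio_rate t * scale_drift (\<alpha> t) (s t))" if "M - s t = 0"
    proof -
      have "\<alpha> t - A (\<alpha> t) \<le> h - A h"
        using strict_mono_root[OF p(1), of h] \<alpha>[OF t'] by (cases "\<alpha> t = h") auto
      then have "\<not> scale_drift (\<alpha> t) (s t + 0) \<ge> 0"
        using less_root_iff[OF p(1), of "s t"] p(4) M that
          strict_mono_shrinkage[of "\<alpha> t - A (\<alpha> t)" "s t"] A_root[OF p(1)] p(1)
        by (auto simp: scale_drift_def field_simps)
      then show ?thesis using p(5) by (simp add: mult_pos_neg)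
    qed
  qed (use M t in auto)
  then show ?thesis by simp
qed

text \<open>Bounds for \<open>s\<close> make \<open>\<beta>\<close> and \<open>\<nu>\<close> comparable, and the fixed energy prevents both from being small:
\<open>\<beta> \<le> V M \<nu>\<close> bounds the energy by a multiple of \<open>\<nu>\<^sup>2\<close>.\<close>

lemma coordinate_bounds:
  assumes t: "t \<in> J" and b: "b > 0" "b < s t" and M: "s t < M" and C: "energy t = C"
  defines "\<nu>\<^sub>1 \<equiv> sqrt (C / ((V * M)\<^sup>2 + 1 + 2 * (C + 1) / 3))"
  shows "\<nu>\<^sub>1 \<le> \<nu> t" "\<nu> t \<le> C + 1" "V * b * \<nu>\<^sub>1 / (C + 2) \<le> \<beta> t" "\<beta> t \<le> C + 1" "C > 0" "\<nu>\<^sub>1 > 0"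
proof -
  note p = pos[OF t]
  have E: "C = (\<beta> t)\<^sup>2 + (\<nu> t)\<^sup>2 + 2 * (\<nu> t) ^ 3 / 3" using C by (simp add: energy_def)
  show C0: "C > 0" unfolding E using p by (intro add_pos_pos) auto
  have "(\<beta> t)\<^sup>2 \<le> C" "(\<nu> t)\<^sup>2 \<le> C" unfolding E using p by auto
  moreover have "C \<le> (C + 1)\<^sup>2" using C0 by (simp add: power2_eq_square algebra_simps)
  ultimately show bnd: "\<beta> t \<le> C + 1" "\<nu> t \<le> C + 1"
    using C0 by (auto intro: power2_le_imp_le order_trans)
  have st: "s t = \<beta> t * (\<nu> t + 1) / \<nu> t / V" by (simp add: s_def sig_def)
  define k where "k = (V * M)\<^sup>2 + 1 + 2 * (C + 1) / 3"
  have k: "k > 0" using C0 unfolding k_def by (intro add_pos_pos add_nonneg_pos) auto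
  have "\<beta> t * (\<nu> t + 1) \<le> V * M * \<nu> t"
    using M p V unfolding st by (simp add: field_simps)
  moreover have "\<beta> t \<le> \<beta> t * (\<nu> t + 1)" using p by (simp add: algebra_simps)
  ultimately have "\<beta> t \<le> V * M * \<nu> t" by linarith
  then have "(\<beta> t)\<^sup>2 \<le> (V * M * \<nu> t)\<^sup>2" using p by (intro power_mono) auto
  moreover have "2 * (\<nu> t) ^ 3 / 3 \<le> 2 * (C + 1) / 3 * (\<nu> t)\<^sup>2"
    using mult_right_mono[OF bnd(2), of "(\<nu> t)\<^sup>2"] by (simp add: power3_eq_cube power2_eq_square algebra_simps)
  ultimately have "C \<le> (V * M)\<^sup>2 * (\<nu> t)\<^sup>2 + (\<nu> t)\<^sup>2 + 2 * (C + 1) / 3 * (\<nu> t)\<^sup>2"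
    using E unfolding power_mult_distrib[of "V * M"] by linarith
  then have "C \<le> k * (\<nu> t)\<^sup>2" unfolding k_def distrib_right mult_1 .
  then have "C / k \<le> (\<nu> t)\<^sup>2" using k by (simp add: divide_le_eq mult.commute)
  then show \<nu>1: "\<nu>\<^sub>1 \<le> \<nu> t"
    unfolding \<nu>\<^sub>1_def k_def[symmetric] using p by (intro real_le_lsqrt) (auto simp: real_sqrt_le_iff)
  show \<nu>1_pos: "\<nu>\<^sub>1 > 0" unfolding \<nu>\<^sub>1_def k_def[symmetric] using C0 k by simp
  have "V * b * \<nu> t \<le> \<beta> t * (\<nu> t + 1)"
    using b p V unfolding st by (simp add: field_simps)
  also have "\<dots> \<le> \<beta> t * (C + 2)" using bnd p by (intro mult_left_mono) auto
  finally have "V * b * \<nu> t \<le> \<beta> t * (C + 2)" .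
  moreover have "V * b * \<nu>\<^sub>1 \<le> V * b * \<nu> t" using \<nu>1 V b by (intro mult_left_mono) auto
  ultimately have "V * b * \<nu>\<^sub>1 \<le> \<beta> t * (C + 2)" by linarith
  then show "V * b * \<nu>\<^sub>1 / (C + 2) \<le> \<beta> t" using C0 by (simp add: divide_le_eq)
qed

end

text \<open>The curve \<open>balance\<close> starts at the origin, so the corner \<open>(a, b)\<close> of an invariant quadrant can be put to
the lower left of any given point.\<close>

lemma exists_trap:
  assumes "\<alpha>0 > 0" "s\<^sub>0 > 0"
  shows "\<exists>a b. 0 < a \<and> balance a < b \<and> b < a - A a \<and> a < \<alpha>0 \<and> b < s\<^sub>0"
proof -
  have "\<forall>\<^sub>F a in at_right 0. balance a < s\<^sub>0 \<and> a \<in> {0<..<\<alpha>0}"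
    using order_tendstoD(2)[OF balance_at_right_0 assms(2)] eventually_at_right_real[OF assms(1)]
    by (rule eventually_conj)
  then obtain a where a: "balance a < s\<^sub>0" "0 < a" "a < \<alpha>0"
    by (auto dest!: eventually_happens)
  then have "balance a < min s\<^sub>0 (a - A a)" using balance_less_root[OF a(2)] by simp
  then obtain b where "balance a < b" "b < min s\<^sub>0 (a - A a)" using dense by blast
  then show ?thesis using a by auto
qed

lemma solves_ivp_mono:
  assumes "solves_ivp V J \<alpha>0 \<beta>0 \<nu>0 \<alpha> \<beta> \<nu>" "I \<subseteq> J"
  shows "solves_ivp V I \<alpha>0 \<beta>0 \<nu>0 \<alpha> \<beta> \<nu>"
  using assms unfolding solves_ivp_def solves_system_def by (blast intro: DERIV_subset)

text \<open>The invariant quadrant bounds \<open>\<alpha>\<close> and \<open>s\<close> from below; then \<open>\<alpha>\<close> grows at most linearly, so \<open>s\<close> stays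
below a level \<open>M\<close>, and the energy turns bounds for \<open>s\<close> into bounds for \<open>\<beta>\<close> and \<open>\<nu>\<close>.\<close>

lemma apriori_bounds:
  assumes "V > 0" "\<alpha>0 > 0" "\<beta>0 > 0" "\<nu>0 > 0" "T \<ge> 0"
  obtains l h where "l > 0"
    "\<And>t \<alpha> \<beta> \<nu>. t \<in> {0..T} \<Longrightarrow> solves_ivp V {0..t} \<alpha>0 \<beta>0 \<nu>0 \<alpha> \<beta> \<nu> \<Longrightarrow>
      \<alpha> t \<in> {l..h} \<and> \<beta> t \<in> {l..h} \<and> \<nu> t \<in> {l..h}"
proof -
  define s\<^sub>0 where "s\<^sub>0 = sig \<beta>0 \<nu>0 / V"
  have s0: "s\<^sub>0 > 0" using assms by (simp add: s\<^sub>0_def sig_def)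
  obtain a b where trap: "0 < a" "balance a < b" "b < a - A a" "a < \<alpha>0" "b < s\<^sub>0"
    using exists_trap[OF assms(2) s0] by blast
  have b0: "b > 0" using balance_root(1)[OF trap(1)] trap by simp
  define C where "C = \<beta>0\<^sup>2 + \<nu>0\<^sup>2 + 2 * \<nu>0 ^ 3 / 3"
  define h\<^sub>\<alpha> where "h\<^sub>\<alpha> = \<alpha>0 + digamma_gap a * T"
  define M where "M = max s\<^sub>0 (h\<^sub>\<alpha> - A h\<^sub>\<alpha>) + 1"
  define \<nu>\<^sub>1 where "\<nu>\<^sub>1 = sqrt (C / ((V * M)\<^sup>2 + 1 + 2 * (C + 1) / 3))"
  define l where "l = min a (min \<nu>\<^sub>1 (V * b * \<nu>\<^sub>1 / (C + 2)))"
  define h where "h = max h\<^sub>\<alpha> (C + 1)"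
  have C0: "C > 0" unfolding C_def using assms by (intro add_pos_pos) auto
  have "\<nu>\<^sub>1 > 0" unfolding \<nu>\<^sub>1_def using C0
    by (intro real_sqrt_gt_zero divide_pos_pos add_pos_pos add_nonneg_pos) auto
  then have "l > 0" using trap(1) C0 b0 assms(1) by (simp add: l_def)
  moreover have "\<alpha> t \<in> {l..h} \<and> \<beta> t \<in> {l..h} \<and> \<nu> t \<in> {l..h}"
    if t: "t \<in> {0..T}" and ivp: "solves_ivp V {0..t} \<alpha>0 \<beta>0 \<nu>0 \<alpha> \<beta> \<nu>" for t \<alpha> \<beta> \<nu>
  proof -
    interpret trajectory V \<alpha> \<beta> \<nu> "{0..t}"
      by standard (use ivp assms in \<open>auto simp: solves_ivp_def\<close>)
    have init: "\<alpha> 0 = \<alpha>0" "\<beta> 0 = \<beta>0" "\<nu> 0 = \<nu>0" "s 0 = s\<^sub>0"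
      using ivp by (simp_all add: solves_ivp_def s_def s\<^sub>0_def)
    have tt: "t \<in> {0..t}" "0 \<in> {0..t}" using t by auto
    have low: "a < \<alpha> u \<and> b < s u" if "u \<in> {0..t}" for u
      by (rule trapped[OF order_refl that trap(1-3)]) (use trap init in auto)
    have up: "\<alpha> u \<le> h\<^sub>\<alpha>" if "u \<in> {0..t}" for u
    proof -
      have "\<alpha> u \<le> \<alpha> 0 + digamma_gap a * u"
        by (rule shape_upper[OF order_refl that trap(1)]) (use low in \<open>auto intro: less_imp_le\<close>)
      also have "\<dots> \<le> h\<^sub>\<alpha>"
        using that t digamma_gap_bounds(1)[OF trap(1)] by (simp add: h\<^sub>\<alpha>_def init)
      finally show ?thesis .
    qed
    have sM: "s t < M"
      by (rule ratio_upper[OF order_refl tt(1) up]) (auto simp: M_def init)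
    have "energy t = C"
      using energy_const[OF _ tt] by (simp add: energy_def C_def init)
    note cb = coordinate_bounds[OF tt(1) b0 _ sM this]
    show ?thesis
      using cb low[OF tt(1)] up[OF tt(1)] unfolding l_def h_def \<nu>\<^sub>1_def by auto
  qed
  ultimately show ?thesis by (rule that)
qed

definition kl_field :: "real \<Rightarrow> real \<times> real \<times> real \<Rightarrow> real \<times> real \<times> real" where
  "kl_field V = (\<lambda>(\<alpha>, \<beta>, \<nu>). (- E_dK_dalpha V \<alpha> \<beta> \<nu>, - E_dK_dbeta V \<alpha> \<beta> \<nu>, - E_dK_dnu V \<alpha> \<beta> \<nu>))"

definition phase_space :: "(real \<times> real \<times> real) set" where
  "phase_space = {0<..} \<times> {0<..} \<times> {0<..}"

lemma has_vector_derivative_triple: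
  fixes a b c :: "real \<Rightarrow> real"
  shows "((\<lambda>t. (a t, b t, c t)) has_vector_derivative (a', b', c')) (at t within S) \<longleftrightarrow>
    (a has_real_derivative a') (at t within S) \<and> (b has_real_derivative b') (at t within S) \<and> (c has_real_derivative c') (at t within S)"
  (is "?L \<longleftrightarrow> ?R")
proof
  assume L: ?L
  show ?R
    using bounded_linear.has_vector_derivative[OF bounded_linear_fst L]
      bounded_linear.has_vector_derivative[OF bounded_linear_fst
        bounded_linear.has_vector_derivative[OF bounded_linear_snd L]]
      bounded_linear.has_vector_derivative[OF bounded_linear_snd
        bounded_linear.has_vector_derivative[OF bounded_linear_snd L]]
    by (simp add: has_real_derivative_iff_has_vector_derivative)
next
  assume ?R
  then show ?L
    by (auto simp: has_real_derivative_iff_has_vector_derivative intro!: has_vector_derivative_Pair)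
qed

lemma solves_system_iff:
  "solves_system V J \<alpha> \<beta> \<nu> \<longleftrightarrow> ode_solution (kl_field V) phase_space J (\<lambda>t. (\<alpha> t, \<beta> t, \<nu> t))"
  by (auto simp: solves_system_def ode_solution_def kl_field_def phase_space_def has_vector_derivative_triple)

abbreviation lipschitz :: "'a::metric_space set \<Rightarrow> ('a \<Rightarrow> 'b::metric_space) \<Rightarrow> bool" where
  "lipschitz U f \<equiv> \<exists>L. L-lipschitz_on U f"

lemma lipschitz_add: "lipschitz U f \<Longrightarrow> lipschitz U g \<Longrightarrow> lipschitz U (\<lambda>x. f x + g x)"
  for f g :: "'a::metric_space \<Rightarrow> 'b::real_normed_vector"
  using lipschitz_on_add by blast

lemma lipschitz_minus: "lipschitz U f \<Longrightarrow> lipschitz U (\<lambda>x. - f x)"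
  for f :: "'a::metric_space \<Rightarrow> 'b::real_normed_vector"
  by simp

lemma lipschitz_Pair: "lipschitz U f \<Longrightarrow> lipschitz U g \<Longrightarrow> lipschitz U (\<lambda>x. (f x, g x))"
  using lipschitz_on_Pair by blast

lemma lipschitz_const: "lipschitz U (\<lambda>_. c)"
  using lipschitz_on_constant by blast

lemma lipschitz_mult:
  fixes f g :: "'a::metric_space \<Rightarrow> real"
  assumes "compact U" "lipschitz U f" "lipschitz U g"
  shows "lipschitz U (\<lambda>x. f x * g x)"
proof -
  obtain L M where L: "L-lipschitz_on U f" and M: "M-lipschitz_on U g" using assms by blast
  have "bounded (f ` U)" "bounded (g ` U)"
    using assms(1) L M by (auto intro!: compact_imp_bounded compact_continuous_image lipschitz_on_continuous_on)
  then obtain B D where B: "B > 0" "\<And>x. x \<in> U \<Longrightarrow> \<bar>f x\<bar> \<le> B" and D: "D > 0" "\<And>x. x \<in> U \<Longrightarrow> \<bar>g x\<bar> \<le> D"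
    unfolding bounded_pos by auto
  have "(B * M + D * L)-lipschitz_on U (\<lambda>x. f x * g x)"
  proof (rule lipschitz_onI)
    fix x y assume xy: "x \<in> U" "y \<in> U"
    have "f x * g x - f y * g y = f x * (g x - g y) + g y * (f x - f y)" by (simp add: algebra_simps)
    then have "\<bar>f x * g x - f y * g y\<bar> \<le> \<bar>f x\<bar> * \<bar>g x - g y\<bar> + \<bar>g y\<bar> * \<bar>f x - f y\<bar>"
      using abs_triangle_ineq[of "f x * (g x - g y)" "g y * (f x - f y)"] by (simp add: abs_mult)
    also have "\<dots> \<le> B * (M * dist x y) + D * (L * dist x y)"
      using lipschitz_onD[OF L xy] lipschitz_onD[OF M xy] B D xy
      by (intro add_mono mult_mono) (auto simp: dist_real_def)
    finally show "dist (f x * g x) (f y * g y) \<le> (B * M + D * L) * dist x y"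
      by (simp add: dist_real_def algebra_simps)
  qed (use B D lipschitz_on_nonneg[OF L] lipschitz_on_nonneg[OF M] in auto)
  then show ?thesis by blast
qed

lemma lipschitz_compose_C1:
  fixes f :: "'a::metric_space \<Rightarrow> real" and g g' :: "real \<Rightarrow> real"
  assumes "compact U" "lipschitz U f" "\<And>x. x \<in> U \<Longrightarrow> f x > 0"
    and g: "\<And>x. x > 0 \<Longrightarrow> (g has_real_derivative g' x) (at x)" and g': "continuous_on {0<..} g'"
  shows "lipschitz U (\<lambda>x. g (f x))"
proof (cases "U = {}")
  case True then show ?thesis by (auto intro: exI[of _ 0])
next
  case False
  obtain L where L: "L-lipschitz_on U f" using assms by blast
  have contf: "continuous_on U f" using L by (rule lipschitz_on_continuous_on)
  obtain m where m: "m \<in> U" "\<And>x. x \<in> U \<Longrightarrow> f m \<le> f x"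
    using continuous_attains_inf[OF assms(1) False contf] by blast
  obtain M where M: "M \<in> U" "\<And>x. x \<in> U \<Longrightarrow> f x \<le> f M"
    using continuous_attains_sup[OF assms(1) False contf] by blast
  have fm: "f m > 0" using assms(3) m by blast
  have "continuous_on {f m..f M} g'" using g' by (rule continuous_on_subset) (use fm in auto)
  then have "bounded (g' ` {f m..f M})" by (intro compact_imp_bounded compact_continuous_image) auto
  then obtain B where B: "B > 0" "\<And>x. x \<in> {f m..f M} \<Longrightarrow> \<bar>g' x\<bar> \<le> B" unfolding bounded_pos by auto
  have "B-lipschitz_on {f m..f M} g"
  proof (rule lipschitz_onI)
    fix x y assume xy: "x \<in> {f m..f M}" "y \<in> {f m..f M}"
    have "norm (g x - g y) \<le> B * norm (x - y)"
      by (rule field_differentiable_bound[of "{f m..f M}" g g'])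
        (use xy fm B in \<open>auto intro!: has_field_derivative_at_within[OF g]\<close>)
    then show "dist (g x) (g y) \<le> B * dist x y" by (simp add: dist_real_def)
  qed (use B in simp)
  then have "B-lipschitz_on (f ` U) g" by (rule lipschitz_on_subset) (use m M in auto)
  then show ?thesis using lipschitz_on_compose2[OF L] by blast
qed

lemma lipschitz_coordinates:
  "lipschitz U (\<lambda>u. fst u)" "lipschitz U (\<lambda>u. fst (snd u))" "lipschitz U (\<lambda>u. snd (snd u))"
  by (rule exI[of _ 1], rule lipschitz_onI,
      auto intro: dist_fst_le dist_snd_le order_trans[OF dist_fst_le dist_snd_le]
        order_trans[OF dist_snd_le dist_snd_le])+

text \<open>The field is built by sums and products from the coordinates and from continuously differentiable functions
of one positive variable; on a compact set all of these preserve the Lipschitz property.\<close>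

lemma lipschitz_kl_field:
  assumes V: "V > 0" and U: "compact U" "U \<subseteq> phase_space"
  shows "lipschitz U (kl_field V)"
proof -
  have pos: "fst u > 0" "fst (snd u) > 0" "snd (snd u) > 0" if "u \<in> U" for u
    using that U(2) by (auto simp: phase_space_def)
  note c = lipschitz_coordinates[of U]
  have inv: "lipschitz U (\<lambda>u. inverse (f u))" if "lipschitz U f" "\<And>u. u \<in> U \<Longrightarrow> f u > 0" for f :: "_ \<Rightarrow> real"
  proof (rule lipschitz_compose_C1[OF U(1) that])
    show "(inverse has_real_derivative - (inverse x ^ Suc (Suc 0))) (at x)" if "x > 0" for x :: real
      using DERIV_inverse[of x UNIV] that by simp
    show "continuous_on {0<..} (\<lambda>x :: real. - (inverse x ^ Suc (Suc 0)))"
      by (intro continuous_intros) auto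
  qed
  define s where "s u = fst (snd u) * (snd (snd u) + 1) * inverse (snd (snd u)) * inverse V" for u :: "real \<times> real \<times> real"
  have s_pos: "s u > 0" if "u \<in> U" for u using pos[OF that] V by (simp add: s_def)
  note intros = lipschitz_add lipschitz_minus lipschitz_mult[OF U(1)] lipschitz_const c inv pos
  have s: "lipschitz U s" unfolding s_def by (intro intros)
  have contF: "continuous_on {0<..} F"
    by (rule DERIV_continuous_on) (auto intro: has_field_derivative_at_within DERIV_F)
  have conts: "continuous_on {0<..} shrinkage" unfolding shrinkage_def by (intro continuous_intros contF)
  have G: "lipschitz U (\<lambda>u. log_mean (s u))"
    by (rule lipschitz_compose_C1[OF U(1) s s_pos DERIV_log_mean])
      (auto intro!: continuous_intros contF)
  have h: "lipschitz U (\<lambda>u. shrinkage (s u))"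
    by (rule lipschitz_compose_C1[OF U(1) s s_pos DERIV_shrinkage])
      (auto intro!: continuous_intros conts)
  have D: "lipschitz U (\<lambda>u. digamma_gap (fst u))"
  proof (rule lipschitz_compose_C1[OF U(1) c(1) pos(1) DERIV_digamma_gap])
    have "isCont (\<lambda>a. - trigamma_gap a) x" if "x > 0" for x
      unfolding trigamma_gap_def using that by (intro continuous_intros) (auto intro!: not_nonpos_Int)
    then show "continuous_on {0<..} (\<lambda>a. - trigamma_gap a)" by (auto intro: continuous_at_imp_continuous_on)
  qed
  define q where "q u = fst u + - ((2 * fst u + 1) * shrinkage (s u))" for u
  have q: "lipschitz U q" unfolding q_def by (intro intros h)
  define f where "f u = (digamma_gap (fst u) + - log_mean (s u), q u * inverse (fst (snd u)),
      - (q u * (inverse (snd (snd u)) * inverse (snd (snd u) + 1))))" for u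
  have "lipschitz U f" unfolding f_def
    by (intro lipschitz_Pair intros D G q) (use pos in \<open>auto intro: add_pos_pos\<close>)
  then obtain L where L: "L-lipschitz_on U f" by blast
  have "f u = kl_field V u" if "u \<in> U" for u
  proof -
    obtain a b n where u: "u = (a, b, n)" by (cases u)
    have p: "a > 0" "b > 0" "n > 0" using pos[OF that] u by auto
    have su: "s u = sig b n / V" by (simp add: s_def u sig_def divide_inverse)
    show ?thesis
      using E_dK_eq[OF V p(2,3), of a]
      by (simp add: f_def kl_field_def u su[unfolded u] q_def shape_drift_def scale_drift_def divide_inverse)
        (simp add: algebra_simps)
  qed
  then have "L-lipschitz_on U (kl_field V)" by (intro lipschitz_on_transform[OF L]) simp
  then show ?thesis by blast
qed

lemma cbox_cube: "cbox (l, l, l) (h, h, h) = {l..h} \<times> {l..h} \<times> {l..h}" for l h :: real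
  by (simp add: cbox_Pair_eq)

text \<open>By the a priori bounds both solutions run in one compact box, where the field has a Lipschitz constant.\<close>

lemma ivp_unique:
  assumes "V > 0" "\<alpha>0 > 0" "\<beta>0 > 0" "\<nu>0 > 0" "t \<in> {0..T}"
    and sol: "solves_ivp V {0..T} \<alpha>0 \<beta>0 \<nu>0 \<alpha> \<beta> \<nu>" "solves_ivp V {0..T} \<alpha>0 \<beta>0 \<nu>0 \<alpha>' \<beta>' \<nu>'"
  shows "\<alpha>' t = \<alpha> t \<and> \<beta>' t = \<beta> t \<and> \<nu>' t = \<nu> t"
proof -
  have T: "T \<ge> 0" using assms(5) by simp
  obtain l h where lh: "l > 0" "\<And>t \<alpha> \<beta> \<nu>. t \<in> {0..T} \<Longrightarrow> solves_ivp V {0..t} \<alpha>0 \<beta>0 \<nu>0 \<alpha> \<beta> \<nu> \<Longrightarrow>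
      \<alpha> t \<in> {l..h} \<and> \<beta> t \<in> {l..h} \<and> \<nu> t \<in> {l..h}"
    by (rule apriori_bounds[OF assms(1-4) T]) (rule that; blast)
  define K where "K = cbox (l, l, l) (h, h, h)"
  have "K \<subseteq> phase_space" using lh(1) by (auto simp: K_def cbox_cube phase_space_def)
  then obtain L where L: "L-lipschitz_on K (kl_field V)"
    using lipschitz_kl_field[OF assms(1), of K] by (auto simp: K_def)
  have inK: "ode_solution (kl_field V) K {0..T} (\<lambda>t. (\<alpha> t, \<beta> t, \<nu> t))"
    if s: "solves_ivp V {0..T} \<alpha>0 \<beta>0 \<nu>0 \<alpha> \<beta> \<nu>" for \<alpha> \<beta> \<nu>
  proof -
    have "(\<alpha> t, \<beta> t, \<nu> t) \<in> K" if "t \<in> {0..T}" for t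
      using lh(2)[OF that solves_ivp_mono[OF s]] that by (auto simp: K_def cbox_cube)
    moreover have "ode_solution (kl_field V) phase_space {0..T} (\<lambda>t. (\<alpha> t, \<beta> t, \<nu> t))"
      using s by (simp add: solves_ivp_def solves_system_iff)
    ultimately show ?thesis by (simp add: ode_solution_def)
  qed
  have "(\<lambda>t. (\<alpha>' t, \<beta>' t, \<nu>' t)) t = (\<lambda>t. (\<alpha> t, \<beta> t, \<nu> t)) t"
    by (rule ode_solution_unique[OF L inK[OF sol(2)] inK[OF sol(1)]])
      (use sol assms in \<open>auto simp: solves_ivp_def\<close>)
  then show ?thesis by simp
qed

lemma ode_solution_iff_ivp:
  "x 0 = (\<alpha>0, \<beta>0, \<nu>0) \<and> ode_solution (kl_field V) phase_space J x \<longleftrightarrow>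
    solves_ivp V J \<alpha>0 \<beta>0 \<nu>0 (\<lambda>t. fst (x t)) (\<lambda>t. fst (snd (x t))) (\<lambda>t. snd (snd (x t)))"
  by (auto simp: solves_ivp_def solves_system_iff prod_eq_iff)

lemma ivp_exists:
  assumes "V > 0" "\<alpha>0 > 0" "\<beta>0 > 0" "\<nu>0 > 0"
  shows "\<exists>\<alpha> \<beta> \<nu>. solves_ivp V {0..} \<alpha>0 \<beta>0 \<nu>0 \<alpha> \<beta> \<nu>"
proof -
  have "\<exists>x. x 0 = (\<alpha>0, \<beta>0, \<nu>0) \<and> ode_solution (kl_field V) phase_space {0..} x"
  proof (rule ode_solution_glue)
    fix T :: real assume "T > 0"
    obtain l h where lh: "l > 0" "\<And>t \<alpha> \<beta> \<nu>. t \<in> {0..T} \<Longrightarrow> solves_ivp V {0..t} \<alpha>0 \<beta>0 \<nu>0 \<alpha> \<beta> \<nu> \<Longrightarrow>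
        \<alpha> t \<in> {l..h} \<and> \<beta> t \<in> {l..h} \<and> \<nu> t \<in> {l..h}"
      by (rule apriori_bounds[OF assms(1-4) less_imp_le[OF \<open>T > 0\<close>]]) (rule that; blast)
    \<comment> \<open>the a priori box, and a larger one in the phase space with it in its interior\<close>
    define K where "K = cbox (l, l, l) (h, h, h)"
    define a where "a = (l / 2, l / 2, l / 2)"
    define b where "b = (h + 1, h + 1, h + 1)"
    have box: "box a b = {l/2<..<h+1} \<times> {l/2<..<h+1} \<times> {l/2<..<h+1}"
      unfolding a_def b_def by (simp add: box_prod)
    have KB: "K \<subseteq> box a b" using lh(1) by (auto simp: K_def cbox_cube box)
    have sub: "cbox a b \<subseteq> phase_space" using lh(1) by (auto simp: a_def b_def cbox_cube phase_space_def)
    then obtain L where L: "L-lipschitz_on (cbox a b) (kl_field V)"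
      using lipschitz_kl_field[OF assms(1), of "cbox a b"] by auto
    have sub': "box a b \<subseteq> phase_space" using sub box_subset_cbox by blast
    have bound: "x t \<in> K" if "t \<in> {0..T}" "x 0 = (\<alpha>0, \<beta>0, \<nu>0)" "ode_solution (kl_field V) phase_space {0..t} x" for x t
    proof -
      have "fst (x t) \<in> {l..h} \<and> fst (snd (x t)) \<in> {l..h} \<and> snd (snd (x t)) \<in> {l..h}"
        by (rule lh(2)[OF that(1)]) (use that(2,3) ode_solution_iff_ivp in blast)
      then show ?thesis by (auto simp: K_def cbox_cube mem_Times_iff)
    qed
    have "\<exists>x. x 0 = (\<alpha>0, \<beta>0, \<nu>0) \<and> ode_solution (kl_field V) K {0..T} x"
    proof (rule ode_solution_in_box[OF L _ _ KB])
      have "ode_solution (kl_field V) phase_space {0..0} (\<lambda>_. (\<alpha>0, \<beta>0, \<nu>0))"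
        using assms by (simp add: ode_solution_def phase_space_def has_vector_derivative_def has_derivative_within_singleton_iff bounded_linear_scaleR_left)
      then show "(\<alpha>0, \<beta>0, \<nu>0) \<in> K" using bound[of 0 "\<lambda>_. (\<alpha>0, \<beta>0, \<nu>0)"] \<open>T > 0\<close> by simp
      show "closed K" by (simp add: K_def closed_cbox)
      show "x t \<in> K" if "t \<in> {0..T}" "x 0 = (\<alpha>0, \<beta>0, \<nu>0)" "ode_solution (kl_field V) (box a b) {0..t} x" for x t
      proof (rule bound[where x = x and t = t])
        show "ode_solution (kl_field V) phase_space {0..t} x"
          using that(3) sub' by (auto simp: ode_solution_def)
      qed fact+
    qed
    then show "\<exists>x. x 0 = (\<alpha>0, \<beta>0, \<nu>0) \<and> ode_solution (kl_field V) phase_space {0..T} x"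
      using KB sub' unfolding ode_solution_def by blast
  next
    fix T t :: real and x y
    assume xy: "x 0 = (\<alpha>0, \<beta>0, \<nu>0)" "y 0 = (\<alpha>0, \<beta>0, \<nu>0)" "ode_solution (kl_field V) phase_space {0..T} x"
      "ode_solution (kl_field V) phase_space {0..T} y" and t: "t \<in> {0..T}"
    have "fst (x t) = fst (y t) \<and> fst (snd (x t)) = fst (snd (y t)) \<and> snd (snd (x t)) = snd (snd (y t))"
      by (rule ivp_unique[OF assms t]) (use xy ode_solution_iff_ivp in blast)+
    then show "x t = y t" by (simp add: prod_eq_iff)
  qed
  then show ?thesis unfolding ode_solution_iff_ivp by blast
qed

section \<open>Long-time behaviour\<close>

lemma drift_bounded_away:
  assumes "0 < a\<^sub>1" "0 < s\<^sub>1"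
  shows "\<exists>\<delta>>0. \<forall>a\<in>{a\<^sub>1..a\<^sub>2}. \<forall>s\<in>{s\<^sub>1..s\<^sub>2}. \<delta> \<le> max (shape_drift a s) (scale_drift a s)"
proof (cases "{a\<^sub>1..a\<^sub>2} \<times> {s\<^sub>1..s\<^sub>2} = {}")
  case True
  then show ?thesis by (auto intro!: exI[of _ 1])
next
  case False
  define R where "R = {a\<^sub>1..a\<^sub>2} \<times> {s\<^sub>1..s\<^sub>2}"
  have D: "continuous_on {0<..} digamma_gap"
    by (rule DERIV_continuous_on) (auto intro: has_field_derivative_at_within DERIV_digamma_gap)
  have G: "continuous_on {0<..} log_mean"
    by (rule DERIV_continuous_on) (auto intro: has_field_derivative_at_within DERIV_log_mean)
  have h: "continuous_on {0<..} shrinkage"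
    by (rule DERIV_continuous_on) (auto intro: has_field_derivative_at_within DERIV_shrinkage)
  have "continuous_on R (\<lambda>u. max (shape_drift (fst u) (snd u)) (scale_drift (fst u) (snd u)))"
    unfolding shape_drift_def scale_drift_def
    by (intro continuous_intros continuous_on_compose2[OF D] continuous_on_compose2[OF G]
        continuous_on_compose2[OF h]) (use assms in \<open>auto simp: R_def\<close>)
  moreover have "compact R" by (simp add: R_def compact_Times)
  moreover have "R \<noteq> {}" using False by (simp add: R_def)
  ultimately obtain u where u: "u \<in> R"
    "\<And>v. v \<in> R \<Longrightarrow> max (shape_drift (fst u) (snd u)) (scale_drift (fst u) (snd u))
      \<le> max (shape_drift (fst v) (snd v)) (scale_drift (fst v) (snd v))"
    using continuous_attains_inf by (metis (no_types, lifting))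
  have "0 < max (shape_drift (fst u) (snd u)) (scale_drift (fst u) (snd u))"
    using drift_dichotomy[of "fst u" "snd u"] u(1) assms by (auto simp: R_def less_max_iff_disj)
  moreover have "max (shape_drift (fst u) (snd u)) (scale_drift (fst u) (snd u)) \<le> max (shape_drift a s) (scale_drift a s)"
    if "a \<in> {a\<^sub>1..a\<^sub>2}" "s \<in> {s\<^sub>1..s\<^sub>2}" for a s
    using u(2)[of "(a, s)"] that by (simp add: R_def)
  ultimately show ?thesis by blast
qed

lemma unbounded_if_derivative_bounded_below:
  fixes f :: "real \<Rightarrow> real"
  assumes der: "\<And>t. t \<ge> t0 \<Longrightarrow> (f has_real_derivative f' t) (at t within {t0..})"
    and "\<delta> > 0" "\<And>t. t \<ge> t0 \<Longrightarrow> \<delta> \<le> f' t"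
  shows "\<exists>t\<ge>t0. B < f t"
proof -
  define t where "t = t0 + (\<bar>B - f t0\<bar> + 1) / \<delta>"
  have t: "t \<ge> t0" using assms(2) by (simp add: t_def)
  have "\<delta> * t - f t \<le> \<delta> * t0 - f t0"
  proof (rule nonincreasing_if_derivative_within_nonpos[where w = "\<lambda>t. \<delta> * t - f t" and w' = "\<lambda>t. \<delta> - f' t", OF t])
    fix u assume "u \<in> {t0..t}"
    then have "(f has_real_derivative f' u) (at u within {t0..t})"
      by (intro DERIV_subset[OF der]) auto
    then show "((\<lambda>t. \<delta> * t - f t) has_real_derivative \<delta> - f' u) (at u within {t0..t})"
      by (auto intro!: derivative_eq_intros)
  qed (use assms(3) in auto)
  moreover have "\<delta> * t = \<delta> * t0 + \<bar>B - f t0\<bar> + 1"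
    using assms(2) unfolding t_def distrib_left[of \<delta> t0] by simp
  ultimately have "B < f t" by linarith
  then show ?thesis using t by blast
qed

locale global_trajectory = trajectory V \<alpha> \<beta> \<nu> "{0..}" for V \<alpha> \<beta> \<nu>
begin

definition p where "p t = shape_drift (\<alpha> t) (s t)"
definition q where "q t = scale_drift (\<alpha> t) (s t)"

lemma pos_at: "t \<ge> 0 \<Longrightarrow> \<alpha> t > 0" "t \<ge> 0 \<Longrightarrow> \<beta> t > 0" "t \<ge> 0 \<Longrightarrow> \<nu> t > 0" "t \<ge> 0 \<Longrightarrow> s t > 0" "t \<ge> 0 \<Longrightarrow> ratio_rate t > 0"
  using pos by auto

lemma deriv_from:
  assumes "t \<ge> t0" "t0 \<ge> 0"
  shows "(\<alpha> has_real_derivative p t) (at t within {t0..})"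
    and "(s has_real_derivative ratio_rate t * q t) (at t within {t0..})"
  using deriv[of t "{t0..}"] assms by (auto simp: p_def q_def)

lemma p_or_q_pos: "t \<ge> 0 \<Longrightarrow> p t > 0 \<or> q t > 0"
  using drift_dichotomy pos_at by (simp add: p_def q_def)

text \<open>On the compact rectangle the larger drift is at least some \<open>\<delta> > 0\<close>, so \<open>s\<close>, or \<open>\<alpha>\<close>, or a
positive combination of both grows at least linearly.\<close>

lemma not_confined:
  assumes t0: "t0 \<ge> 0" and bd: "\<And>t. t \<ge> t0 \<Longrightarrow> \<alpha> t \<le> K" "\<And>t. t \<ge> t0 \<Longrightarrow> s t \<le> M"
    and signs: "(\<forall>t\<ge>t0. 0 \<le> p t \<and> 0 \<le> q t) \<or> (\<forall>t\<ge>t0. p t \<le> 0) \<or> (\<forall>t\<ge>t0. q t \<le> 0)"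
  shows False
proof -
  obtain a b where trap: "0 < a" "balance a < b" "b < a - A a" "a < \<alpha> 0" "b < s 0"
    using exists_trap[of "\<alpha> 0" "s 0"] pos_at by auto
  have b: "b > 0" using balance_root(1)[OF trap(1)] trap by simp
  have low: "a < \<alpha> t" "b < s t" if "t \<ge> 0" for t
    using trapped[of t t a b] trap that by auto
  define C where "C = energy 0"
  have C: "energy t = C" if "t \<ge> 0" for t
    using energy_const[of t 0] that by (simp add: C_def)
  have C0: "C > 0" unfolding C_def energy_def using pos_at[of 0] by (intro add_pos_pos) auto
  obtain \<delta> where \<delta>: "\<delta> > 0" "\<And>x y. x \<in> {a..K} \<Longrightarrow> y \<in> {b..M} \<Longrightarrow> \<delta> \<le> max (shape_drift x y) (scale_drift x y)"
    using drift_bounded_away[OF trap(1) b] by metis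
  have max: "\<delta> \<le> max (p t) (q t)" if "t \<ge> t0" for t
    unfolding p_def q_def using \<delta>(2)[of "\<alpha> t" "s t"] bd[OF that] low[of t] that t0 by auto
  have stiff: "b / C \<le> ratio_rate t" if "t \<ge> t0" for t
  proof -
    have "b / C \<le> s t / C" using low[of t] that t0 C0 by (intro divide_right_mono) auto
    also have "\<dots> \<le> ratio_rate t" using ratio_rate_lower[of t] C[of t] that t0 by simp
    finally show ?thesis .
  qed
  from signs consider "\<forall>t\<ge>t0. 0 \<le> p t \<and> 0 \<le> q t" | "\<forall>t\<ge>t0. p t \<le> 0" | "\<forall>t\<ge>t0. q t \<le> 0" by blast
  then show False
  proof cases
    case 1
    \<comment> \<open>the weight compensates the lower bound \<open>b/C\<close> for the rate of \<open>s\<close>\<close>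
    define f where "f t = \<alpha> t + (C / b) * s t" for t
    have "\<exists>t\<ge>t0. K + (C / b) * M < f t"
    proof (rule unbounded_if_derivative_bounded_below[OF _ \<delta>(1)])
      fix t assume t: "t \<ge> t0"
      show "(f has_real_derivative p t + (C / b) * (ratio_rate t * q t)) (at t within {t0..})"
        unfolding f_def by (intro DERIV_add DERIV_cmult deriv_from t t0)
      have "q t = (C / b) * ((b / C) * q t)" using b C0 by simp
      also have "\<dots> \<le> (C / b) * (ratio_rate t * q t)"
        using stiff[OF t] 1 t b C0 by (intro mult_left_mono mult_right_mono) auto
      finally have "q t \<le> (C / b) * (ratio_rate t * q t)" .
      then show "\<delta> \<le> p t + (C / b) * (ratio_rate t * q t)"
        using max[OF t] 1 t by (auto simp: le_max_iff_disj intro: order_trans)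
    qed
    moreover have "f t \<le> K + (C / b) * M" if "t \<ge> t0" for t
      unfolding f_def using bd[OF that] b C0 by (intro add_mono mult_left_mono) auto
    ultimately show False by (meson not_le)
  next
    case 2
    have "\<exists>t\<ge>t0. M < s t"
    proof (rule unbounded_if_derivative_bounded_below)
      fix t assume t: "t \<ge> t0"
      show "(s has_real_derivative ratio_rate t * q t) (at t within {t0..})" by (rule deriv_from[OF t t0])
      have "\<delta> \<le> q t" using max[OF t] 2 t \<delta>(1) by (auto simp: le_max_iff_disj)
      then show "b / C * \<delta> \<le> ratio_rate t * q t"
        using stiff[OF t] b C0 \<delta>(1) by (intro mult_mono) (auto intro: order_trans[OF _ stiff[OF t]])
    qed (use b C0 \<delta>(1) in auto)
    then show False using bd(2) by (meson not_le)
  next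
    case 3
    have "\<exists>t\<ge>t0. K < \<alpha> t"
    proof (rule unbounded_if_derivative_bounded_below[OF _ \<delta>(1)])
      fix t assume t: "t \<ge> t0"
      show "(\<alpha> has_real_derivative p t) (at t within {t0..})" by (rule deriv_from[OF t t0])
      show "\<delta> \<le> p t" using max[OF t] 3 t \<delta>(1) by (auto simp: le_max_iff_disj)
    qed
    then show False using bd(1) by (meson not_le)
  qed
qed

lemma nonincreasing_from_0:
  assumes "0 \<le> t" and "\<And>t. t \<ge> 0 \<Longrightarrow> (f has_real_derivative f' t) (at t within {0..})" "\<And>t. t \<ge> 0 \<Longrightarrow> f' t \<le> 0"
  shows "f t \<le> f 0"
proof (rule nonincreasing_if_derivative_within_nonpos[where w = f and w' = f', OF assms(1)])
  fix u assume u: "u \<in> {0..t}"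
  show "(f has_real_derivative f' u) (at u within {0..t})"
    by (rule DERIV_subset[OF assms(2)]) (use u in auto)
  show "f' u \<le> 0" using assms(3) u by simp
qed

text \<open>Outside the region exactly one drift is positive, and which one cannot change: equality of the drifts in
between would make both positive. If always \<open>p \<le> 0\<close>, then \<open>\<alpha>\<close> decreases and bounds \<open>s\<close> through
\<open>balance\<close>; if always \<open>q \<le> 0\<close>, then \<open>s\<close> decreases and bounds \<open>\<alpha>\<close> through \<open>\<alpha> - A \<alpha> \<le> s\<close>. Both are
impossible for a trajectory with constant signs.\<close>

lemma enters_region: "\<exists>t0\<ge>0. p t0 > 0 \<and> q t0 > 0"
proof (rule ccontr)
  assume "\<not> ?thesis"
  then have out: "p t \<le> 0 \<or> q t \<le> 0" if "t \<ge> 0" for t using that by (meson not_le)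
  have contp: "continuous_on {0..} (\<lambda>t. p t - q t)"
  proof (intro continuous_on_diff)
    show "continuous_on {0..} p" unfolding p_def
      by (rule DERIV_continuous_on, rule DERIV_shape_drift[OF deriv(1,4)[OF _ order_refl]]) (use pos in auto)
    show "continuous_on {0..} q" unfolding q_def
      by (rule DERIV_continuous_on, rule DERIV_scale_drift[OF deriv(1,4)[OF _ order_refl]]) (use pos in auto)
  qed
  have ne: "p t \<noteq> q t" if "t \<ge> 0" for t using out[OF that] p_or_q_pos[OF that] by auto
  have same_sign: "p 0 < q 0 \<longleftrightarrow> p t < q t" if "t \<ge> 0" for t
  proof (rule ccontr)
    assume "\<not> ?thesis"
    then have "(p 0 - q 0 \<le> 0 \<and> 0 \<le> p t - q t) \<or> (p t - q t \<le> 0 \<and> 0 \<le> p 0 - q 0)" by auto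
    then obtain u where "0 \<le> u" "p u - q u = 0"
      using IVT'[of "\<lambda>t. p t - q t" 0 0 t] IVT2'[of "\<lambda>t. p t - q t" t 0 0] \<open>t \<ge> 0\<close>
        continuous_on_subset[OF contp, of "{0..t}"] by auto
    then show False using ne by simp
  qed
  show False
  proof (cases "p 0 < q 0")
    case True
    then have p: "p t \<le> 0" if "t \<ge> 0" for t using same_sign[OF that] out[OF that] that by auto
    have a: "\<alpha> t \<le> \<alpha> 0" if "t \<ge> 0" for t
      using nonincreasing_from_0[of t \<alpha> p] that p deriv_from(1)[of 0] by simp
    have "s t \<le> balance (\<alpha> 0)" if "t \<ge> 0" for t
    proof -
      have "s t \<le> balance (\<alpha> t)"
        using p[OF that] drift_sign_iff(1)[of "\<alpha> t" "s t"] pos_at[OF that] by (auto simp: p_def)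
      also have "\<dots> \<le> balance (\<alpha> 0)"
        using strict_mono_balance[of "\<alpha> t" "\<alpha> 0"] a[OF that] pos_at[OF that] by (cases "\<alpha> t = \<alpha> 0") auto
      finally show ?thesis .
    qed
    then show False using not_confined[of 0 "\<alpha> 0" "balance (\<alpha> 0)"] a p by auto
  next
    case False
    then have q: "q t \<le> 0" if "t \<ge> 0" for t using same_sign[OF that] out[OF that] that by auto
    have s: "s t \<le> s 0" if "t \<ge> 0" for t
      using nonincreasing_from_0[of t s "\<lambda>t. ratio_rate t * q t"] that q deriv_from(2)[of 0] pos_at(5)
      by (simp add: mult_nonneg_nonpos less_imp_le)
    obtain K where K: "K > 0" "s 0 < K - A K"
      using filterlim_at_top_dense[THEN iffD1, OF root_at_top, rule_format, of "s 0"] eventually_gt_at_top[of 0]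
      by (metis (mono_tags, lifting) eventually_conj eventually_happens trivial_limit_at_top_linorder)
    have "\<alpha> t \<le> K" if "t \<ge> 0" for t
    proof (rule ccontr)
      assume "\<not> \<alpha> t \<le> K"
      then have "K - A K < \<alpha> t - A (\<alpha> t)" using strict_mono_root[OF K(1)] by simp
      moreover have "\<alpha> t - A (\<alpha> t) \<le> s t"
        using q[OF that] drift_sign_iff(2)[of "\<alpha> t" "s t"] pos_at[OF that] by (auto simp: q_def)
      ultimately show False using K(2) s[OF that] by simp
    qed
    then show False using not_confined[of 0 K "s 0"] s q by auto
  qed
qed

lemma region_stays:
  assumes "0 \<le> t0" "p t0 > 0" "q t0 > 0" "t0 \<le> t" shows "p t > 0 \<and> q t > 0"
  using drift_invariant[of t0 t t] assms by (auto simp: p_def q_def)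

text \<open>In the region \<open>\<alpha>\<close> increases, and a bound for \<open>\<alpha>\<close> would also bound \<open>s < \<alpha> - A \<alpha>\<close>.\<close>

lemma shape_at_top: "filterlim \<alpha> at_top at_top"
proof -
  obtain t0 where t0: "t0 \<ge> 0" "p t0 > 0" "q t0 > 0" using enters_region by blast
  have pq: "p t > 0" "q t > 0" if "t \<ge> t0" for t using region_stays t0 that by blast+
  have mono: "\<alpha> u \<le> \<alpha> t" if "t0 \<le> u" "u \<le> t" for u t
  proof -
    have "- \<alpha> t \<le> - \<alpha> u"
    proof (rule nonincreasing_if_derivative_within_nonpos[where w = "\<lambda>t. - \<alpha> t" and w' = "\<lambda>t. - p t", OF that(2)])
      fix x assume x: "x \<in> {u..t}"
      then show "((\<lambda>t. - \<alpha> t) has_real_derivative - p x) (at x within {u..t})"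
        using that t0 by (intro DERIV_minus DERIV_subset[OF deriv_from(1)[of t0]]) auto
      show "- p x \<le> 0" using pq[of x] x that by simp
    qed
    then show ?thesis by simp
  qed
  have "\<exists>u\<ge>t0. K < \<alpha> u" for K
  proof (rule ccontr)
    assume "\<not> ?thesis"
    then have a: "\<alpha> t \<le> K" if "t \<ge> t0" for t using that by (meson not_le)
    have K0: "K > 0" using a[of t0] pos_at(1)[OF t0(1)] by simp
    have "s t \<le> K - A K" if "t \<ge> t0" for t
    proof -
      have t: "t \<ge> 0" using that t0 by simp
      have "s t < \<alpha> t - A (\<alpha> t)"
        using pq(2)[OF that] drift_sign_iff(2)[of "\<alpha> t" "s t"] pos_at[OF t] by (simp add: q_def)
      also have "\<dots> \<le> K - A K"
        using strict_mono_root[of "\<alpha> t" K] a[OF that] pos_at[OF t] by (cases "\<alpha> t = K") auto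
      finally show ?thesis by simp
    qed
    moreover have "\<forall>t\<ge>t0. 0 \<le> p t \<and> 0 \<le> q t" using pq less_imp_le by blast
    ultimately show False using not_confined[OF t0(1), of K "K - A K"] a by blast
  qed
  then show ?thesis unfolding filterlim_at_top eventually_at_top_linorder
    by (metis less_imp_le mono order_trans)
qed

text \<open>In the region, \<open>s\<close> lies above \<open>balance \<alpha>\<close>.\<close>

lemma ratio_at_top: "filterlim s at_top at_top"
proof (rule filterlim_at_top_mono)
  show "filterlim (\<lambda>t. balance (\<alpha> t)) at_top at_top"
    using balance_at_top shape_at_top by (rule filterlim_compose)
  obtain t0 where t0: "t0 \<ge> 0" "p t0 > 0" "q t0 > 0" using enters_region by blast
  show "\<forall>\<^sub>F t in at_top. balance (\<alpha> t) \<le> s t"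
    using eventually_ge_at_top[of t0]
  proof eventually_elim
    case (elim t)
    then show ?case
      using region_stays[OF t0] drift_sign_iff(1)[of "\<alpha> t" "s t"] pos_at[of t] t0(1) by (simp add: p_def)
  qed
qed

lemma nu_tendsto: "(\<nu> \<longlongrightarrow> 0) at_top"
proof -
  define C where "C = energy 0"
  define B where "B = (C + 1) * (C + 2) / V"
  show ?thesis
  proof (rule tendsto_sandwich[of "\<lambda>_. 0" _ _ "\<lambda>t. B / s t"])
    show "\<forall>\<^sub>F t in at_top. 0 \<le> \<nu> t"
      using eventually_ge_at_top[of 0] by eventually_elim (use pos_at in \<open>auto intro: less_imp_le\<close>)
    show "\<forall>\<^sub>F t in at_top. \<nu> t \<le> B / s t"
      using eventually_ge_at_top[of 0]
    proof eventually_elim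
      case (elim t)
      have t: "t \<in> {0..}" using elim by simp
      have "energy t = C" using energy_const[of t 0] elim by (simp add: C_def)
      note cb = coordinate_bounds[OF t half_gt_zero[OF pos_at(4)[OF elim]] _ _ this, of "s t + 1"]
      have "\<beta> t \<le> C + 1" "\<nu> t \<le> C + 1" using cb pos_at(4)[OF elim] by auto
      then have "\<beta> t * (\<nu> t + 1) \<le> (C + 1) * (C + 2)"
        using pos_at[OF elim] by (intro mult_mono) auto
      moreover have "\<nu> t * s t = \<beta> t * (\<nu> t + 1) / V" using pos_at[OF elim] by (simp add: s_def sig_def)
      ultimately have "\<nu> t * s t \<le> B" using V by (simp add: B_def divide_right_mono)
      then show ?case using pos_at(4)[OF elim] by (simp add: le_divide_eq)
    qed
    show "((\<lambda>t. B / s t) \<longlongrightarrow> 0) at_top"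
      by (rule tendsto_divide_0[OF tendsto_const filterlim_at_top_imp_at_infinity[OF ratio_at_top]])
  qed auto
qed

lemma beta_tendsto: "(\<beta> \<longlongrightarrow> sqrt (energy 0)) at_top"
proof (rule Lim_transform_eventually)
  have "((\<lambda>t. sqrt (energy 0 - (\<nu> t)\<^sup>2 - 2 * (\<nu> t) ^ 3 / 3)) \<longlongrightarrow> sqrt (energy 0 - 0\<^sup>2 - 2 * 0 ^ 3 / 3)) at_top"
    by (intro tendsto_intros nu_tendsto) auto
  then show "((\<lambda>t. sqrt (energy 0 - (\<nu> t)\<^sup>2 - 2 * (\<nu> t) ^ 3 / 3)) \<longlongrightarrow> sqrt (energy 0)) at_top" by simp
  show "\<forall>\<^sub>F t in at_top. sqrt (energy 0 - (\<nu> t)\<^sup>2 - 2 * (\<nu> t) ^ 3 / 3) = \<beta> t"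
    using eventually_ge_at_top[of 0]
  proof eventually_elim
    case (elim t)
    have "energy 0 - (\<nu> t)\<^sup>2 - 2 * (\<nu> t) ^ 3 / 3 = (\<beta> t)\<^sup>2"
      using energy_const[of t 0] elim by (simp add: energy_def)
    then show ?case using pos_at(2)[OF elim] by simp
  qed
qed

end

lemma S_star_iff:
  assumes "V > 0" "\<alpha> > 0" "\<beta> > 0" "\<nu> > 0"
  shows "(\<alpha>, \<beta>, \<nu>) \<in> S_star V (\<lambda>a. V * balance a) \<longleftrightarrow>
    shape_drift \<alpha> (sig \<beta> \<nu> / V) > 0 \<and> scale_drift \<alpha> (sig \<beta> \<nu> / V) > 0"
proof -
  have "sig \<beta> \<nu> / V > 0" using assms by (simp add: sig_def)
  from drift_sign_iff[OF assms(2) this] show ?thesis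
    using assms unfolding S_star_def sigma_kappa_def sig_def[symmetric]
    by (simp add: less_divide_eq divide_less_eq mult.commute)
qed

text \<open>The curve is the graph of \<open>y x = sqrt (C - x\<^sup>2 - 2x\<^sup>3/3)\<close> over the interval of those
\<open>x > 0\<close> at which the radicand is positive.\<close>

lemma integral_curve_level_curve:
  assumes "C > 0"
  shows "is_integral_curve (\<lambda>\<nu> \<beta>. - (\<nu> * (\<nu> + 1) / \<beta>)) (level_curve C)"
proof -
  define e where "e x = x\<^sup>2 + 2 * x ^ 3 / 3" for x :: real
  define I where "I = {x. 0 < x \<and> e x < C}"
  define y where "y x = sqrt (C - e x)" for x
  have mono: "e x \<le> e z" if "0 < x" "x \<le> z" for x z
    unfolding e_def using that by (intro add_mono divide_right_mono mult_left_mono power_mono) auto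
  have "open I"
    unfolding I_def e_def by (intro open_Collect_conj open_Collect_less continuous_intros) auto
  moreover have "is_interval I"
    unfolding is_interval_1 I_def by (smt (verit) mem_Collect_eq mono)
  moreover have "I \<noteq> {}"
  proof -
    have "(e \<longlongrightarrow> 0) (at_right 0)" unfolding e_def by real_asymp
    from order_tendstoD(2)[OF this assms] eventually_at_right_less
    have "\<forall>\<^sub>F x in at_right 0. e x < C \<and> 0 < x" by (rule eventually_conj)
    then show ?thesis by (auto dest!: eventually_happens simp: I_def)
  qed
  moreover have "(y has_real_derivative - (x * (x + 1) / y x)) (at x)" if "x \<in> I" for x
  proof -
    have "C - e x > 0" using that by (simp add: I_def)
    moreover have "(e has_real_derivative 2 * (x * (x + 1))) (at x)"
      unfolding e_def by (auto intro!: derivative_eq_intros simp: algebra_simps power2_eq_square)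
    ultimately show ?thesis
      unfolding y_def by (auto intro!: derivative_eq_intros simp: divide_simps)
  qed
  moreover have "level_curve C = (\<lambda>x. (x, y x)) ` I"
  proof (intro set_eqI iffI)
    fix z assume "z \<in> level_curve C"
    then obtain n b where z: "z = (n, b)" "n > 0" "b > 0" "b\<^sup>2 + e n = C"
      by (auto simp: level_curve_def e_def)
    then have "C - e n = b\<^sup>2" by simp
    moreover from this have "e n < C" using z(3) by (metis diff_gt_0_iff_gt zero_less_power)
    ultimately show "z \<in> (\<lambda>x. (x, y x)) ` I" using z by (auto simp: y_def I_def)
  next
    fix z assume "z \<in> (\<lambda>x. (x, y x)) ` I"
    then obtain x where x: "z = (x, y x)" "x > 0" "e x < C" by (auto simp: I_def)
    then have "y x > 0" "(y x)\<^sup>2 = C - e x" by (auto simp: y_def)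
    then show "z \<in> level_curve C" using x by (simp add: level_curve_def e_def)
  qed
  ultimately show ?thesis
    unfolding is_integral_curve_def by (intro exI[of _ I] exI[of _ y] conjI ballI) simp_all
qed

lemma forward_invariant_S_star:
  assumes "V > 0" shows "forward_invariant V (S_star V (\<lambda>a. V * balance a))"
  unfolding forward_invariant_def
proof (intro allI impI ballI)
  fix T \<alpha> \<beta> \<nu> t
  assume T: "T > 0" and sys: "solves_system V {0..<T} \<alpha> \<beta> \<nu>"
    and init: "(\<alpha> 0, \<beta> 0, \<nu> 0) \<in> S_star V (\<lambda>a. V * balance a)" and t: "t \<in> {0..<T}"
  interpret trajectory V \<alpha> \<beta> \<nu> "{0..<T}" by standard (use assms sys in auto)
  have zero: "0 \<in> {0..<T}" and sub: "{0..t} \<subseteq> {0..<T}" using t by auto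
  note p0 = pos[OF zero] and pt = pos[OF t]
  show "(\<alpha> t, \<beta> t, \<nu> t) \<in> S_star V (\<lambda>a. V * balance a)"
    using drift_invariant[OF sub, of t] init t S_star_iff[OF assms p0(1-3)] S_star_iff[OF assms pt(1-3)]
    by (simp add: s_def)
qed

lemma global_trajectoryI:
  assumes "V > 0" "solves_ivp V {0..} \<alpha>0 \<beta>0 \<nu>0 \<alpha> \<beta> \<nu>" shows "global_trajectory V \<alpha> \<beta> \<nu>"
  using assms by unfold_locales (auto simp: solves_ivp_def)

text \<open>By uniqueness the entry time of one solution serves for all solutions with the same initial values.\<close>

lemma eventually_in_S_star:
  assumes V: "V > 0" and init: "\<alpha>0 > 0" "\<beta>0 > 0" "\<nu>0 > 0"
  shows "\<exists>t0\<ge>0. \<forall>\<alpha> \<beta> \<nu>. solves_ivp V {0..} \<alpha>0 \<beta>0 \<nu>0 \<alpha> \<beta> \<nu> \<longrightarrow>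
    (\<forall>t>t0. (\<alpha> t, \<beta> t, \<nu> t) \<in> S_star V (\<lambda>a. V * balance a) \<and> deriv \<alpha> t > 0 \<and> deriv \<beta> t > 0 \<and> deriv \<nu> t < 0)"
proof -
  obtain a b n where ref: "solves_ivp V {0..} \<alpha>0 \<beta>0 \<nu>0 a b n" using ivp_exists[OF V init] by blast
  interpret ref: global_trajectory V a b n by (rule global_trajectoryI[OF V ref])
  obtain t0 where t0: "t0 \<ge> 0" "ref.p t0 > 0" "ref.q t0 > 0" using ref.enters_region by blast
  have "(\<alpha> t, \<beta> t, \<nu> t) \<in> S_star V (\<lambda>a. V * balance a) \<and> deriv \<alpha> t > 0 \<and> deriv \<beta> t > 0 \<and> deriv \<nu> t < 0"
    if ivp: "solves_ivp V {0..} \<alpha>0 \<beta>0 \<nu>0 \<alpha> \<beta> \<nu>" and t: "t > t0" for \<alpha> \<beta> \<nu> t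
  proof -
    interpret global_trajectory V \<alpha> \<beta> \<nu> by (rule global_trajectoryI[OF V ivp])
    have t': "t > 0" using t t0 by simp
    have eq: "\<alpha> t = a t \<and> \<beta> t = b t \<and> \<nu> t = n t"
      by (rule ivp_unique[OF V init, of t t]) (use solves_ivp_mono[OF ref] solves_ivp_mono[OF ivp] t' in auto)
    have pq: "p t > 0 \<and> q t > 0"
      using ref.region_stays[OF t0, of t] t eq by (simp add: p_def q_def ref.p_def ref.q_def s_def ref.s_def)
    have at: "at t within {0<..} = at t" using t' by (intro at_within_open) auto
    have d: "(\<alpha> has_real_derivative p t) (at t)" "(\<beta> has_real_derivative q t / \<beta> t) (at t)"
      "(\<nu> has_real_derivative - q t / (\<nu> t * (\<nu> t + 1))) (at t)"
    proof -
      have t: "t \<in> {0..}" "{0<..} \<subseteq> {0::real..}" using t' by auto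
      show "(\<alpha> has_real_derivative p t) (at t)" "(\<beta> has_real_derivative q t / \<beta> t) (at t)"
        "(\<nu> has_real_derivative - q t / (\<nu> t * (\<nu> t + 1))) (at t)"
        using deriv(1-3)[OF t] unfolding at p_def q_def by simp_all
    qed
    note ps = pos_at[of t]
    have "(\<alpha> t, \<beta> t, \<nu> t) \<in> S_star V (\<lambda>a. V * balance a)"
      using S_star_iff[OF V] ps t' pq by (simp add: p_def q_def s_def)
    then show ?thesis
      using d[THEN DERIV_imp_deriv] pq ps t' by (simp add: divide_neg_pos)
  qed
  then show ?thesis using t0(1) by blast
qed

theorem theorem3p2:
  fixes V :: real
  assumes "V > 0"
  shows
   "(\<comment> \<open>well-posedness: unique solutions, defined for all \<open>t \<ge> 0\<close>\<close>
     \<forall>\<alpha>0 > 0. \<forall>\<beta>0 > 0. \<forall>\<nu>0 > 0. \<exists>\<alpha> \<beta> \<nu>.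
       solves_ivp V {0..} \<alpha>0 \<beta>0 \<nu>0 \<alpha> \<beta> \<nu> \<and>
       (\<forall>T > 0. \<forall>\<alpha>' \<beta>' \<nu>'. solves_ivp V {0..<T} \<alpha>0 \<beta>0 \<nu>0 \<alpha>' \<beta>' \<nu>' \<longrightarrow>
          (\<forall>t\<in>{0..<T}. \<alpha>' t = \<alpha> t \<and> \<beta>' t = \<beta> t \<and> \<nu>' t = \<nu> t)))
    \<and>
    (\<exists>\<sigma>s :: real \<Rightarrow> real.
       \<comment> \<open>1\<close>
       smooth_on {0<..} \<sigma>s \<and> strict_mono_on {0<..} \<sigma>s \<and>
       (\<forall>\<alpha> > 0. \<forall>\<beta> > 0. \<forall>\<nu> > 0. sig \<beta> \<nu> = \<sigma>s \<alpha> \<longrightarrow> - E_dK_dalpha V \<alpha> \<beta> \<nu> = 0) \<and>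
       (\<sigma>s \<longlongrightarrow> 0) (at_right 0) \<and> filterlim \<sigma>s at_top at_top \<and>
       (\<forall>\<alpha> > 0. \<sigma>s \<alpha> < sigma_kappa V 0 \<alpha>) \<and>
       (\<forall>\<kappa> > 0. \<exists>\<alpha>\<kappa> > 0. \<forall>\<alpha> > \<alpha>\<kappa>. \<sigma>s \<alpha> > sigma_kappa V \<kappa> \<alpha>) \<and>
       forward_invariant V (S_star V \<sigma>s) \<and>
       \<comment> \<open>2\<close>
       (\<forall>\<alpha>0 > 0. \<forall>\<beta>0 > 0. \<forall>\<nu>0 > 0. \<exists>t0 \<ge> 0. \<forall>\<alpha> \<beta> \<nu>.
          solves_ivp V {0..} \<alpha>0 \<beta>0 \<nu>0 \<alpha> \<beta> \<nu> \<longrightarrow>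
          (\<forall>t > t0. (\<alpha> t, \<beta> t, \<nu> t) \<in> S_star V \<sigma>s \<and>
             deriv \<alpha> t > 0 \<and> deriv \<beta> t > 0 \<and> deriv \<nu> t < 0)))
    \<and>
    (\<comment> \<open>3\<close>
     \<forall>\<alpha>0 > 0. \<forall>\<beta>0 > 0. \<forall>\<nu>0 > 0. \<exists>C > 0.
       is_integral_curve (\<lambda>\<nu> \<beta>. - (\<nu> * (\<nu> + 1) / \<beta>)) (level_curve C) \<and>
       (\<forall>\<alpha> \<beta> \<nu>. solves_ivp V {0..} \<alpha>0 \<beta>0 \<nu>0 \<alpha> \<beta> \<nu> \<longrightarrow>
          (\<forall>t \<ge> 0. (\<nu> t, \<beta> t) \<in> level_curve C)))
    \<and>
    (\<comment> \<open>4\<close>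
     \<forall>\<alpha>0 > 0. \<forall>\<beta>0 > 0. \<forall>\<nu>0 > 0. \<forall>\<alpha> \<beta> \<nu>.
       solves_ivp V {0..} \<alpha>0 \<beta>0 \<nu>0 \<alpha> \<beta> \<nu> \<longrightarrow>
         filterlim \<alpha> at_top at_top \<and>
         ((\<lambda>t. A (\<alpha> t)) \<longlongrightarrow> 1) at_top \<and>
         (\<nu> \<longlongrightarrow> 0) at_top \<and>
         (\<beta> \<longlongrightarrow> sqrt (\<beta>0\<^sup>2 + \<nu>0\<^sup>2 + 2 * \<nu>0 ^ 3 / 3)) at_top)"
proof (intro conjI)
  show "\<forall>\<alpha>0>0. \<forall>\<beta>0>0. \<forall>\<nu>0>0. \<exists>\<alpha> \<beta> \<nu>.
       solves_ivp V {0..} \<alpha>0 \<beta>0 \<nu>0 \<alpha> \<beta> \<nu> \<and>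
       (\<forall>T > 0. \<forall>\<alpha>' \<beta>' \<nu>'. solves_ivp V {0..<T} \<alpha>0 \<beta>0 \<nu>0 \<alpha>' \<beta>' \<nu>' \<longrightarrow>
          (\<forall>t\<in>{0..<T}. \<alpha>' t = \<alpha> t \<and> \<beta>' t = \<beta> t \<and> \<nu>' t = \<nu> t))"
    (is "\<forall>\<alpha>0>0. \<forall>\<beta>0>0. \<forall>\<nu>0>0. ?P \<alpha>0 \<beta>0 \<nu>0")
  proof (intro allI impI)
    fix \<alpha>0 \<beta>0 \<nu>0 :: real assume init: "\<alpha>0 > 0" "\<beta>0 > 0" "\<nu>0 > 0"
    obtain \<alpha> \<beta> \<nu> where sol: "solves_ivp V {0..} \<alpha>0 \<beta>0 \<nu>0 \<alpha> \<beta> \<nu>" using ivp_exists[OF assms init] by blast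
    have "\<alpha>' t = \<alpha> t \<and> \<beta>' t = \<beta> t \<and> \<nu>' t = \<nu> t"
      if sol': "solves_ivp V {0..<T} \<alpha>0 \<beta>0 \<nu>0 \<alpha>' \<beta>' \<nu>'" and t: "t \<in> {0..<T}" for T \<alpha>' \<beta>' \<nu>' t
    proof (rule ivp_unique[OF assms init, where T = t and \<alpha> = \<alpha> and \<beta> = \<beta> and \<nu> = \<nu>
          and \<alpha>' = \<alpha>' and \<beta>' = \<beta>' and \<nu>' = \<nu>'])
      show "t \<in> {0..t}" using t by simp
      show "solves_ivp V {0..t} \<alpha>0 \<beta>0 \<nu>0 \<alpha> \<beta> \<nu>" by (rule solves_ivp_mono[OF sol]) auto
      show "solves_ivp V {0..t} \<alpha>0 \<beta>0 \<nu>0 \<alpha>' \<beta>' \<nu>'" by (rule solves_ivp_mono[OF sol']) (use t in auto)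
    qed
    with sol show "?P \<alpha>0 \<beta>0 \<nu>0" by blast
  qed
next
  let ?\<sigma> = "\<lambda>a. V * balance a"
  show "\<exists>\<sigma>s. smooth_on {0<..} \<sigma>s \<and> strict_mono_on {0<..} \<sigma>s \<and>
       (\<forall>\<alpha> > 0. \<forall>\<beta> > 0. \<forall>\<nu> > 0. sig \<beta> \<nu> = \<sigma>s \<alpha> \<longrightarrow> - E_dK_dalpha V \<alpha> \<beta> \<nu> = 0) \<and>
       (\<sigma>s \<longlongrightarrow> 0) (at_right 0) \<and> filterlim \<sigma>s at_top at_top \<and>
       (\<forall>\<alpha> > 0. \<sigma>s \<alpha> < sigma_kappa V 0 \<alpha>) \<and>
       (\<forall>\<kappa> > 0. \<exists>\<alpha>\<kappa> > 0. \<forall>\<alpha> > \<alpha>\<kappa>. \<sigma>s \<alpha> > sigma_kappa V \<kappa> \<alpha>) \<and>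
       forward_invariant V (S_star V \<sigma>s) \<and>
       (\<forall>\<alpha>0 > 0. \<forall>\<beta>0 > 0. \<forall>\<nu>0 > 0. \<exists>t0 \<ge> 0. \<forall>\<alpha> \<beta> \<nu>.
          solves_ivp V {0..} \<alpha>0 \<beta>0 \<nu>0 \<alpha> \<beta> \<nu> \<longrightarrow>
          (\<forall>t > t0. (\<alpha> t, \<beta> t, \<nu> t) \<in> S_star V \<sigma>s \<and>
             deriv \<alpha> t > 0 \<and> deriv \<beta> t > 0 \<and> deriv \<nu> t < 0))"
  proof (intro exI[of _ ?\<sigma>] conjI)
    show "smooth_on {0<..} ?\<sigma>" by (rule smooth_on_balance)
    show "strict_mono_on {0<..} ?\<sigma>"
      using strict_mono_balance assms by (intro strict_mono_onI) simp
    show "\<forall>\<alpha> > 0. \<forall>\<beta> > 0. \<forall>\<nu> > 0. sig \<beta> \<nu> = ?\<sigma> \<alpha> \<longrightarrow> - E_dK_dalpha V \<alpha> \<beta> \<nu> = 0"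
      using E_dK_eq(1)[OF assms] balance_root(2) assms by (simp add: shape_drift_def)
    show "(?\<sigma> \<longlongrightarrow> 0) (at_right 0)"
      using tendsto_mult_left[OF balance_at_right_0, of V] by simp
    show "filterlim ?\<sigma> at_top at_top"
      using filterlim_tendsto_pos_mult_at_top[OF tendsto_const assms balance_at_top] .
    show "\<forall>\<alpha> > 0. ?\<sigma> \<alpha> < sigma_kappa V 0 \<alpha>"
      using balance_less_root assms by (simp add: sigma_kappa_def mult.commute)
    show "\<forall>\<kappa> > 0. \<exists>\<alpha>\<kappa> > 0. \<forall>\<alpha> > \<alpha>\<kappa>. ?\<sigma> \<alpha> > sigma_kappa V \<kappa> \<alpha>"
    proof (intro allI impI)
      fix \<kappa> :: real assume "\<kappa> > 0"
      then obtain N where N: "\<And>a. a > N \<Longrightarrow> (1 - \<kappa> / a) * (a - A a) < balance a"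
        using balance_above_shrunk_root unfolding eventually_at_top_dense by blast
      then have "sigma_kappa V \<kappa> a < ?\<sigma> a" if "a > max N 1" for a
        using that assms mult_strict_right_mono[OF N, of a V] by (simp add: sigma_kappa_def mult.commute)
      then show "\<exists>\<alpha>\<kappa> > 0. \<forall>\<alpha> > \<alpha>\<kappa>. ?\<sigma> \<alpha> > sigma_kappa V \<kappa> \<alpha>"
        by (intro exI[of _ "max N 1"]) auto
    qed
    show "forward_invariant V (S_star V ?\<sigma>)" by (rule forward_invariant_S_star[OF assms])
  qed (use eventually_in_S_star[OF assms] in blast)
next
  show "\<forall>\<alpha>0 > 0. \<forall>\<beta>0 > 0. \<forall>\<nu>0 > 0. \<exists>C > 0.
       is_integral_curve (\<lambda>\<nu> \<beta>. - (\<nu> * (\<nu> + 1) / \<beta>)) (level_curve C) \<and>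
       (\<forall>\<alpha> \<beta> \<nu>. solves_ivp V {0..} \<alpha>0 \<beta>0 \<nu>0 \<alpha> \<beta> \<nu> \<longrightarrow>
          (\<forall>t \<ge> 0. (\<nu> t, \<beta> t) \<in> level_curve C))"
    (is "\<forall>\<alpha>0>0. \<forall>\<beta>0>0. \<forall>\<nu>0>0. ?P \<alpha>0 \<beta>0 \<nu>0")
  proof (intro allI impI)
    fix \<alpha>0 \<beta>0 \<nu>0 :: real assume init: "\<alpha>0 > 0" "\<beta>0 > 0" "\<nu>0 > 0"
    define C where "C = \<beta>0\<^sup>2 + \<nu>0\<^sup>2 + 2 * \<nu>0 ^ 3 / 3"
    have C: "C > 0" unfolding C_def using init by (intro add_pos_pos) auto
    have "(\<nu> t, \<beta> t) \<in> level_curve C"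
      if ivp: "solves_ivp V {0..} \<alpha>0 \<beta>0 \<nu>0 \<alpha> \<beta> \<nu>" and t: "t \<ge> 0" for \<alpha> \<beta> \<nu> t
    proof -
      interpret global_trajectory V \<alpha> \<beta> \<nu> by (rule global_trajectoryI[OF assms ivp])
      have "energy t = energy 0" using energy_const[of t 0] t by simp
      also have "\<dots> = C" using ivp by (simp add: energy_def C_def solves_ivp_def)
      finally show ?thesis using pos_at[OF t] by (simp add: level_curve_def energy_def)
    qed
    then show "?P \<alpha>0 \<beta>0 \<nu>0"
      using C integral_curve_level_curve[OF C] by blast
  qed
next
  show "\<forall>\<alpha>0 > 0. \<forall>\<beta>0 > 0. \<forall>\<nu>0 > 0. \<forall>\<alpha> \<beta> \<nu>.
       solves_ivp V {0..} \<alpha>0 \<beta>0 \<nu>0 \<alpha> \<beta> \<nu> \<longrightarrow>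
         filterlim \<alpha> at_top at_top \<and> ((\<lambda>t. A (\<alpha> t)) \<longlongrightarrow> 1) at_top \<and> (\<nu> \<longlongrightarrow> 0) at_top \<and>
         (\<beta> \<longlongrightarrow> sqrt (\<beta>0\<^sup>2 + \<nu>0\<^sup>2 + 2 * \<nu>0 ^ 3 / 3)) at_top"
    (is "\<forall>\<alpha>0>0. \<forall>\<beta>0>0. \<forall>\<nu>0>0. \<forall>\<alpha> \<beta> \<nu>. _ \<longrightarrow> ?P \<alpha>0 \<beta>0 \<nu>0 \<alpha> \<beta> \<nu>")
  proof (intro allI impI)
    fix \<alpha>0 \<beta>0 \<nu>0 :: real and \<alpha> \<beta> \<nu> assume ivp: "solves_ivp V {0..} \<alpha>0 \<beta>0 \<nu>0 \<alpha> \<beta> \<nu>"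
    interpret global_trajectory V \<alpha> \<beta> \<nu> by (rule global_trajectoryI[OF assms ivp])
    have "energy 0 = \<beta>0\<^sup>2 + \<nu>0\<^sup>2 + 2 * \<nu>0 ^ 3 / 3" using ivp by (simp add: energy_def solves_ivp_def)
    then show "?P \<alpha>0 \<beta>0 \<nu>0 \<alpha> \<beta> \<nu>"
      using shape_at_top filterlim_compose[OF A_tendsto shape_at_top] nu_tendsto beta_tendsto by simp
  qed
qed

end
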